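(* Let $\lambda=(\lambda_1,\dots,\lambda_I)$ and $\mu=(\mu_1,\dots,\mu_J)$ be partitions of $n$, and let $P$ be the random transpositions Markov chain on $\mathcal{T}_{\lambda,\mu}$ (defined in the context). Then: (a) Every eigenvalue of $P$ is of the form \[ \beta_\rho=\frac{1}{n}+\frac{1}{n^2}\sum_{j=1}^{k}\left[(\rho_j-j)(\rho_j-j+1)-j(j-1)\right] \] for some partition $\rho=(\rho_1,\dots,\rho_k)$ of $n$. (b) The eigenvalues of $P$, listed with multiplicity, are obtained by taking, for each partition $\rho$ of $n$, the value $\beta_\rho$ with multiplicity $m_\rho^\lambda\cdot m_\rho^\mu$, where $m_\rho^\lambda$ and $m_\rho^\mu$ are Kostka numbers. (c) The eigenfunctions of $P$ can be chosen to be polynomials in the table entries $(x_{ij})$ that are orthogonal in $\ell^2(\pi_{\lambda,\mu})$ (i.e. they are orthogonal polynomials for the Fisher–Yates distribution $\pi_{\lambda,\mu}$).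
   Context: For partitions $\lambda=(\lambda_1,\dots,\lambda_I)$, $\mu=(\mu_1,\dots,\mu_J)$ of $n$, $\mathcal{T}_{\lambda,\mu}$ is the set of $I\times J$ tables with nonnegative integer entries, row sums $\lambda_1,\dots,\lambda_I$ and column sums $\mu_1,\dots,\mu_J$. The Fisher–Yates distribution is $\pi_{\lambda,\mu}(T)=\frac{1}{n!}\prod_{i,j}\frac{\lambda_i!\,\mu_j!}{T_{ij}!}$ (product over all cells). For a table $T$ and indices $i_1\ne i_2$, $j_1\ne j_2$, $F_{(i_1,j_1),(i_2,j_2)}(T)$ is the table obtained from $T$ by subtracting $1$ from entries $(i_1,j_1)$ and $(i_2,j_2)$ and adding $1$ to entries $(i_1,j_2)$ and $(i_2,j_1)$. The random transpositions chain on $\mathcal{T}_{\lambda,\mu}$ has transition probabilities $P(T,T')=\frac{2T_{i_1j_1}T_{i_2j_2}}{n^2}$ if $T'=F_{(i_1,j_1),(i_2,j_2)}(T)\neq T$ (with $T_{i_1j_1}T_{i_2j_2}\ge 1$), $P(T,T)$ equal to the remaining probability mass, and $0$ otherwise. Equivalently, it is the image on tables of the random transpositions walk on $S_n$ (pick two positions independently and uniformly, possibly equal, and swap). The Kostka number $m_\rho^\lambda$ is the number of semistandard Young tableaux of shape $\rho$ and content $\lambda$, i.e. the number of ways to fill the Young diagram of $\rho$ with $\lambda_1$ symbols $1$, $\lambda_2$ symbols $2$, etc., so that rows weakly increase and columns strictly increase. *)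

theory Defs
  imports "Jordan_Normal_Form.Char_Poly" "HOL-Library.Multiset"
begin

type_synonym table = "nat \<Rightarrow> nat \<Rightarrow> nat"

definition is_partition :: "nat \<Rightarrow> nat list \<Rightarrow> bool" where
  "is_partition n \<rho> \<longleftrightarrow> sorted_wrt (\<ge>) \<rho> \<and> 0 \<notin> set \<rho> \<and> sum_list \<rho> = n"

definition partitions :: "nat \<Rightarrow> nat list set" where
  "partitions n = {\<rho>. is_partition n \<rho>}"

definition tables :: "nat list \<Rightarrow> nat list \<Rightarrow> table set" where
  "tables lam mu = {T. (\<forall>i j. (i \<ge> length lam \<or> j \<ge> length mu) \<longrightarrow> T i j = 0)
      \<and> (\<forall>i < length lam. (\<Sum>j<length mu. T i j) = lam ! i)
      \<and> (\<forall>j < length mu. (\<Sum>i<length lam. T i j) = mu ! j)}"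

definition fisher_yates :: "nat list \<Rightarrow> nat list \<Rightarrow> table \<Rightarrow> real" where
  "fisher_yates lam mu T =
     (\<Prod>i<length lam. fact (lam ! i)) * (\<Prod>j<length mu. fact (mu ! j)) /
     (fact (sum_list lam) * (\<Prod>i<length lam. \<Prod>j<length mu. fact (T i j)))"

definition flip :: "table \<Rightarrow> nat \<Rightarrow> nat \<Rightarrow> nat \<Rightarrow> nat \<Rightarrow> table" where
  "flip T i1 j1 i2 j2 = (\<lambda>i j.
     if (i, j) = (i1, j1) \<or> (i, j) = (i2, j2) then T i j - 1
     else if (i, j) = (i1, j2) \<or> (i, j) = (i2, j1) then T i j + 1
     else T i j)"

text \<open>Off-diagonal transition probability. Each unordered pair of cells
  {(i1,j1),(i2,j2)} with i1 \<noteq> i2, j1 \<noteq> j2 is counted once (normalised by i1 < i2);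
  distinct such pairs give distinct tables.\<close>
definition rt_move :: "nat list \<Rightarrow> nat list \<Rightarrow> table \<Rightarrow> table \<Rightarrow> real" where
  "rt_move lam mu T T' =
     (\<Sum>i1<length lam. \<Sum>i2<length lam. \<Sum>j1<length mu. \<Sum>j2<length mu.
        if i1 < i2 \<and> j1 \<noteq> j2 \<and> T' = flip T i1 j1 i2 j2
        then 2 * real (T i1 j1) * real (T i2 j2) / (real (sum_list lam))\<^sup>2 else 0)"

definition rt_chain :: "nat list \<Rightarrow> nat list \<Rightarrow> table \<Rightarrow> table \<Rightarrow> real" where
  "rt_chain lam mu T T' =
     (if T' = T then 1 - (\<Sum>T''\<in>tables lam mu - {T}. rt_move lam mu T T'')
      else rt_move lam mu T T')"

definition beta :: "nat \<Rightarrow> nat list \<Rightarrow> real" where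
  "beta n \<rho> = 1 / real n + 1 / (real n)\<^sup>2 *
     (\<Sum>j = 1..length \<rho>. (real (\<rho> ! (j - 1)) - real j) * (real (\<rho> ! (j - 1)) - real j + 1)
                           - real j * (real j - 1))"

definition cells :: "nat list \<Rightarrow> (nat \<times> nat) set" where
  "cells \<rho> = {(r, c). r < length \<rho> \<and> c < \<rho> ! r}"

definition ssyt :: "nat list \<Rightarrow> nat list \<Rightarrow> table set" where
  "ssyt \<rho> lam = {t.
      (\<forall>r c. (r, c) \<notin> cells \<rho> \<longrightarrow> t r c = 0)
    \<and> (\<forall>(r, c) \<in> cells \<rho>. 1 \<le> t r c \<and> t r c \<le> length lam)
    \<and> (\<forall>r c. (r, c) \<in> cells \<rho> \<and> (r, Suc c) \<in> cells \<rho> \<longrightarrow> t r c \<le> t r (Suc c))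
    \<and> (\<forall>r c. (r, c) \<in> cells \<rho> \<and> (Suc r, c) \<in> cells \<rho> \<longrightarrow> t r c < t (Suc r) c)
    \<and> (\<forall>s \<in> {1..length lam}. card {x \<in> cells \<rho>. t (fst x) (snd x) = s} = lam ! (s - 1))}"

definition kostka :: "nat list \<Rightarrow> nat list \<Rightarrow> nat" where
  "kostka \<rho> lam = card (ssyt \<rho> lam)"

inductive poly_fun :: "(table \<Rightarrow> real) \<Rightarrow> bool" where
  const: "poly_fun (\<lambda>T. c)"
| var: "poly_fun (\<lambda>T. real (T i j))"
| add: "poly_fun f \<Longrightarrow> poly_fun g \<Longrightarrow> poly_fun (\<lambda>T. f T + g T)"
| mult: "poly_fun f \<Longrightarrow> poly_fun g \<Longrightarrow> poly_fun (\<lambda>T. f T * g T)"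

end

theory Submission
  imports Defs "HOL-Combinatorics.Permutations"
begin

text \<open>
Up to the affine map \<open>x \<mapsto> (n + x) / n\<^sup>2\<close>, the chain is the operator \<open>swap_op\<close> on functions of
tables that sums over ordered pairs of distinct balls and exchanges their columns. It is the
normal-ordered Casimir operator of the row operators, and equally of the column operators
\<open>E\<^sub>a\<^sub>b\<close> (\<open>column_op\<close>), hence commutes with every \<open>E\<^sub>a\<^sub>b\<close>. Writing it through \<open>E\<^sub>a\<^sub>b E\<^sub>b\<^sub>a\<close> and using
cyclicity of the trace between tables with different column sums gives a recursion for the traces
\<open>t\<^sub>k\<close> of its powers: \<open>t\<^sub>k\<^sub>+\<^sub>1(\<alpha>, \<mu>) = c(\<mu>) t\<^sub>k(\<alpha>, \<mu>) + \<Sum> B(\<mu>, \<nu>) t\<^sub>k(\<alpha>, \<nu>)\<close>, where \<open>c(\<mu>)\<close> is twice the sum of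
contents and \<open>\<nu>\<close> runs over partitions with a larger sum of squares than \<open>\<mu>\<close>. The initial values
\<open>t\<^sub>0(\<alpha>, \<mu>) = \<Sum>\<^sub>\<rho> K\<^sub>\<rho>\<^sub>\<alpha> K\<^sub>\<rho>\<^sub>\<mu>\<close> (the RSK count, obtained from a local rule for horizontal strips), the
symmetry in \<open>\<alpha>, \<mu>\<close> and the unitriangularity of the Kostka numbers then force
\<open>t\<^sub>k(\<alpha>, \<mu>) = \<Sum>\<^sub>\<rho> c(\<rho>)\<^sup>k K\<^sub>\<rho>\<^sub>\<alpha> K\<^sub>\<rho>\<^sub>\<mu>\<close>, without any representation theory. Reversibility yields an
orthogonal eigenbasis, and the power sums determine the multiplicities. On a finite set every
function agrees with a polynomial.
\<close>

section \<open>Counting tables by pairs of chains of horizontal strips\<close>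

text \<open>The operators \<open>E\<^sub>a\<^sub>b\<close> change the column sums, so no single set
  of tables carries the argument: traces for all column sums are followed at once. The margins are
  padded to length \<open>n\<close> on both sides, so that transposing a table stays inside the
  family. A direct verification of the trace formula from the recursion would need
  \<open>(c(\<rho>) - c(\<mu>)) K = \<Sum> B K\<close>, which is Freudenthal's multiplicity formula
  for Kostka numbers. It is not proved on its own; comparing rows with columns is what supplies it.
  The affine map has a plain meaning: two positions picked independently coincide with probability
  \<open>n / n^2\<close>, and then nothing happens; the other \<open>n (n - 1)\<close> ordered
  pairs, each of probability \<open>1 / n^2\<close>, are those over which \<open>swap_op\<close>
  sums. Knowing all traces also takes the place of the spectral theorem: it exhibits a product of
  real linear factors that annihilates the operator, and eigenfunctions are read off from that
  product.\<close>

definition part_fun :: "nat \<Rightarrow> (nat \<Rightarrow> nat) set" where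
  "part_fun n = {\<rho>. antimono \<rho> \<and> (\<forall>i\<ge>n. \<rho> i = 0) \<and> sum \<rho> {..<n} = n}"

text \<open>The skew shape \<open>\<rho> / \<kappa>\<close> is a horizontal strip: no two of its
  cells lie in one column.\<close>

definition interlaces :: "(nat \<Rightarrow> nat) \<Rightarrow> (nat \<Rightarrow> nat) \<Rightarrow> bool" where
  "interlaces \<kappa> \<rho> \<longleftrightarrow> (\<forall>i. \<kappa> i \<le> \<rho> i \<and> \<rho> (Suc i) \<le> \<kappa> i)"

lemma sum_lessThan_zero_tail:
  fixes f :: "nat \<Rightarrow> 'b::comm_monoid_add"
  assumes "\<And>i. i \<ge> n \<Longrightarrow> f i = 0" "n \<le> m"
  shows "sum f {..<m} = sum f {..<n}"
  by (rule sum.mono_neutral_right) (use assms in auto)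

lemma part_fun_sum: "\<rho> \<in> part_fun n \<Longrightarrow> n \<le> m \<Longrightarrow> sum \<rho> {..<m} = n"
  using sum_lessThan_zero_tail[of n \<rho> m] by (auto simp: part_fun_def)

lemma part_fun_zero: "\<rho> \<in> part_fun n \<Longrightarrow> n \<le> i \<Longrightarrow> \<rho> i = 0"
  by (auto simp: part_fun_def)

lemma part_fun_antimono: "\<rho> \<in> part_fun n \<Longrightarrow> i \<le> j \<Longrightarrow> \<rho> j \<le> \<rho> i"
  by (auto simp: part_fun_def dest: antimonoD)

text \<open>Any bound \<open>m\<close> on the support will do: if part \<open>i\<close> is nonzero,
  so are the parts \<open>0\<close> to \<open>i\<close>, and the sum is at least
  \<open>i + 1\<close>; hence the support lies below \<open>n\<close>.\<close>

lemma ParI: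
  assumes dec: "\<And>i. \<rho> (Suc i) \<le> \<rho> i" and zero: "\<And>i. i \<ge> m \<Longrightarrow> \<rho> i = 0"
    and sum: "sum \<rho> {..<m} = n"
  shows "\<rho> \<in> part_fun n"
proof -
  have anti: "antimono \<rho>"
    using dec by (simp add: antimono_iff_le_Suc)
  have z: "\<rho> i = 0" if "i \<ge> n" for i
  proof (rule ccontr)
    assume "\<rho> i \<noteq> 0"
    then have pos: "\<rho> j \<ge> 1" if "j \<le> i" for j
      using antimonoD[OF anti that] by linarith
    have "i < m" using zero[of i] \<open>\<rho> i \<noteq> 0\<close> by (metis not_le_imp_less)
    have "i + 1 = (\<Sum>j<Suc i. 1::nat)" by simp
    also have "\<dots> \<le> sum \<rho> {..<Suc i}" by (rule sum_mono) (use pos in auto)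
    also have "\<dots> \<le> sum \<rho> {..<m}" by (rule sum_mono2) (use \<open>i < m\<close> in auto)
    finally show False using sum that by simp
  qed
  have "sum \<rho> {..<n} = sum \<rho> {..<max n m}"
    by (rule sum_lessThan_zero_tail[symmetric]) (use z in auto)
  also have "\<dots> = sum \<rho> {..<m}"
    by (rule sum_lessThan_zero_tail) (use zero in auto)
  finally show ?thesis using anti z sum by (auto simp: part_fun_def)
qed

lemma finite_part_fun: "finite (part_fun n)"
proof (rule finite_subset)
  show "part_fun n \<subseteq> {f. \<forall>x. (x \<in> {..<n} \<longrightarrow> f x \<in> {..n}) \<and> (x \<notin> {..<n} \<longrightarrow> f x = 0)}"
  proof (clarsimp simp: part_fun_def not_less)
    fix \<rho> :: "nat \<Rightarrow> nat" and i assume "sum \<rho> {..<n} = n" "i < n"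
    then show "\<rho> i \<le> n" using member_le_sum[of i "{..<n}" \<rho>] by simp
  qed
qed (rule finite_set_of_finite_funs; simp)

lemma part_fun_disjoint: "\<rho> \<in> part_fun m \<Longrightarrow> \<rho> \<in> part_fun n \<Longrightarrow> m = n"
  using part_fun_sum[of \<rho> m "max m n"] part_fun_sum[of \<rho> n "max m n"] by simp

lemma part_fun_0: "part_fun 0 = {\<lambda>_. 0}"
  by (auto simp: part_fun_def antimono_def)

lemma zero_in_part_fun_iff: "\<rho> \<in> part_fun n \<Longrightarrow> \<rho> = (\<lambda>_. 0) \<longleftrightarrow> n = 0"
  by (metis part_fun_0 part_fun_disjoint singletonD singletonI)

lemma interlaces_size_le: "interlaces \<kappa> \<rho> \<Longrightarrow> \<kappa> \<in> part_fun k \<Longrightarrow> \<rho> \<in> part_fun r \<Longrightarrow> k \<le> r"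
  using sum_mono[of "{..<max k r}" \<kappa> \<rho>] part_fun_sum[of \<kappa> k "max k r"] part_fun_sum[of \<rho> r "max k r"]
  by (auto simp: interlaces_def)

text \<open>The local rule of row insertion: reflecting \<open>\<sigma> (i
    + 1)\<close> in the interval of values that it may take gives
  \<open>\<kappa> i\<close>, and the excess of \<open>\<sigma> 0\<close> over its minimum is recorded by the size of \<open>\<kappa>\<close>.\<close>

lemma card_common_extensions:
  assumes \<alpha>: "\<alpha> \<in> part_fun a" and \<beta>: "\<beta> \<in> part_fun b"
  shows "card {\<sigma> \<in> part_fun s. interlaces \<alpha> \<sigma> \<and> interlaces \<beta> \<sigma>} =
    (\<Sum>k | k \<le> a \<and> a + b \<le> s + k. card {\<kappa> \<in> part_fun k. interlaces \<kappa> \<alpha> \<and> interlaces \<kappa> \<beta>})"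
proof -
  define up where "up = {\<sigma> \<in> part_fun s. interlaces \<alpha> \<sigma> \<and> interlaces \<beta> \<sigma>}"
  \<comment> \<open>By \<open>|\<kappa>| + s + mx 0 = a + b + \<sigma> 0\<close>, the second
    inequality is \<open>mx 0 \<le> \<sigma> 0\<close> written in sizes; the first holds because
    \<kappa> lies inside \<alpha>.\<close>
  define ks where "ks = {k. k \<le> a \<and> a + b \<le> s + k}"
  define down where "down k = {\<kappa> \<in> part_fun k. interlaces \<kappa> \<alpha> \<and> interlaces \<kappa> \<beta>}" for k
  define mx where "mx i = max (\<alpha> i) (\<beta> i)" for i
  define mn where "mn i = min (\<alpha> i) (\<beta> i)" for i
  define \<Phi> where "\<Phi> \<sigma> = (\<lambda>i. mx (Suc i) + mn i - \<sigma> (Suc i))" for \<sigma> :: "nat \<Rightarrow> nat"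
  \<comment> \<open>Entry \<open>0\<close> has no partner under the reflection and is recovered from
    the sizes. Since \<kappa> has at most \<open>a\<close> cells, its first \<open>a\<close> parts
    already give its full size.\<close>
  define \<Psi> where "\<Psi> \<kappa> = (\<lambda>i. case i of 0 \<Rightarrow> mx 0 + (s + sum \<kappa> {..<a}) - (a + b)
     | Suc j \<Rightarrow> mx (Suc j) + mn j - \<kappa> j)" for \<kappa> :: "nat \<Rightarrow> nat"
  define M where "M = Suc (a + b + s)"
  have sum_mxmn: "sum mx {..<m} + sum mn {..<m} = a + b" if "m \<ge> a" "m \<ge> b" for m
  proof -
    have "sum mx {..<m} + sum mn {..<m} = (\<Sum>i<m. \<alpha> i + \<beta> i)"
      unfolding sum.distrib[symmetric] by (rule sum.cong) (auto simp: mx_def mn_def)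
    then show ?thesis using part_fun_sum[OF \<alpha>] part_fun_sum[OF \<beta>] that by (simp add: sum.distrib)
  qed
  have mx0: "mx i = 0" if "i \<ge> a + b" for i
    using part_fun_zero[OF \<alpha>] part_fun_zero[OF \<beta>] that by (simp add: mx_def)
  have mn0: "mn i = 0" if "i \<ge> a + b" for i
    using part_fun_zero[OF \<alpha>] part_fun_zero[OF \<beta>] that by (simp add: mn_def)
  have up_to_down: "\<Phi> \<sigma> \<in> (\<Union>k\<in>ks. down k) \<and> \<Psi> (\<Phi> \<sigma>) = \<sigma>" if "\<sigma> \<in> up" for \<sigma>
  proof -
    have \<sigma>: "\<sigma> \<in> part_fun s" and "interlaces \<alpha> \<sigma>" "interlaces \<beta> \<sigma>" using that by (auto simp: up_def)
    then have lo: "mx i \<le> \<sigma> i" and hi: "\<sigma> (Suc i) \<le> mn i" for i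
      by (auto simp: interlaces_def mx_def mn_def)
    have eq: "\<Phi> \<sigma> i + \<sigma> (Suc i) = mx (Suc i) + mn i" for i
      using hi[of i] by (simp add: \<Phi>_def)
    have b1: "mx (Suc i) \<le> \<Phi> \<sigma> i" "\<Phi> \<sigma> i \<le> mn i" for i
      using eq[of i] hi[of i] lo[of "Suc i"] by linarith+
    have int: "interlaces (\<Phi> \<sigma>) \<alpha>" "interlaces (\<Phi> \<sigma>) \<beta>"
      using b1 by (auto simp: interlaces_def mx_def mn_def)
    define k where "k = sum (\<Phi> \<sigma>) {..<M}"
    have "(\<Sum>i<M. \<Phi> \<sigma> i) + (\<Sum>i<M. \<sigma> (Suc i)) = (\<Sum>i<M. mx (Suc i)) + (\<Sum>i<M. mn i)"
      unfolding sum.distrib[symmetric] using eq by simp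
    moreover have "sum \<sigma> {..<Suc M} = s" by (rule part_fun_sum[OF \<sigma>]) (simp add: M_def)
    moreover have "sum mx {..<Suc M} + sum mn {..<Suc M} = a + b"
      by (rule sum_mxmn) (auto simp: M_def)
    moreover have "sum mn {..<Suc M} = sum mn {..<M}" using mn0[of M] by (simp add: M_def)
    ultimately have k: "k + s + mx 0 = a + b + \<sigma> 0"
      unfolding sum.lessThan_Suc_shift k_def by simp
    have zero: "\<Phi> \<sigma> i = 0" if "i \<ge> a" for i
      using b1(2)[of i] part_fun_zero[OF \<alpha> that] by (simp add: mn_def)
    have P: "\<Phi> \<sigma> \<in> part_fun k"
    proof (rule ParI)
      show "\<Phi> \<sigma> (Suc i) \<le> \<Phi> \<sigma> i" for i
        using b1(2)[of "Suc i"] b1(1)[of i] by (simp add: mn_def mx_def)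
      show "\<Phi> \<sigma> i = 0" if "i \<ge> M" for i using zero that by (simp add: M_def)
    qed (simp add: k_def)
    have "k \<le> a" using interlaces_size_le[OF int(1) P \<alpha>] .
    moreover have "a + b \<le> s + k" using k lo[of 0] by linarith
    ultimately have "\<Phi> \<sigma> \<in> (\<Union>k\<in>ks. down k)" using P int by (auto simp: ks_def down_def)
    moreover have "sum (\<Phi> \<sigma>) {..<a} = k"
      using part_fun_sum[OF P \<open>k \<le> a\<close>] .
    then have "\<Psi> (\<Phi> \<sigma>) i = \<sigma> i" for i
    proof (cases i)
      case 0 then show ?thesis using k \<open>sum (\<Phi> \<sigma>) {..<a} = k\<close> by (simp add: \<Psi>_def)
    next
      case (Suc j) then show ?thesis using eq[of j] by (simp add: \<Psi>_def)
    qed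
    ultimately show ?thesis by blast
  qed
  have down_to_up: "\<Psi> \<kappa> \<in> up \<and> \<Phi> (\<Psi> \<kappa>) = \<kappa>" if in_down: "\<kappa> \<in> (\<Union>k\<in>ks. down k)" for \<kappa>
  proof -
    obtain k where k: "k \<le> a" "a + b \<le> s + k" and \<kappa>: "\<kappa> \<in> part_fun k"
      and "interlaces \<kappa> \<alpha>" "interlaces \<kappa> \<beta>"
      using in_down by (auto simp: ks_def down_def)
    then have b: "mx (Suc i) \<le> \<kappa> i" "\<kappa> i \<le> mn i" for i
      by (auto simp: interlaces_def mx_def mn_def)
    have s\<kappa>: "sum \<kappa> {..<m} = k" if "m \<ge> a" for m using part_fun_sum[OF \<kappa>] k that by simp
    have z: "\<Psi> \<kappa> 0 + (a + b) = mx 0 + (s + k)"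
      using k s\<kappa> by (simp add: \<Psi>_def)
    have eq: "\<Psi> \<kappa> (Suc i) + \<kappa> i = mx (Suc i) + mn i" for i
      using b(2)[of i] by (simp add: \<Psi>_def)
    have lo: "mx i \<le> \<Psi> \<kappa> i" for i
    proof (cases i)
      case 0 then show ?thesis using z k by simp
    next
      case (Suc j) then show ?thesis using eq[of j] b[of j] by simp
    qed
    have hi: "\<Psi> \<kappa> (Suc i) \<le> mn i" for i using eq[of i] b[of i] by linarith
    have int: "interlaces \<alpha> (\<Psi> \<kappa>)" "interlaces \<beta> (\<Psi> \<kappa>)"
      using lo hi by (auto simp: interlaces_def mx_def mn_def)
    have "(\<Sum>i<M. \<Psi> \<kappa> (Suc i)) + (\<Sum>i<M. \<kappa> i) = (\<Sum>i<M. mx (Suc i)) + (\<Sum>i<M. mn i)"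
      unfolding sum.distrib[symmetric] using eq by simp
    moreover have "sum mx {..<Suc M} + sum mn {..<Suc M} = a + b"
      by (rule sum_mxmn) (auto simp: M_def)
    moreover have "sum mn {..<Suc M} = sum mn {..<M}" using mn0[of M] by (simp add: M_def)
    moreover have "sum \<kappa> {..<M} = k" by (rule s\<kappa>) (simp add: M_def)
    ultimately have sz: "sum (\<Psi> \<kappa>) {..<Suc M} = s"
      unfolding sum.lessThan_Suc_shift using z by simp
    have "\<Psi> \<kappa> \<in> part_fun s"
    proof (rule ParI)
      show "\<Psi> \<kappa> (Suc i) \<le> \<Psi> \<kappa> i" for i
        using hi[of i] lo[of i] by (simp add: mn_def mx_def)
      show "\<Psi> \<kappa> i = 0" if "i \<ge> Suc M" for i
        using that mn0[of "i - 1"] hi[of "i - 1"] by (simp add: M_def)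
    qed (rule sz)
    then have "\<Psi> \<kappa> \<in> up" using int by (simp add: up_def)
    moreover have "\<Phi> (\<Psi> \<kappa>) = \<kappa>"
    proof
      show "\<Phi> (\<Psi> \<kappa>) i = \<kappa> i" for i using eq[of i] by (simp add: \<Phi>_def)
    qed
    ultimately show ?thesis by blast
  qed
  have "bij_betw \<Phi> up (\<Union>k\<in>ks. down k)"
    by (rule bij_betw_byWitness[where f' = \<Psi>]) (use up_to_down down_to_up in auto)
  then have "card up = card (\<Union>k\<in>ks. down k)" by (rule bij_betw_same_card)
  also have "\<dots> = (\<Sum>k\<in>ks. card (down k))"
  proof (rule card_UN_disjoint)
    show "finite ks" by (rule finite_subset[of _ "{..a}"]) (auto simp: ks_def)
    show "\<forall>i\<in>ks. finite (down i)" using finite_part_fun by (auto simp: down_def)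
    show "\<forall>i\<in>ks. \<forall>j\<in>ks. i \<noteq> j \<longrightarrow> down i \<inter> down j = {}"
      using part_fun_disjoint by (auto simp: down_def)
  qed
  finally show ?thesis by (simp add: up_def ks_def down_def)
qed

text \<open>The Kostka number as the number of chains of partitions from the empty one to \<open>\<rho>\<close> whose steps are
  horizontal strips of sizes \<open>\<mu> 0, \<dots>, \<mu> (l - 1)\<close>. It is meaningful only for \<open>\<rho>\<close> of size \<open>\<mu> 0 + \<dots>
      + \<mu> (l - 1)\<close>:
  the last step fixes the size of the smaller partition but not that of \<open>\<rho>\<close>.\<close>

fun kostka_count :: "(nat \<Rightarrow> nat) \<Rightarrow> nat \<Rightarrow> (nat \<Rightarrow> nat) \<Rightarrow> nat" where
  "kostka_count \<mu> 0 \<rho> = (if \<rho> = (\<lambda>_. 0) then 1 else 0)"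
| "kostka_count \<mu> (Suc l) \<rho> = (\<Sum>\<sigma> | \<sigma> \<in> part_fun (sum \<mu> {..<l})
    \<and> interlaces \<sigma> \<rho>. kostka_count \<mu> l \<sigma>)"

lemma kostka_count_cong: "(\<And>i. i < l \<Longrightarrow> \<mu> i = \<nu> i) \<Longrightarrow> kostka_count \<mu> l \<rho> = kostka_count \<nu> l \<rho>"
proof (induction l arbitrary: \<rho>)
  case (Suc l)
  have "sum \<mu> {..<l} = sum \<nu> {..<l}" by (rule sum.cong) (use Suc.prems in auto)
  then show ?case using Suc by (simp cong: sum.cong)
qed simp

definition subcontents :: "(nat \<Rightarrow> nat) \<Rightarrow> nat \<Rightarrow> nat \<Rightarrow> (nat \<Rightarrow> nat) set" where
  "subcontents \<mu> l r = {\<nu>. (\<forall>i\<ge>l. \<nu> i = 0) \<and> (\<forall>i<l. \<nu> i \<le> \<mu> i) \<and> sum \<nu> {..<l} = r}"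

lemma finite_subcontents: "finite (subcontents \<mu> l r)"
proof (rule finite_subset)
  show "subcontents \<mu> l r \<subseteq>
    {f. \<forall>x. (x \<in> {..<l} \<longrightarrow> f x \<in> {..r}) \<and> (x \<notin> {..<l} \<longrightarrow> f x = 0)}"
  proof (clarsimp simp: subcontents_def not_less)
    fix \<rho> :: "nat \<Rightarrow> nat" and i assume "i < l"
    then show "\<rho> i \<le> sum \<rho> {..<l}" using member_le_sum[of i "{..<l}" \<rho>] by simp
  qed
qed (rule finite_set_of_finite_funs; simp)

text \<open>\<open>k\<close> is what remains for the first \<open>l\<close> parts and
  \<open>r - k\<close> is the last part; the two bounds on \<open>k\<close> say that the last part
  lies between \<open>0\<close> and \<open>\<mu> l\<close>.\<close>

lemma bij_betw_subcontents_Suc: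
  "bij_betw (\<lambda>(k, \<nu>). \<nu>(l := r - k))
     (SIGMA k:{k. k \<le> r \<and> r \<le> \<mu> l + k}. subcontents \<mu> l k) (subcontents \<mu> (Suc l) r)"
proof (rule bij_betw_byWitness[where f' = "\<lambda>\<nu>. (sum \<nu> {..<l}, \<nu>(l := 0))"])
  have upd: "sum (\<nu>(l := x)) {..<l} = sum \<nu> {..<l}" for \<nu> :: "nat \<Rightarrow> nat" and x
    by (rule sum.cong) auto
  show "\<forall>p\<in>SIGMA k:{k. k \<le> r \<and> r \<le> \<mu> l + k}. subcontents \<mu> l k.
    (sum (case p of (k, \<nu>) \<Rightarrow> \<nu>(l := r - k)) {..<l}, (case p of (k, \<nu>) \<Rightarrow> \<nu>(l := r - k))(l := 0)) = p"
    by (auto simp: subcontents_def upd)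
  show "\<forall>\<nu>\<in>subcontents \<mu> (Suc l) r. (case (sum \<nu> {..<l}, \<nu>(l := 0)) of (k, \<nu>) \<Rightarrow> \<nu>(l := r - k)) = \<nu>"
    by (auto simp: subcontents_def)
  show "(\<lambda>(k, \<nu>). \<nu>(l := r - k)) ` (SIGMA k:{k. k \<le> r \<and> r \<le> \<mu> l + k}. subcontents \<mu> l k)
    \<subseteq> subcontents \<mu> (Suc l) r"
    by (auto simp: subcontents_def upd less_Suc_eq)
  show "(\<lambda>\<nu>. (sum \<nu> {..<l}, \<nu>(l := 0))) ` subcontents \<mu> (Suc l) r
    \<subseteq> (SIGMA k:{k. k \<le> r \<and> r \<le> \<mu> l + k}. subcontents \<mu> l k)"
    by (auto simp: subcontents_def upd le_Suc_eq)
qed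

text \<open>In symmetric functions: the adjoint of multiplication by \<open>h_d\<close>, applied to
  a product of complete symmetric functions, takes \<open>d\<close> boxes away, distributed over the
  factors in all possible ways; \<nu> records what is left. In the induction
  \<open>card_common_extensions\<close> moves the extension of \<rho> past the last step of the
  chain.\<close>

lemma sum_kostka_count_extensions:
  assumes "\<rho> \<in> part_fun r"
  shows "(\<Sum>\<sigma> | \<sigma> \<in> part_fun (sum \<mu> {..<l}) \<and> interlaces \<rho> \<sigma>. kostka_count \<mu> l \<sigma>) =
    (\<Sum>\<nu>\<in>subcontents \<mu> l r. kostka_count \<nu> l \<rho>)"
  using assms
proof (induction l arbitrary: r \<rho>)
  case 0
  have "{\<sigma>. \<sigma> = (\<lambda>_. 0) \<and> interlaces \<rho> \<sigma>} = (if r = 0 then {\<lambda>_. 0} else {})"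
  proof -
    have "interlaces \<rho> (\<lambda>_. 0) \<longleftrightarrow> \<rho> = (\<lambda>_. 0)" by (auto simp: interlaces_def)
    then show ?thesis using zero_in_part_fun_iff[OF 0] by auto
  qed
  moreover have "subcontents \<mu> 0 r = (if r = 0 then {\<lambda>_. 0} else {})"
    by (auto simp: subcontents_def)
  ultimately show ?case using zero_in_part_fun_iff[OF 0] by (simp add: part_fun_0)
next
  case (Suc l)
  define s where "s = sum \<mu> {..<l}"
  define m where "m = \<mu> l"
  define ks where "ks = {k. k \<le> r \<and> r + s \<le> (s + m) + k}"
  have ks: "ks = {k. k \<le> r \<and> r \<le> \<mu> l + k}" by (auto simp: ks_def m_def)
  have fin: "finite {\<sigma> \<in> part_fun x. Q \<sigma>}" for x Q using finite_part_fun by simp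
  have finks: "finite ks" by (rule finite_subset[of _ "{..r}"]) (auto simp: ks_def)
  have "(\<Sum>\<sigma> | \<sigma> \<in> part_fun (sum \<mu> {..<Suc l}) \<and> interlaces \<rho> \<sigma>. kostka_count \<mu> (Suc l) \<sigma>) =
    (\<Sum>\<sigma> | \<sigma> \<in> part_fun (s + m) \<and> interlaces \<rho> \<sigma>. \<Sum>\<tau> | \<tau> \<in> part_fun s
        \<and> interlaces \<tau> \<sigma>. kostka_count \<mu> l \<tau>)"
    by (simp add: s_def m_def)
  also have "\<dots> = (\<Sum>\<tau>\<in>part_fun s. \<Sum>\<sigma> | \<sigma> \<in> {\<sigma> \<in> part_fun (s + m). interlaces \<rho> \<sigma>}
      \<and> interlaces \<tau> \<sigma>. kostka_count \<mu> l \<tau>)"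
    by (rule sum.swap_restrict[OF fin finite_part_fun])
  also have "\<dots> = (\<Sum>\<tau>\<in>part_fun s. card {\<sigma> \<in> part_fun (s + m). interlaces \<rho> \<sigma> \<and> interlaces \<tau> \<sigma>}
      * kostka_count \<mu> l \<tau>)"
    by (simp add: conj_assoc)
  also have "\<dots> = (\<Sum>\<tau>\<in>part_fun s. (\<Sum>k\<in>ks. card {\<kappa> \<in> part_fun k. interlaces \<kappa> \<rho> \<and> interlaces \<kappa> \<tau>})
      * kostka_count \<mu> l \<tau>)"
    using card_common_extensions[OF Suc.prems] by (intro sum.cong) (simp_all add: ks_def)
  also have "\<dots> = (\<Sum>\<tau>\<in>part_fun s. \<Sum>k\<in>ks. \<Sum>\<kappa> | \<kappa> \<in> {\<kappa> \<in> part_fun k. interlaces \<kappa> \<rho>}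
      \<and> interlaces \<kappa> \<tau>. kostka_count \<mu> l \<tau>)"
    by (simp add: sum_distrib_right conj_assoc)
  also have "\<dots> = (\<Sum>k\<in>ks. \<Sum>\<tau>\<in>part_fun s. \<Sum>\<kappa> | \<kappa> \<in> {\<kappa> \<in> part_fun k. interlaces \<kappa> \<rho>}
      \<and> interlaces \<kappa> \<tau>. kostka_count \<mu> l \<tau>)"
    by (rule sum.swap)
  also have "\<dots> = (\<Sum>k\<in>ks. \<Sum>\<kappa> | \<kappa> \<in> part_fun k \<and> interlaces \<kappa> \<rho>. \<Sum>\<tau> | \<tau> \<in> part_fun s
      \<and> interlaces \<kappa> \<tau>. kostka_count \<mu> l \<tau>)"
    by (rule sum.cong[OF refl], rule sum.swap_restrict[OF finite_part_fun fin])
  also have "\<dots> = (\<Sum>k\<in>ks. \<Sum>\<kappa> | \<kappa> \<in> part_fun k \<and> interlaces \<kappa> \<rho>.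
      \<Sum>\<nu>\<in>subcontents \<mu> l k. kostka_count \<nu> l \<kappa>)"
    by (rule sum.cong[OF refl], rule sum.cong[OF refl]) (simp add: s_def Suc.IH)
  also have "\<dots> = (\<Sum>k\<in>ks. \<Sum>\<nu>\<in>subcontents \<mu> l k. \<Sum>\<kappa> | \<kappa> \<in> part_fun k
      \<and> interlaces \<kappa> \<rho>. kostka_count \<nu> l \<kappa>)"
    by (rule sum.cong[OF refl], rule sum.swap)
  also have "\<dots> = (\<Sum>k\<in>ks. \<Sum>\<nu>\<in>subcontents \<mu> l k. kostka_count (\<nu>(l := r - k)) (Suc l) \<rho>)"
  proof (intro sum.cong refl)
    fix k \<nu> assume "\<nu> \<in> subcontents \<mu> l k"
    then have "sum (\<nu>(l := r - k)) {..<l} = k"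
      by (auto simp: subcontents_def intro!: sum.cong)
    moreover have "kostka_count (\<nu>(l := r - k)) l \<kappa> = kostka_count \<nu> l \<kappa>" for \<kappa>
        by (rule kostka_count_cong) simp
    ultimately show "(\<Sum>\<kappa> | \<kappa> \<in> part_fun k \<and> interlaces \<kappa> \<rho>. kostka_count \<nu> l \<kappa>)
        = kostka_count (\<nu>(l := r - k)) (Suc l) \<rho>"
      by simp
  qed
  also have "\<dots> = (\<Sum>(k, \<nu>)\<in>(SIGMA k:ks. subcontents \<mu> l k). kostka_count (\<nu>(l := r - k)) (Suc l) \<rho>)"
    by (rule sum.Sigma) (auto simp: finks finite_subcontents)
  also have "\<dots> = (\<Sum>\<nu>\<in>subcontents \<mu> (Suc l) r. kostka_count \<nu> (Suc l) \<rho>)"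
    using sum.reindex_bij_betw[OF bij_betw_subcontents_Suc[of l r \<mu>], of "\<lambda>\<nu>. kostka_count \<nu> (Suc l) \<rho>"]
    unfolding ks by (simp add: case_prod_unfold)
  finally show ?case .
qed

section \<open>Tables with prescribed row and column sums\<close>

definition margin_tables :: "nat \<Rightarrow> nat \<Rightarrow> (nat \<Rightarrow> nat) \<Rightarrow> (nat \<Rightarrow> nat) \<Rightarrow> (nat \<Rightarrow> nat \<Rightarrow> nat) set" where
  "margin_tables m n \<alpha> \<mu> = {T. (\<forall>i j. m \<le> i \<or> n \<le> j \<longrightarrow> T i j = 0) \<and>
     (\<forall>i<m. (\<Sum>j<n. T i j) = \<alpha> i) \<and> (\<forall>j<n. (\<Sum>i<m. T i j) = \<mu> j)}"

lemma finite_margin_tables: "finite (margin_tables m n \<alpha> \<mu>)"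
proof (rule finite_subset)
  let ?R = "{f. \<forall>x. (x \<in> {..<n} \<longrightarrow> f x \<in> {..sum \<alpha> {..<m}}) \<and> (x \<notin> {..<n} \<longrightarrow> f x = 0)}"
  show "margin_tables m n \<alpha> \<mu> \<subseteq>
    {f. \<forall>x. (x \<in> {..<m} \<longrightarrow> f x \<in> ?R) \<and> (x \<notin> {..<m} \<longrightarrow> f x = (\<lambda>_. 0))}"
  proof (clarsimp simp: margin_tables_def not_less, intro conjI allI impI ext)
    fix T :: "nat \<Rightarrow> nat \<Rightarrow> nat" and i j
    assume row: "\<forall>i<m. (\<Sum>j<n. T i j) = \<alpha> i" and "i < m" "j < n"
    then have "T i j \<le> \<alpha> i" using member_le_sum[of j "{..<n}" "T i"] by simp
    also have "\<dots> \<le> sum \<alpha> {..<m}" using member_le_sum[of i "{..<m}" \<alpha>] \<open>i < m\<close> by simp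
    finally show "T i j \<le> sum \<alpha> {..<m}" .
  qed auto
  have "finite ?R" by (rule finite_set_of_finite_funs) auto
  then show "finite {f. \<forall>x. (x \<in> {..<m} \<longrightarrow> f x \<in> ?R) \<and> (x \<notin> {..<m} \<longrightarrow> f x = (\<lambda>_. 0))}"
    by (intro finite_set_of_finite_funs) auto
qed

text \<open>Splits off the last row. Equality of the two totals is what makes the restored row
  \<open>\<mu> - \<nu>\<close> sum to \<open>\<alpha> m\<close>.\<close>

lemma bij_betw_margin_tables_Suc:
  assumes "sum \<alpha> {..<Suc m} = sum \<mu> {..<n}"
  shows "bij_betw (\<lambda>(\<nu>, T). T(m := \<lambda>j. if j < n then \<mu> j - \<nu> j else 0))
    (SIGMA \<nu>:subcontents \<mu> n (sum \<alpha> {..<m}). margin_tables m n \<alpha> \<nu>) (margin_tables (Suc m) n \<alpha> \<mu>)"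
proof -
  have upd: "(\<Sum>i<m. (T(m := x)) i j) = (\<Sum>i<m. T i j)" for T :: "nat \<Rightarrow> nat \<Rightarrow> nat" and x j
    by (rule sum.cong) auto
  let ?g = "\<lambda>T. ((\<lambda>j. \<Sum>i<m. T i j), T(m := (\<lambda>_. 0)))"
  show ?thesis
  proof (rule bij_betw_byWitness[where f' = ?g])
    show "\<forall>p\<in>SIGMA \<nu>:subcontents \<mu> n (sum \<alpha> {..<m}). margin_tables m n \<alpha> \<nu>.
      ?g (case p of (\<nu>, T) \<Rightarrow> T(m := \<lambda>j. if j < n then \<mu> j - \<nu> j else 0)) = p"
    proof
      fix p assume "p \<in> (SIGMA \<nu>:subcontents \<mu> n (sum \<alpha> {..<m}). margin_tables m n \<alpha> \<nu>)"
      then obtain \<nu> T where p: "p = (\<nu>, T)"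
        and "\<nu> \<in> subcontents \<mu> n (sum \<alpha> {..<m})" "T \<in> margin_tables m n \<alpha> \<nu>" by blast
      then have "(\<Sum>i<m. T i j) = \<nu> j" "T m j = 0" for j
        by (cases "j < n"; auto simp: subcontents_def margin_tables_def)+
      then have "?g (T(m := \<lambda>j. if j < n then \<mu> j - \<nu> j else 0)) = (\<nu>, T)"
        by (simp add: upd fun_eq_iff)
      then show "?g (case p of (\<nu>, T) \<Rightarrow> T(m := \<lambda>j. if j < n then \<mu> j - \<nu> j else 0)) = p"
        by (simp add: p)
    qed
    show "\<forall>T\<in>margin_tables (Suc m) n \<alpha> \<mu>.
      (case ?g T of (\<nu>, T) \<Rightarrow> T(m := \<lambda>j. if j < n then \<mu> j - \<nu> j else 0)) = T"
      by (auto simp: margin_tables_def fun_eq_iff)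
    show "(\<lambda>(\<nu>, T). T(m := \<lambda>j. if j < n then \<mu> j - \<nu> j else 0)) `
      (SIGMA \<nu>:subcontents \<mu> n (sum \<alpha> {..<m}). margin_tables m n \<alpha> \<nu>) \<subseteq> margin_tables (Suc m) n \<alpha> \<mu>"
    proof clarify
      fix \<nu> T assume \<nu>: "\<nu> \<in> subcontents \<mu> n (sum \<alpha> {..<m})" and T: "T \<in> margin_tables m n \<alpha> \<nu>"
      have "(\<Sum>j<n. \<mu> j - \<nu> j) = (\<Sum>j<n. \<mu> j) - (\<Sum>j<n. \<nu> j)"
        using \<nu> by (intro sum_subtractf_nat) (auto simp: subcontents_def)
      also have "\<dots> = \<alpha> m" using \<nu> assms by (simp add: subcontents_def)
      finally show "T(m := \<lambda>j. if j < n then \<mu> j - \<nu> j else 0) \<in> margin_tables (Suc m) n \<alpha> \<mu>"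
        using \<nu> T unfolding margin_tables_def subcontents_def
        by (auto simp: upd less_Suc_eq)
    qed
    show "?g ` margin_tables (Suc m) n \<alpha> \<mu>
        \<subseteq> (SIGMA \<nu>:subcontents \<mu> n (sum \<alpha> {..<m}). margin_tables m n \<alpha> \<nu>)"
    proof clarify
      fix T assume T: "T \<in> margin_tables (Suc m) n \<alpha> \<mu>"
      have "(\<Sum>j<n. \<Sum>i<m. T i j) = (\<Sum>i<m. \<Sum>j<n. T i j)" by (rule sum.swap)
      also have "\<dots> = sum \<alpha> {..<m}" using T by (auto simp: margin_tables_def intro!: sum.cong)
      finally have s: "(\<Sum>j<n. \<Sum>i<m. T i j) = sum \<alpha> {..<m}" .
      have le: "(\<Sum>i<m. T i j) \<le> \<mu> j" if "j < n" for j
      proof -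
        have "\<mu> j = (\<Sum>i<m. T i j) + T m j" using T that by (auto simp: margin_tables_def)
        then show ?thesis by simp
      qed
      show "(\<lambda>j. \<Sum>i<m. T i j) \<in> subcontents \<mu> n (sum \<alpha> {..<m}) \<and>
        T(m := \<lambda>_. 0) \<in> margin_tables m n \<alpha> (\<lambda>j. \<Sum>i<m. T i j)"
        using T s le by (auto simp: subcontents_def margin_tables_def upd less_Suc_eq_le)
    qed
  qed
qed

text \<open>The RSK count. Deleting the last row of a table replaces \<mu> by the column sums \<nu>
  of the rest; \<open>sum_kostka_count_extensions\<close> converts the sum over \<nu> into one more
  horizontal strip, which becomes the last step of the chain for \<alpha>.\<close>

theorem card_margin_tables:
  assumes "sum \<alpha> {..<m} = sum \<mu> {..<n}"
  shows "card (margin_tables m n \<alpha> \<mu>) = (\<Sum>\<rho>\<in>part_fun (sum \<alpha> {..<m}). kostka_count \<alpha> m \<rho>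
      * kostka_count \<mu> n \<rho>)"
  using assms
proof (induction m arbitrary: \<mu>)
  case 0
  then have z: "\<mu> j = 0" if "j < n" for j using that by (simp add: sum_eq_0_iff)
  have kz: "l \<le> n \<Longrightarrow> kostka_count \<mu> l (\<lambda>_. 0) = 1" for l
  proof (induction l)
    case (Suc l)
    have "sum \<mu> {..<l} = 0" using z Suc.prems by simp
    moreover have "{\<sigma>. \<sigma> = (\<lambda>_. 0::nat) \<and> interlaces \<sigma> (\<lambda>_. 0)} = {\<lambda>_. 0}"
      by (auto simp: interlaces_def)
    ultimately show ?case using Suc by (simp add: part_fun_0)
  qed simp
  have "margin_tables 0 n \<alpha> \<mu> = {\<lambda>_ _. 0}" using z by (auto simp: margin_tables_def fun_eq_iff)
  then show ?case using kz by (simp add: part_fun_0)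
next
  case (Suc m)
  define r where "r = sum \<alpha> {..<m}"
  define s where "s = sum \<mu> {..<n}"
  have s: "sum \<alpha> {..<Suc m} = s" using Suc.prems by (simp add: s_def)
  have "card (margin_tables (Suc m) n \<alpha> \<mu>)
      = card (SIGMA \<nu>:subcontents \<mu> n r. margin_tables m n \<alpha> \<nu>)"
    using bij_betw_same_card[OF bij_betw_margin_tables_Suc[OF Suc.prems]] by (simp add: r_def)
  also have "\<dots> = (\<Sum>\<nu>\<in>subcontents \<mu> n r. card (margin_tables m n \<alpha> \<nu>))"
    by (rule card_SigmaI) (auto simp: finite_subcontents finite_margin_tables)
  also have "\<dots> = (\<Sum>\<nu>\<in>subcontents \<mu> n r. \<Sum>\<rho>\<in>part_fun r. kostka_count \<alpha> m \<rho> * kostka_count \<nu> n \<rho>)"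
    unfolding r_def by (rule sum.cong[OF refl], rule Suc.IH) (auto simp: subcontents_def)
  also have "\<dots> = (\<Sum>\<rho>\<in>part_fun r. kostka_count \<alpha> m \<rho> * (\<Sum>\<nu>\<in>subcontents \<mu> n r. kostka_count \<nu> n \<rho>))"
    unfolding sum_distrib_left by (rule sum.swap)
  also have "\<dots> = (\<Sum>\<rho>\<in>part_fun r. kostka_count \<alpha> m \<rho> * (\<Sum>\<sigma> | \<sigma> \<in> part_fun s
      \<and> interlaces \<rho> \<sigma>. kostka_count \<mu> n \<sigma>))"
    by (intro sum.cong refl) (simp add: s_def sum_kostka_count_extensions)
  also have "\<dots> = (\<Sum>\<rho>\<in>part_fun r. \<Sum>\<sigma> | \<sigma> \<in> part_fun s \<and> interlaces \<rho> \<sigma>. kostka_count \<alpha> m \<rho>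
      * kostka_count \<mu> n \<sigma>)"
    by (simp add: sum_distrib_left)
  also have "\<dots> = (\<Sum>\<sigma>\<in>part_fun s. \<Sum>\<rho> | \<rho> \<in> part_fun r \<and> interlaces \<rho> \<sigma>. kostka_count \<alpha> m \<rho>
      * kostka_count \<mu> n \<sigma>)"
    by (rule sum.swap_restrict) (rule finite_part_fun)+
  also have "\<dots> = (\<Sum>\<sigma>\<in>part_fun s. kostka_count \<alpha> (Suc m) \<sigma> * kostka_count \<mu> n \<sigma>)"
    by (simp add: r_def sum_distrib_right)
  finally show ?case unfolding s .
qed

section \<open>Unitriangularity of Kostka numbers\<close>

text \<open>Each strip starts at most one new row, so the shape reached after \<open>k\<close> steps
  has at most \<open>k\<close> rows, and its \<open>sum \<mu> {..<k}\<close> cells all lie in the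
  first \<open>k\<close> rows of \<rho>. This is the dominance order.\<close>

lemma kostka_count_nonzero_dominates:
  assumes "kostka_count \<mu> l \<rho> \<noteq> 0" "\<rho> \<in> part_fun (sum \<mu> {..<l})"
  shows "(\<forall>i\<ge>l. \<rho> i = 0) \<and> (\<forall>k\<le>l. sum \<mu> {..<k} \<le> sum \<rho> {..<k})"
  using assms
proof (induction l arbitrary: \<rho>)
  case 0
  then show ?case by (auto split: if_splits)
next
  case (Suc l)
  from Suc.prems(1) have "(\<Sum>\<sigma> | \<sigma> \<in> part_fun (sum \<mu> {..<l})
      \<and> interlaces \<sigma> \<rho>. kostka_count \<mu> l \<sigma>) \<noteq> 0" by simp
  then obtain \<sigma> where \<sigma>: "\<sigma> \<in> part_fun (sum \<mu> {..<l})" "interlaces \<sigma> \<rho>" "kostka_count \<mu> l \<sigma> \<noteq> 0"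
    by (rule sum.not_neutral_contains_not_neutral) auto
  have IH: "\<forall>i\<ge>l. \<sigma> i = 0" "\<forall>k\<le>l. sum \<mu> {..<k} \<le> sum \<sigma> {..<k}"
    using Suc.IH[OF \<sigma>(3,1)] by auto
  have z: "\<rho> i = 0" if i: "i \<ge> Suc l" for i
  proof -
    obtain j where "i = Suc j" "j \<ge> l" using i by (cases i) auto
    then show ?thesis using IH(1) \<sigma>(2) by (auto simp: interlaces_def) (metis le_zero_eq)
  qed
  define s where "s = sum \<mu> {..<Suc l}"
  have "sum \<rho> {..<Suc l} = sum \<rho> {..<max (Suc l) s}"
    by (rule sum_lessThan_zero_tail[symmetric]) (use z in auto)
  also have "\<dots> = s" by (rule part_fun_sum) (use Suc.prems in \<open>auto simp: s_def\<close>)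
  finally have tot: "sum \<rho> {..<Suc l} = sum \<mu> {..<Suc l}" by (simp add: s_def)
  have "sum \<mu> {..<k} \<le> sum \<rho> {..<k}" if "k \<le> l" for k
  proof -
    have "sum \<mu> {..<k} \<le> sum \<sigma> {..<k}" using IH that by simp
    also have "\<dots> \<le> sum \<rho> {..<k}" by (rule sum_mono) (use \<sigma>(2) in \<open>auto simp: interlaces_def\<close>)
    finally show ?thesis .
  qed
  then show ?case using z tot by (auto simp: le_Suc_eq)
qed

text \<open>The only chain adds one row at a time: by dominance the shape before the last step has
  all its \<open>sum \<rho> {..<l}\<close> cells in the first \<open>l\<close> rows, so it must fill
  them.\<close>

lemma kostka_count_self:
  assumes "\<rho> \<in> part_fun n" "\<forall>i\<ge>l. \<rho> i = 0"
  shows "kostka_count \<rho> l \<rho> = 1"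
  using assms
proof (induction l arbitrary: \<rho> n)
  case 0
  then show ?case by auto
next
  case (Suc l)
  define \<tau> where "\<tau> = \<rho>(l := 0)"
  define s where "s = sum \<rho> {..<l}"
  have sum\<tau>: "sum \<tau> {..<l} = s" by (auto simp: s_def \<tau>_def intro: sum.cong)
  have \<tau>z: "\<tau> i = 0" if "i \<ge> l" for i
    using that Suc.prems(2) by (cases "i = l") (auto simp: \<tau>_def)
  have \<tau>: "\<tau> \<in> part_fun s"
  proof (rule ParI[OF _ \<tau>z sum\<tau>])
    show "\<tau> (Suc i) \<le> \<tau> i" for i
      using part_fun_antimono[OF Suc.prems(1), of i "Suc i"] Suc.prems(2) by (auto simp: \<tau>_def)
  qed
  have int: "interlaces \<tau> \<rho>"
    using part_fun_antimono[OF Suc.prems(1), of _ "Suc _"] Suc.prems(2) by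
        (auto simp: \<tau>_def interlaces_def)
  have "kostka_count \<rho> l \<sigma> = (if \<sigma> = \<tau> then 1 else 0)" if "\<sigma> \<in> part_fun s" "interlaces \<sigma> \<rho>" for \<sigma>
  proof (cases "\<sigma> = \<tau>")
    case True
    have "kostka_count \<rho> l \<tau> = kostka_count \<tau> l \<tau>" by (rule kostka_count_cong) (simp add: \<tau>_def)
    also have "\<dots> = 1" by (rule Suc.IH[OF \<tau>]) (use \<tau>z in auto)
    finally show ?thesis using True by simp
  next
    case False
    have "kostka_count \<rho> l \<sigma> = 0"
    proof (rule ccontr)
      assume "kostka_count \<rho> l \<sigma> \<noteq> 0"
      from kostka_count_nonzero_dominates[OF this] that(1)
      have z: "\<forall>i\<ge>l. \<sigma> i = 0" and le: "s \<le> sum \<sigma> {..<l}" by (auto simp: s_def)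
      have "\<sigma> i = \<rho> i" if "i < l" for i
      proof (rule ccontr)
        assume "\<sigma> i \<noteq> \<rho> i"
        then have "sum \<sigma> {..<l} < sum \<rho> {..<l}"
          using \<open>interlaces \<sigma> \<rho>\<close> that
          by (intro sum_strict_mono_ex1)
              (auto simp: interlaces_def le_neq_implies_less intro!: bexI[of _ i])
        then show False using le by (simp add: s_def)
      qed
      then have "\<sigma> = \<tau>" using z \<tau>z by (auto simp: \<tau>_def fun_eq_iff) (metis not_le)
      then show False using False by simp
    qed
    then show ?thesis using False by simp
  qed
  then have "kostka_count \<rho> (Suc l) \<rho> = (\<Sum>\<sigma> | \<sigma> \<in> part_fun s \<and> interlaces \<sigma> \<rho>. if \<sigma>
      = \<tau> then 1 else 0)"
    by (simp add: s_def)
  also have "\<dots> = 1" using \<tau> int finite_part_fun by (subst sum.delta) auto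
  finally show ?case .
qed

text \<open>Summation by parts with a decreasing weight and nonnegative partial sums. Keeping the
  boundary term makes the induction work; it vanishes when the increments sum to zero.\<close>

lemma sum_mult_ge_Abel:
  fixes m d :: "nat \<Rightarrow> int"
  assumes "\<And>i. m (Suc i) \<le> m i" "\<And>k. k \<le> l \<Longrightarrow> 0 \<le> sum d {..<k}" "k \<le> l"
  shows "m k * sum d {..<k} \<le> (\<Sum>i<k. m i * d i)"
  using assms(3)
proof (induction k)
  case (Suc k)
  have "m (Suc k) * sum d {..<Suc k} \<le> m k * sum d {..<Suc k}"
    using assms(1) assms(2)[OF Suc.prems] by (intro mult_right_mono)
  also have "\<dots> \<le> (\<Sum>i<Suc k. m i * d i)" using Suc by (simp add: algebra_simps)
  finally show ?case .
qed simp

text \<open>With \<open>d = \<rho> - \<mu>\<close>, the sums of squares differ by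
  \<open>|d|^2\<close> plus twice the scalar product of \<mu> and \<open>d\<close>, and dominance
  makes the latter nonnegative. The sum of squares thus turns dominance into a numerical measure for
  induction.\<close>

lemma kostka_count_nonzero_sum_squares:
  assumes "\<mu> \<in> part_fun n" "\<rho> \<in> part_fun n" "kostka_count \<mu> n \<rho> \<noteq> 0" "\<rho> \<noteq> \<mu>"
  shows "(\<Sum>i<n. (\<mu> i)\<^sup>2) < (\<Sum>i<n. (\<rho> i)\<^sup>2)"
proof -
  define m d where "m i = int (\<mu> i)" and "d i = int (\<rho> i) - int (\<mu> i)" for i
  have n: "sum \<mu> {..<n} = n" "sum \<rho> {..<n} = n" using assms by (auto simp: part_fun_def)
  have "\<forall>k\<le>n. sum \<mu> {..<k} \<le> sum \<rho> {..<k}"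
    using kostka_count_nonzero_dominates[OF assms(3)] assms(2) n by simp
  then have "0 \<le> sum d {..<k}" if "k \<le> n" for k
    using that by (simp add: d_def sum_subtractf flip: of_nat_sum)
  then have "m n * sum d {..<n} \<le> (\<Sum>i<n. m i * d i)"
    by (intro sum_mult_ge_Abel[of m n]) (use part_fun_antimono[OF assms(1)] in \<open>auto simp: m_def\<close>)
  moreover have "sum d {..<n} = 0" unfolding d_def sum_subtractf of_nat_sum[symmetric]
      using n by simp
  ultimately have ge: "0 \<le> (\<Sum>i<n. m i * d i)" by simp
  obtain i where "\<rho> i \<noteq> \<mu> i" using assms(4) by auto
  then have "i < n" using part_fun_zero[OF assms(1)] part_fun_zero[OF assms(2)] by (metis not_le)
  then have "0 < (\<Sum>i<n. (d i)\<^sup>2)"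
    using \<open>\<rho> i \<noteq> \<mu> i\<close> by (intro sum_pos2[of _ i]) (auto simp: d_def)
  then have "0 < (\<Sum>i<n. (d i)\<^sup>2) + 2 * (\<Sum>i<n. m i * d i)" using ge by simp
  also have "\<dots> = (\<Sum>i<n. (int (\<rho> i))\<^sup>2 - (int (\<mu> i))\<^sup>2)"
    unfolding sum_distrib_left sum.distrib[symmetric]
    by (rule sum.cong) (auto simp: d_def m_def power2_eq_square algebra_simps)
  finally have "(\<Sum>i<n. (int (\<mu> i))\<^sup>2) < (\<Sum>i<n. (int (\<rho> i))\<^sup>2)" by (simp add: sum_subtractf)
  also have "(\<Sum>i<n. (int (\<mu> i))\<^sup>2) = int (\<Sum>i<n. (\<mu> i)\<^sup>2)" by simp
  also have "(\<Sum>i<n. (int (\<rho> i))\<^sup>2) = int (\<Sum>i<n. (\<rho> i)\<^sup>2)" by simp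
  finally show ?thesis by (simp only: of_nat_less_iff)
qed

text \<open>By induction towards larger \<open>q\<close>, the only possible defect of the formula at \<open>(\<alpha>, \<mu>)\<close> is governed by one number
  \<open>V \<mu> \<alpha>\<close>; symmetry gives \<open>V \<mu> \<alpha> = V \<alpha> \<mu>\<close>, while triangularity makes one of the two vanish.\<close>

lemma traces_from_triangular_recursion:
  fixes K :: "'a \<Rightarrow> 'a \<Rightarrow> real" and t :: "nat \<Rightarrow> 'a \<Rightarrow> 'a \<Rightarrow> real" and q :: "'a \<Rightarrow> nat"
  assumes fin: "finite A"
    and K1: "\<And>\<rho>. \<rho> \<in> A \<Longrightarrow> K \<rho> \<rho> = 1"
    and Ktri: "\<And>\<rho> \<mu>. \<rho> \<in> A \<Longrightarrow> \<mu> \<in> A \<Longrightarrow> K \<rho> \<mu> \<noteq> 0 \<Longrightarrow> \<rho> \<noteq> \<mu> \<Longrightarrow> q \<mu> < q \<rho>"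
    and t0: "\<And>\<alpha> \<mu>. \<alpha> \<in> A \<Longrightarrow> \<mu> \<in> A \<Longrightarrow> t 0 \<alpha> \<mu> = (\<Sum>\<rho>\<in>A. K \<rho> \<alpha> * K \<rho> \<mu>)"
    and sym: "\<And>k \<alpha> \<mu>. \<alpha> \<in> A \<Longrightarrow> \<mu> \<in> A \<Longrightarrow> t k \<alpha> \<mu> = t k \<mu> \<alpha>"
    and rec: "\<And>k \<alpha> \<mu>. \<alpha> \<in> A \<Longrightarrow> \<mu> \<in> A \<Longrightarrow>
      t (Suc k) \<alpha> \<mu> = c \<mu> * t k \<alpha> \<mu> + (\<Sum>\<nu> | \<nu> \<in> A \<and> q \<mu> < q \<nu>. B \<mu> \<nu> * t k \<alpha> \<nu>)"
    and mem: "\<alpha> \<in> A" "\<mu> \<in> A"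
  shows "t k \<alpha> \<mu> = (\<Sum>\<rho>\<in>A. c \<rho> ^ k * K \<rho> \<alpha> * K \<rho> \<mu>)"
proof -
  define S where "S k \<alpha> \<mu> = (\<Sum>\<rho>\<in>A. c \<rho> ^ k * K \<rho> \<alpha> * K \<rho> \<mu>)" for k \<alpha> \<mu>
  \<comment> \<open>The defect of the claimed formula under one step of the recursion. In the
    application, \<open>V \<mu> \<rho> = 0\<close> is Freudenthal's formula for the weight
    multiplicities \<open>K\<close>.\<close>
  define V where "V \<mu> \<rho> = (\<Sum>\<nu> | \<nu> \<in> A \<and> q \<mu> < q \<nu>. B \<mu> \<nu> * K \<rho> \<nu>) - (c \<rho> - c \<mu>) * K \<rho> \<mu>" for \<mu> \<rho>
  define M where "M = (\<Sum>a\<in>A. q a)"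
  have qM: "q a \<le> M" if "a \<in> A" for a using member_le_sum[OF that, of q] fin by (simp add: M_def)
  have S_sym: "S k \<alpha> \<mu> = S k \<mu> \<alpha>" for k \<alpha> \<mu> by (simp add: S_def mult_ac)
  have S_rec: "c \<mu> * S k \<alpha> \<mu> + (\<Sum>\<nu> | \<nu> \<in> A \<and> q \<mu> < q \<nu>. B \<mu> \<nu> * S k \<alpha> \<nu>)
      = S (Suc k) \<alpha> \<mu> + (\<Sum>\<rho>\<in>A. c \<rho> ^ k * K \<rho> \<alpha> * V \<mu> \<rho>)" for k \<alpha> \<mu>
  proof -
    have "(\<Sum>\<nu> | \<nu> \<in> A \<and> q \<mu> < q \<nu>. B \<mu> \<nu> * S k \<alpha> \<nu>)
      = (\<Sum>\<rho>\<in>A. \<Sum>\<nu> | \<nu> \<in> A \<and> q \<mu> < q \<nu>. B \<mu> \<nu> * (c \<rho> ^ k * K \<rho> \<alpha> * K \<rho> \<nu>))"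
      unfolding S_def sum_distrib_left by (rule sum.swap)
    also have "\<dots> = (\<Sum>\<rho>\<in>A. c \<rho> ^ k * K \<rho> \<alpha> * (V \<mu> \<rho> + (c \<rho> - c \<mu>) * K \<rho> \<mu>))"
      unfolding V_def by (simp add: sum_distrib_left mult_ac)
    finally show ?thesis
      by (simp add: S_def sum_distrib_left sum.distrib[symmetric] algebra_simps)
  qed
  have V_zero: "V \<mu> \<rho> = 0" if "\<mu> \<in> A" "\<rho> \<in> A" "\<rho> = \<mu> \<or> q \<rho> \<le> q \<mu>" for \<mu> \<rho>
  proof -
    have "K \<rho> \<nu> = 0" if "\<nu> \<in> A" "q \<mu> < q \<nu>" for \<nu>
      using Ktri[of \<rho> \<nu>] that \<open>\<rho> \<in> A\<close> \<open>\<rho> = \<mu> \<or> q \<rho> \<le> q \<mu>\<close> by (cases "\<rho> = \<nu>") fastforce+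
    moreover have "(c \<rho> - c \<mu>) * K \<rho> \<mu> = 0"
      using Ktri[of \<rho> \<mu>] that by (cases "\<rho> = \<mu>") auto
    ultimately show ?thesis by (simp add: V_def)
  qed
  have "\<forall>k. t k \<alpha> \<mu> = S k \<alpha> \<mu>"
    using mem
  \<comment> \<open>\<open>M\<close> bounds \<open>q\<close> on \<open>A\<close>, so the measure
    drops as soon as \<open>q \<alpha> + q \<mu>\<close> grows.\<close>
  proof (induction "(M - q \<alpha>) + (M - q \<mu>)" arbitrary: \<alpha> \<mu> rule: less_induct)
    case less
    have IH: "t k \<alpha>' \<mu>' = S k \<alpha>' \<mu>'"
      if "\<alpha>' \<in> A" "\<mu>' \<in> A" "q \<alpha> + q \<mu> < q \<alpha>' + q \<mu>'" for \<alpha>' \<mu>' k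
      using less(1)[of \<alpha>' \<mu>'] that qM[of \<alpha>'] qM[of \<mu>'] qM[of \<alpha>] qM[of \<mu>] less.prems by auto
    \<comment> \<open>Stated for both orders of the pair: the recursion acts on the second argument
      only, and the two outcomes will be compared by symmetry.\<close>
    have defect: "t (Suc k) a m = c m * t k a m + S (Suc k) a m - c m * S k a m + c a ^ k * V m a"
      if am: "(a = \<alpha> \<and> m = \<mu>) \<or> (a = \<mu> \<and> m = \<alpha>)" for a m k
    proof -
      have mem': "a \<in> A" "m \<in> A" using am less.prems by auto
      have IH': "t k \<alpha>' \<mu>' = S k \<alpha>' \<mu>'"
        if "\<alpha>' \<in> A" "\<mu>' \<in> A" "q a + q m < q \<alpha>' + q \<mu>'" for \<alpha>' \<mu>' k
        using IH[of \<alpha>' \<mu>'] that am by (auto simp: add.commute)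
      \<comment> \<open>For \<open>q a < q \<rho>\<close> the formula at \<open>(\<rho>, m)\<close>
        is already known, so the recursion with \<open>k = 0\<close> gives
        \<open>\<Sum> K \<tau> \<rho> * V m \<tau> = 0\<close>. Unitriangularity solves these
        equations for \<open>V m \<rho>\<close>, starting from the largest \<open>q\<close>.\<close>
      have V0: "V m \<rho> = 0" if "\<rho> \<in> A" "q a < q \<rho>" for \<rho>
        using that
      proof (induction "M - q \<rho>" arbitrary: \<rho> rule: less_induct)
        case (less \<rho>)
        have "S 1 \<rho> m = t (Suc 0) \<rho> m" using IH'[of \<rho> m 1] less mem' by simp
        also have "\<dots> = c m * S 0 \<rho> m + (\<Sum>\<nu> | \<nu> \<in> A \<and> q m < q \<nu>. B m \<nu> * S 0 \<rho> \<nu>)"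
          unfolding rec[OF less(2) mem'(2)] using less mem' by (simp add: IH')
        also have "\<dots> = S 1 \<rho> m + (\<Sum>\<tau>\<in>A. K \<tau> \<rho> * V m \<tau>)" unfolding S_rec by simp
        finally have "(\<Sum>\<tau>\<in>A. K \<tau> \<rho> * V m \<tau>) = 0" by simp
        moreover have "(\<Sum>\<tau>\<in>A. K \<tau> \<rho> * V m \<tau>) = (\<Sum>\<tau>\<in>A. if \<tau> = \<rho> then V m \<rho> else 0)"
        proof (rule sum.cong[OF refl])
          fix \<tau> assume "\<tau> \<in> A"
          show "K \<tau> \<rho> * V m \<tau> = (if \<tau> = \<rho> then V m \<rho> else 0)"
          proof (cases "\<tau> = \<rho> \<or> K \<tau> \<rho> = 0")
            case True
            then show ?thesis using K1[OF \<open>\<rho> \<in> A\<close>] by auto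
          next
            case False
            then have "q \<rho> < q \<tau>" using Ktri[of \<tau> \<rho>] \<open>\<tau> \<in> A\<close> \<open>\<rho> \<in> A\<close> by blast
            then have "V m \<tau> = 0" using less(1)[of \<tau>] \<open>\<tau> \<in> A\<close> qM[of \<tau>] less(3) by simp
            then show ?thesis using False by simp
          qed
        qed
        ultimately show ?case using less(2) fin by simp
      qed
      have "(\<Sum>\<rho>\<in>A. c \<rho> ^ k * K \<rho> a * V m \<rho>) = (\<Sum>\<rho>\<in>A. if \<rho> = a then c a ^ k * V m a else 0)"
      proof (rule sum.cong[OF refl])
        fix \<rho> assume "\<rho> \<in> A"
        show "c \<rho> ^ k * K \<rho> a * V m \<rho> = (if \<rho> = a then c a ^ k * V m a else 0)"
          using K1[OF mem'(1)] Ktri[OF \<open>\<rho> \<in> A\<close> mem'(1)] V0[OF \<open>\<rho> \<in> A\<close>] by (cases "\<rho> = a") auto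
      qed
      then have Vsum: "(\<Sum>\<rho>\<in>A. c \<rho> ^ k * K \<rho> a * V m \<rho>) = c a ^ k * V m a"
        using fin mem' by simp
      have "t (Suc k) a m = c m * t k a m + (\<Sum>\<nu> | \<nu> \<in> A \<and> q m < q \<nu>. B m \<nu> * S k a \<nu>)"
        unfolding rec[OF mem'] using mem' by (simp add: IH')
      also have "(\<Sum>\<nu> | \<nu> \<in> A \<and> q m < q \<nu>. B m \<nu> * S k a \<nu>)
        = S (Suc k) a m - c m * S k a m + c a ^ k * V m a"
        using S_rec[of m k a] Vsum by simp
      finally show ?thesis by simp
    qed
    have t0S: "t 0 a m = S 0 a m" if "a \<in> A" "m \<in> A" for a m using t0[OF that] by (simp add: S_def)
    have "t 1 \<alpha> \<mu> = S 1 \<alpha> \<mu> + V \<mu> \<alpha>"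
      using defect[of \<alpha> \<mu> 0] t0S less.prems by simp
    moreover have "t 1 \<mu> \<alpha> = S 1 \<mu> \<alpha> + V \<alpha> \<mu>"
      using defect[of \<mu> \<alpha> 0] t0S less.prems by simp
    ultimately have "V \<mu> \<alpha> = V \<alpha> \<mu>" using sym[of \<alpha> \<mu> 1] S_sym[of 1 \<alpha> \<mu>] less.prems by simp
    then have Vz: "V \<mu> \<alpha> = 0"
      using V_zero[of \<mu> \<alpha>] V_zero[of \<alpha> \<mu>] less.prems by (cases "q \<alpha> \<le> q \<mu>") auto
    show ?case
    proof
      show "t k \<alpha> \<mu> = S k \<alpha> \<mu>" for k
        by (induction k) (use t0S less.prems defect[of \<alpha> \<mu>] Vz in auto)
    qed
  qed
  then show ?thesis by (simp add: S_def)
qed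

section \<open>Operators on functions of tables\<close>

type_synonym table_fun = "table \<Rightarrow> real"

definition incr :: "nat \<Rightarrow> nat \<Rightarrow> (nat \<Rightarrow> nat \<Rightarrow> nat) \<Rightarrow> nat \<Rightarrow> nat \<Rightarrow> nat" where
  "incr i j T = (\<lambda>k l. if k = i \<and> l = j then Suc (T k l) else T k l)"

definition decr :: "nat \<Rightarrow> nat \<Rightarrow> (nat \<Rightarrow> nat \<Rightarrow> nat) \<Rightarrow> nat \<Rightarrow> nat \<Rightarrow> nat" where
  "decr i j T = (\<lambda>k l. if k = i \<and> l = j then T k l - 1 else T k l)"

text \<open>\<open>raise\<close> and \<open>lower\<close> satisfy the canonical commutation relations; the weight \<open>T i j\<close> in \<open>lower\<close> makes the truncated
  subtraction in \<open>decr\<close> harmless.\<close>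

definition raise :: "nat \<Rightarrow> nat \<Rightarrow> table_fun \<Rightarrow> table_fun" where
  "raise i j f = (\<lambda>T. f (incr i j T))"

definition lower :: "nat \<Rightarrow> nat \<Rightarrow> table_fun \<Rightarrow> table_fun" where
  "lower i j f = (\<lambda>T. real (T i j) * f (decr i j T))"

lemma incr_commute: "incr k l (incr i j T) = incr i j (incr k l T)"
  by (auto simp: incr_def fun_eq_iff)

lemma raise_commute: "raise i j (raise k l f) = raise k l (raise i j f)"
  by (simp add: raise_def incr_commute[of k])

lemma lower_commute: "lower i j (lower k l f) = lower k l (lower i j f)"
proof (cases "i = k \<and> j = l")
  case False
  have "decr k l (decr i j T) = decr i j (decr k l T)" for T
    using False by (auto simp: decr_def fun_eq_iff)
  moreover have "decr k l T i j = T i j" "decr i j T k l = T k l" for T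
    using False by (auto simp: decr_def)
  ultimately show ?thesis by (simp add: lower_def mult_ac)
qed simp

lemma raise_lower:
  "raise i j (lower k l f) T = lower k l (raise i j f) T + (if k = i \<and> l = j then f T else 0)"
proof (cases "k = i \<and> l = j")
  case True
  have "decr i j (incr i j T) = T" by (auto simp: decr_def incr_def fun_eq_iff)
  moreover have "incr i j (decr i j T) = T" if "T i j \<noteq> 0"
    using that by (auto simp: decr_def incr_def fun_eq_iff)
  moreover have "incr i j T i j = Suc (T i j)" by (simp add: incr_def)
  ultimately show ?thesis using True
    by (cases "T i j = 0") (auto simp: raise_def lower_def algebra_simps)
next
  case False
  then have "decr k l (incr i j T) = incr i j (decr k l T)" "incr i j T k l = T k l"
    by (auto simp: decr_def incr_def fun_eq_iff)
  then show ?thesis using False by (auto simp: raise_def lower_def)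
qed

lemma raise_sum: "raise i j (\<lambda>T. \<Sum>x\<in>A. g x T) = (\<lambda>T. \<Sum>x\<in>A. raise i j (g x) T)"
  by (simp add: raise_def)

lemma lower_sum: "lower i j (\<lambda>T. \<Sum>x\<in>A. g x T) = (\<lambda>T. \<Sum>x\<in>A. lower i j (g x) T)"
  by (simp add: lower_def sum_distrib_left)

lemma lower_add: "lower i j (\<lambda>T. f T + g T) = (\<lambda>T. lower i j f T + lower i j g T)"
  by (simp add: lower_def algebra_simps)

lemma lower_zero: "lower i j (\<lambda>T. 0) = (\<lambda>T. 0)"
  by (simp add: lower_def)

text \<open>One step of normal ordering below an outer \<open>lower\<close>: moving
  \<open>raise\<close> inward leaves a contraction exactly when the two cells coincide.\<close>

lemma lower_raise_lower:
  "lower i j (raise a b (lower k l f)) T =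
    lower i j (lower k l (raise a b f)) T + (if k = a \<and> l = b then lower i j f T else 0)"
proof -
  have "raise a b (lower k l f) = (\<lambda>T. lower k l (raise a b f) T + (if k = a \<and> l
      = b then f T else 0))"
    by (simp add: fun_eq_iff raise_lower)
  then show ?thesis by (cases "k = a \<and> l = b") (auto simp: lower_add lower_zero)
qed

text \<open>On the direction, for distinct \<open>a\<close> and \<open>b\<close>: if
  \<open>T\<close> has column sums \<mu>, then \<open>f\<close> is read at tables with one ball
  fewer in column \<open>a\<close> and one more in column \<open>b\<close>.\<close>

definition column_op :: "nat \<Rightarrow> nat \<Rightarrow> nat \<Rightarrow> table_fun \<Rightarrow> table_fun" where
  "column_op m a b f = (\<lambda>T. \<Sum>i<m. lower i a (raise i b f) T)"

definition row_op :: "nat \<Rightarrow> nat \<Rightarrow> nat \<Rightarrow> table_fun \<Rightarrow> table_fun" where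
  "row_op n i k f = (\<lambda>T. \<Sum>j<n. lower i j (raise k j f) T)"

text \<open>The commuting actions of the Howe dual pair gl_m, gl_n. Both products have the same
  normal-ordered part, and their single contractions, at the cell \<open>(k, a)\<close> on the left
  and \<open>(i, b)\<close> on the right, both leave \<open>lower i a (raise k b f)\<close>.\<close>

lemma row_op_column_op_commute:
  assumes "i < m" "k < m" "a < n" "b < n"
  shows "row_op n i k (column_op m a b f) T = column_op m a b (row_op n i k f) T"
proof -
  have "row_op n i k (column_op m a b f) T =
      (\<Sum>j<n. \<Sum>p<m. lower i j (raise k j (lower p a (raise p b f))) T)"
    by (simp add: row_op_def column_op_def raise_sum lower_sum)
  also have "\<dots> = (\<Sum>j<n. \<Sum>p<m. lower i j (lower p a (raise k j (raise p b f))) T)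
      + (\<Sum>j<n. \<Sum>p<m. if p = k \<and> a = j then lower i j (raise p b f) T else 0)"
    by (simp add: lower_raise_lower sum.distrib)
  also have "(\<Sum>j<n. \<Sum>p<m. if p = k \<and> a = j then lower i j (raise p b f) T else 0)
      = (\<Sum>j<n. if j = a then \<Sum>p<m. if p = k then lower i j (raise p b f) T else 0 else 0)"
    by (intro sum.cong refl) auto
  also have "\<dots> = lower i a (raise k b f) T" using assms by simp
  also have "\<dots> = (\<Sum>j<n. if j = b then \<Sum>p<m. if p = i then lower p a (raise k j f) T else 0 else 0)"
    using assms by simp
  also have "\<dots> = (\<Sum>j<n. \<Sum>p<m. if i = p \<and> j = b then lower p a (raise k j f) T else 0)"
    by (intro sum.cong refl) auto
  also have "(\<Sum>j<n. \<Sum>p<m. lower i j (lower p a (raise k j (raise p b f))) T) + \<dots> =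
      (\<Sum>j<n. \<Sum>p<m. lower p a (raise p b (lower i j (raise k j f))) T)"
    unfolding sum.distrib[symmetric]
  proof (rule sum.cong[OF refl], rule sum.cong[OF refl])
    fix j p
    show "lower i j (lower p a (raise k j (raise p b f))) T +
        (if i = p \<and> j = b then lower p a (raise k j f) T else 0) =
      lower p a (raise p b (lower i j (raise k j f))) T"
      unfolding lower_raise_lower lower_commute[of i j p a] raise_commute[of k j p b] ..
  qed
  also have "\<dots> = (\<Sum>p<m. \<Sum>j<n. lower p a (raise p b (lower i j (raise k j f))) T)"
    by (rule sum.swap)
  also have "\<dots> = column_op m a b (row_op n i k f) T"
    by (simp add: row_op_def column_op_def raise_sum lower_sum)
  finally show ?thesis .
qed

text \<open>Both removals are made before the additions, so the weight counts ordered pairs of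
  different balls even within one cell. Pairs in a common row or column are included; exchanging
  them changes nothing.\<close>

definition swap_op :: "nat \<Rightarrow> nat \<Rightarrow> table_fun \<Rightarrow> table_fun" where
  "swap_op m n f = (\<lambda>T. \<Sum>i<m. \<Sum>k<m. \<Sum>j<n. \<Sum>l<n. lower i j (lower k l (raise i l (raise k j f))) T)"

text \<open>For each \<open>i\<close>, every one of the \<open>m\<close> values of \<open>k\<close>
  leaves one contraction \<open>row_op n i i\<close>. Since only row operators occur here,
  commutation with \<open>column_op\<close> follows at once.\<close>

lemma swap_op_row_op:
  "swap_op m n f T = (\<Sum>i<m. \<Sum>k<m. row_op n i k (row_op n k i f) T) - real m *
      (\<Sum>i<m. row_op n i i f T)"
proof -
  have "row_op n i k (row_op n k i f) T =
      (\<Sum>j<n. \<Sum>l<n. lower i j (lower k l (raise i l (raise k j f))) T) + row_op n i i f T" for i k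
  proof -
    have "row_op n i k (row_op n k i f) T =
        (\<Sum>j<n. \<Sum>l<n. lower i j (raise k j (lower k l (raise i l f))) T)"
      by (simp add: row_op_def raise_sum lower_sum)
    also have "\<dots> = (\<Sum>j<n. \<Sum>l<n. lower i j (lower k l (raise i l (raise k j f))) T)
        + (\<Sum>j<n. \<Sum>l<n. if l = j then lower i j (raise i l f) T else 0)"
      unfolding sum.distrib[symmetric]
      by (intro sum.cong refl) (simp add: lower_raise_lower raise_commute[of k])
    finally show ?thesis by (simp add: row_op_def)
  qed
  then show ?thesis by (simp add: swap_op_def sum.distrib sum_distrib_left)
qed

lemma column_op_sum: "column_op m a b (\<lambda>T. \<Sum>x\<in>A. g x T) = (\<lambda>T. \<Sum>x\<in>A. column_op m a b (g x) T)"
  unfolding column_op_def raise_sum lower_sum by (rule ext, rule sum.swap)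

lemma column_op_diff_scale:
  "column_op m a b (\<lambda>T. f T - c * g T) = (\<lambda>T. column_op m a b f T - c * column_op m a b g T)"
  by (simp add: column_op_def raise_def lower_def fun_eq_iff algebra_simps sum_subtractf sum_distrib_left)

lemma swap_op_column_op_commute:
  assumes "a < n" "b < n"
  shows "swap_op m n (column_op m a b f) = column_op m a b (swap_op m n f)"
proof
  fix T
  have rc: "row_op n i k (column_op m a b f) = column_op m a b (row_op n i k f)"
      if "i < m" "k < m" for i k f
    using row_op_column_op_commute[of i m k a n b f] that assms by (simp add: fun_eq_iff)
  have "swap_op m n f = (\<lambda>T. (\<Sum>i<m. \<Sum>k<m. row_op n i k (row_op n k i f) T) - real m *
      (\<Sum>i<m. row_op n i i f T))"
    by (simp add: swap_op_row_op fun_eq_iff)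
  then have "column_op m a b (swap_op m n f) T =
     (\<Sum>i<m. \<Sum>k<m. column_op m a b (row_op n i k (row_op n k i f)) T)
       - real m * (\<Sum>i<m. column_op m a b (row_op n i i f) T)"
    by (simp add: column_op_sum column_op_diff_scale)
  then show "swap_op m n (column_op m a b f) T = column_op m a b (swap_op m n f) T"
    by (simp add: swap_op_row_op rc)
qed

lemma swap_op_pow_column_op_commute:
  assumes "a < n" "b < n"
  shows "(swap_op m n ^^ k) (column_op m a b f) = column_op m a b ((swap_op m n ^^ k) f)"
  by (induction k) (simp_all add: swap_op_column_op_commute assms)

text \<open>The normal-ordered product of \<open>column_op m a b\<close> and
  \<open>column_op m b a\<close>; it is symmetric in the two columns, although the plain product is
  not.\<close>

definition column_pair_op :: "nat \<Rightarrow> nat \<Rightarrow> nat \<Rightarrow> table_fun \<Rightarrow> table_fun" where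
  "column_pair_op m a b f = (\<lambda>T. \<Sum>i<m. \<Sum>k<m. lower i a (lower k b (raise i b (raise k a f))) T)"

lemma swap_op_column_pair_op: "swap_op m n f T = (\<Sum>a<n. \<Sum>b<n. column_pair_op m a b f T)"
proof -
  have "swap_op m n f T =
    (\<Sum>i<m. \<Sum>a<n. \<Sum>k<m. \<Sum>b<n. lower i a (lower k b (raise i b (raise k a f))) T)"
    unfolding swap_op_def by (intro sum.cong refl sum.swap)
  also have "\<dots> = (\<Sum>a<n. \<Sum>i<m. \<Sum>k<m. \<Sum>b<n. lower i a (lower k b (raise i b (raise k a f))) T)"
    by (rule sum.swap)
  also have "\<dots> = (\<Sum>a<n. \<Sum>i<m. \<Sum>b<n. \<Sum>k<m. lower i a (lower k b (raise i b (raise k a f))) T)"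
    by (intro sum.cong refl sum.swap)
  also have "\<dots> = (\<Sum>a<n. \<Sum>b<n. column_pair_op m a b f T)"
    unfolding column_pair_op_def by (intro sum.cong refl sum.swap)
  finally show ?thesis .
qed

lemma column_pair_op_commute: "column_pair_op m a b f = column_pair_op m b a f"
proof
  fix T
  have "column_pair_op m a b f T = (\<Sum>k<m. \<Sum>i<m. lower i a (lower k b (raise i b (raise k a f))) T)"
    unfolding column_pair_op_def by (rule sum.swap)
  then show "column_pair_op m a b f T = column_pair_op m b a f T"
    by (simp add: column_pair_op_def lower_commute[of _ a] raise_commute[of _ b])
qed

lemma lower_raise_same: "lower i j (raise i j f) T = real (T i j) * f T"
proof (cases "T i j = 0")
  case False
  then have "incr i j (decr i j T) = T" by (auto simp: incr_def decr_def fun_eq_iff)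
  then show ?thesis by (simp add: lower_def raise_def)
qed (simp add: lower_def)

text \<open>The contraction is the case in which the ball just moved is moved back; it counts the
  balls in column \<open>a\<close>.\<close>

lemma column_op_column_op:
  "column_op m a b (column_op m b a f) T = column_pair_op m a b f T + real (\<Sum>i<m. T i a) * f T"
proof -
  have "column_op m a b (column_op m b a f) T =
      (\<Sum>i<m. \<Sum>k<m. lower i a (raise i b (lower k b (raise k a f))) T)"
    by (simp add: column_op_def raise_sum lower_sum)
  also have "\<dots> = column_pair_op m a b f T + (\<Sum>i<m. \<Sum>k<m. if k
      = i then lower i a (raise k a f) T else 0)"
    by (simp add: lower_raise_lower sum.distrib column_pair_op_def)
  also have "(\<Sum>i<m. \<Sum>k<m. if k = i then lower i a (raise k a f) T else 0) = real (\<Sum>i<m. T i a)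
      * f T"
    by (simp add: lower_raise_same sum_distrib_right)
  finally show ?thesis .
qed

lemma column_pair_op_same: "column_pair_op m a a f T = real (\<Sum>i<m. T i a) * (real (\<Sum>i<m. T i a)
    - 1) * f T"
proof -
  have "column_op m a a f T = real (\<Sum>i<m. T i a) * f T" for f T
    by (simp add: column_op_def lower_raise_same sum_distrib_right)
  then show ?thesis using column_op_column_op[of m a a f T] by (simp add: algebra_simps)
qed

section \<open>Kernels and traces of operators between finite sets\<close>

definition point_fun :: "'a \<Rightarrow> 'a \<Rightarrow> real" where
  "point_fun T = (\<lambda>T'. if T' = T then 1 else 0)"

text \<open>Operators act on functions of all tables. Here their values on \<open>S\<close> come
  from a matrix with rows \<open>S\<close> and columns \<open>S'\<close>, which expresses linearity
  and the change of column sums at once.\<close>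

definition has_kernel :: "(('a \<Rightarrow> real) \<Rightarrow> 'a \<Rightarrow> real) \<Rightarrow> 'a set \<Rightarrow> 'a set \<Rightarrow> bool" where
  "has_kernel X S S' \<longleftrightarrow> (\<forall>f. \<forall>T\<in>S. X f T = (\<Sum>T'\<in>S'. X (point_fun T') T * f T'))"

definition op_trace :: "'a set \<Rightarrow> (('a \<Rightarrow> real) \<Rightarrow> 'a \<Rightarrow> real) \<Rightarrow> real" where
  "op_trace S X = (\<Sum>T\<in>S. X (point_fun T) T)"

text \<open>The targets are constrained only where the weight is nonzero, because a move out of an
  empty cell, where \<open>decr\<close> truncates, may land outside \<open>S'\<close>.\<close>

lemma has_kernelI:
  assumes "finite S'" "\<And>f T. T \<in> S \<Longrightarrow> X f T = (\<Sum>k\<in>I T. w k T * f (s k T))"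
    and "\<And>k T. T \<in> S \<Longrightarrow> k \<in> I T \<Longrightarrow> w k T \<noteq> 0 \<Longrightarrow> s k T \<in> S'"
  shows "has_kernel X S S'"
  unfolding has_kernel_def
proof (intro allI ballI)
  fix f T assume T: "T \<in> S"
  have "(\<Sum>T'\<in>S'. X (point_fun T') T * f T') = (\<Sum>T'\<in>S'. \<Sum>k\<in>I T. w k T * (if s k T
      = T' then f T' else 0))"
    unfolding assms(2)[OF T] sum_distrib_right by (intro sum.cong refl) (simp add: point_fun_def)
  also have "\<dots> = (\<Sum>k\<in>I T. \<Sum>T'\<in>S'. w k T * (if s k T = T' then f T' else 0))"
    by (rule sum.swap)
  also have "\<dots> = (\<Sum>k\<in>I T. w k T * f (s k T))"
  proof (rule sum.cong[OF refl])
    fix k assume "k \<in> I T"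
    then show "(\<Sum>T'\<in>S'. w k T * (if s k T = T' then f T' else 0)) = w k T * f (s k T)"
      using assms(1,3) T unfolding sum_distrib_left[symmetric] by (cases "w k T = 0") auto
  qed
  also have "\<dots> = X f T" using assms(2)[OF T] by simp
  finally show "X f T = (\<Sum>T'\<in>S'. X (point_fun T') T * f T')" by simp
qed

lemma has_kernel_comp:
  assumes "has_kernel X S S'" "has_kernel Z S' S''"
  shows "has_kernel (\<lambda>f. X (Z f)) S S''"
  unfolding has_kernel_def
proof (intro allI ballI)
  fix f T assume T: "T \<in> S"
  have X: "X g T = (\<Sum>T'\<in>S'. X (point_fun T') T * g T')" for g
    using assms(1) T by (auto simp: has_kernel_def)
  have Z: "T' \<in> S' \<Longrightarrow> Z g T' = (\<Sum>T''\<in>S''. Z (point_fun T'') T' * g T'')" for g T'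
    using assms(2) by (auto simp: has_kernel_def)
  have "X (Z f) T = (\<Sum>T'\<in>S'. \<Sum>T''\<in>S''. X (point_fun T') T * (Z (point_fun T'') T' * f T''))"
    unfolding X[of "Z f"] by (intro sum.cong refl) (simp add: Z[of _ f] sum_distrib_left)
  also have "\<dots> = (\<Sum>T''\<in>S''. \<Sum>T'\<in>S'. X (point_fun T') T * (Z (point_fun T'') T' * f T''))"
      by (rule sum.swap)
  also have "\<dots> = (\<Sum>T''\<in>S''. X (Z (point_fun T'')) T * f T'')"
    by (intro sum.cong refl) (simp add: X[of "Z _"] sum_distrib_right mult.assoc)
  finally show "X (Z f) T = (\<Sum>T''\<in>S''. X (Z (point_fun T'')) T * f T'')" .
qed

lemma has_kernel_pow:
  assumes "has_kernel X S S" "finite S"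
  shows "has_kernel (X ^^ k) S S"
proof (induction k)
  case 0
  have "f T = (\<Sum>T'\<in>S. point_fun T' T * f T')" if "T \<in> S" for f T
  proof -
    have "(\<Sum>T'\<in>S. point_fun T' T * f T') = (\<Sum>T'\<in>S. if T = T' then f T' else 0)"
      by (rule sum.cong) (auto simp: point_fun_def)
    then show ?thesis using assms that by simp
  qed
  then show ?case by (auto simp: has_kernel_def)
next
  case (Suc k)
  then show ?case using has_kernel_comp[OF assms(1) Suc] by (simp add: comp_def)
qed

text \<open>Cyclicity for rectangular matrices; this is what relates traces over two different
  systems of column sums.\<close>

lemma op_trace_commute:
  assumes "has_kernel X S S'" "has_kernel Z S' S"
  shows "op_trace S (\<lambda>f. X (Z f)) = op_trace S' (\<lambda>f. Z (X f))"
proof -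
  have "op_trace S (\<lambda>f. X (Z f)) = (\<Sum>T\<in>S. \<Sum>T'\<in>S'. X (point_fun T') T * Z (point_fun T) T')"
    unfolding op_trace_def using assms(1) by (intro sum.cong refl) (auto simp: has_kernel_def)
  also have "\<dots> = (\<Sum>T'\<in>S'. \<Sum>T\<in>S. Z (point_fun T) T' * X (point_fun T') T)"
    by (subst sum.swap) (simp add: mult.commute)
  also have "\<dots> = op_trace S' (\<lambda>f. Z (X f))"
    unfolding op_trace_def
  proof (rule sum.cong[OF refl])
    fix T' assume "T' \<in> S'"
    then show "(\<Sum>T\<in>S. Z (point_fun T) T' * X (point_fun T') T) = Z (X (point_fun T')) T'"
      using assms(2) unfolding has_kernel_def by metis
  qed
  finally show ?thesis .
qed

lemma sum_incr_row: "j < n \<Longrightarrow> (\<Sum>l<n. incr i j T k l) = (\<Sum>l<n. T k l) + (if k = i then 1 else 0)"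
  by (cases "k = i") (auto simp: incr_def sum.remove[of "{..<n}" j])

lemma sum_incr_col: "i < m \<Longrightarrow> (\<Sum>k<m. incr i j T k l) = (\<Sum>k<m. T k l) + (if l = j then 1 else 0)"
  by (cases "l = j") (auto simp: incr_def sum.remove[of "{..<m}" i])

lemma sum_decr_row:
  "j < n \<Longrightarrow> 0 < T i j \<Longrightarrow> (\<Sum>l<n. decr i j T k l) + (if k = i then 1 else 0) = (\<Sum>l<n. T k l)"
  by (cases "k = i") (auto simp: decr_def sum.remove[of "{..<n}" j])

lemma sum_decr_col:
  "i < m \<Longrightarrow> 0 < T i j \<Longrightarrow> (\<Sum>k<m. decr i j T k l) + (if l = j then 1 else 0) = (\<Sum>k<m. T k l)"
  by (cases "l = j") (auto simp: decr_def sum.remove[of "{..<m}" i])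

lemma margin_tables_move:
  assumes "T \<in> margin_tables m n \<alpha> \<mu>" "i < m" "a < n" "b < n" "a \<noteq> b" "0 < T i a"
    and "\<nu> a + 1 = \<mu> a" "\<nu> b = \<mu> b + 1" "\<And>j. j \<noteq> a \<Longrightarrow> j \<noteq> b \<Longrightarrow> \<nu> j = \<mu> j"
  shows "incr i b (decr i a T) \<in> margin_tables m n \<alpha> \<nu>"
proof -
  have "(\<Sum>l<n. incr i b (decr i a T) k l) = \<alpha> k" if "k < m" for k
    using sum_incr_row[of b n i "decr i a T" k] sum_decr_row[of a n T i k] assms that
    by (auto simp: margin_tables_def)
  moreover have "(\<Sum>k<m. incr i b (decr i a T) k l) = \<nu> l" if "l < n" for l
  proof -
    have "(\<Sum>k<m. T k l) = \<mu> l" using assms(1) that by (auto simp: margin_tables_def)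
    then show ?thesis
      using sum_incr_col[of i m b "decr i a T" l] sum_decr_col[of i m T a l] assms(2,5-)
      by (cases "l = a"; cases "l = b") auto
  qed
  moreover have "incr i b (decr i a T) k l = 0" if "m \<le> k \<or> n \<le> l" for k l
    using assms(1-4) that by (auto simp: incr_def decr_def margin_tables_def)
  ultimately show ?thesis by (auto simp: margin_tables_def)
qed

lemma has_kernel_column_op:
  assumes "a < n" "b < n" "a \<noteq> b"
    and "\<nu> a + 1 = \<mu> a" "\<nu> b = \<mu> b + 1" "\<And>j. j \<noteq> a \<Longrightarrow> j \<noteq> b \<Longrightarrow> \<nu> j = \<mu> j"
  shows "has_kernel (column_op m a b) (margin_tables m n \<alpha> \<mu>) (margin_tables m n \<alpha> \<nu>)"
proof (rule has_kernelI)
  show "column_op m a b f T = (\<Sum>i<m. real (T i a) * f (incr i b (decr i a T)))" for f T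
    by (simp add: column_op_def lower_def raise_def)
  show "incr k b (decr k a T) \<in> margin_tables m n \<alpha> \<nu>"
    if "T \<in> margin_tables m n \<alpha> \<mu>" "k \<in> {..<m}" "real (T k a) \<noteq> 0" for k T
    using that assms by (intro margin_tables_move[of T m n \<alpha> \<mu>]) auto
qed (rule finite_margin_tables)

definition swap_cells :: "nat \<Rightarrow> nat \<Rightarrow> nat \<Rightarrow> nat \<Rightarrow> (nat \<Rightarrow> nat \<Rightarrow> nat) \<Rightarrow> nat \<Rightarrow> nat \<Rightarrow> nat" where
  "swap_cells i j k l T = incr k j (incr i l (decr k l (decr i j T)))"

lemma swap_op_eq:
  "swap_op m n f T = (\<Sum>i<m. \<Sum>k<m. \<Sum>j<n. \<Sum>l<n.
     real (T i j) * real (decr i j T k l) * f (swap_cells i j k l T))"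
  by (simp add: swap_op_def lower_def raise_def swap_cells_def mult.assoc)

lemma swap_cells_in_margin_tables:
  assumes "T \<in> margin_tables m n \<alpha> \<mu>" "i < m" "k < m" "j < n" "l < n" "0 < T i j" "0 < decr i j T k l"
  shows "swap_cells i j k l T \<in> margin_tables m n \<alpha> \<mu>"
proof -
  have "(\<Sum>q<n. swap_cells i j k l T p q) = \<alpha> p" if "p < m" for p
    unfolding swap_cells_def
    using sum_incr_row[of j n k "incr i l (decr k l (decr i j T))" p]
      sum_incr_row[of l n i "decr k l (decr i j T)" p]
      sum_decr_row[of l n "decr i j T" k p] sum_decr_row[of j n T i p] assms that
    by (auto simp: margin_tables_def)
  moreover have "(\<Sum>p<m. swap_cells i j k l T p q) = \<mu> q" if "q < n" for q
    unfolding swap_cells_def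
    using sum_incr_col[of k m j "incr i l (decr k l (decr i j T))" q]
      sum_incr_col[of i m l "decr k l (decr i j T)" q]
      sum_decr_col[of k m "decr i j T" l q] sum_decr_col[of i m T j q] assms that
    by (auto simp: margin_tables_def)
  moreover have "swap_cells i j k l T p q = 0" if "m \<le> p \<or> n \<le> q" for p q
    using assms that by (auto simp: swap_cells_def incr_def decr_def margin_tables_def)
  ultimately show ?thesis by (auto simp: margin_tables_def)
qed

lemma has_kernel_swap_op: "has_kernel (swap_op m n) (margin_tables m n \<alpha> \<mu>) (margin_tables m n \<alpha> \<mu>)"
proof (rule has_kernelI[where I = "\<lambda>T. {..<m} \<times> {..<m} \<times> {..<n} \<times> {..<n}"
    and w = "\<lambda>(i, k, j, l) T. real (T i j) * real (decr i j T k l)"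
    and s = "\<lambda>(i, k, j, l). swap_cells i j k l"])
  fix f :: table_fun and T
  show "swap_op m n f T = (\<Sum>x\<in>{..<m} \<times> {..<m} \<times> {..<n} \<times> {..<n}.
     (case x of (i, k, j, l) \<Rightarrow> \<lambda>T. real (T i j) * real (decr i j T k l)) T *
     f ((case x of (i, k, j, l) \<Rightarrow> swap_cells i j k l) T))"
    by (simp add: swap_op_eq sum.cartesian_product case_prod_unfold)
next
  fix x T assume "T \<in> margin_tables m n \<alpha> \<mu>" "x \<in> {..<m} \<times> {..<m} \<times> {..<n} \<times> {..<n}"
    "(case x of (i, k, j, l) \<Rightarrow> \<lambda>T. real (T i j) * real (decr i j T k l)) T \<noteq> 0"
  then show "(case x of (i, k, j, l) \<Rightarrow> swap_cells i j k l) T \<in> margin_tables m n \<alpha> \<mu>"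
    by (auto intro!: swap_cells_in_margin_tables)
qed (rule finite_margin_tables)

section \<open>Traces of powers of the swap operator\<close>

definition swap_trace :: "nat \<Rightarrow> nat \<Rightarrow> nat \<Rightarrow> (nat \<Rightarrow> nat) \<Rightarrow> (nat \<Rightarrow> nat) \<Rightarrow> real" where
  "swap_trace m n k \<alpha> \<mu> = op_trace (margin_tables m n \<alpha> \<mu>) (swap_op m n ^^ k)"

definition pair_trace ::
  "nat \<Rightarrow> nat \<Rightarrow> nat \<Rightarrow> nat \<Rightarrow> nat \<Rightarrow> (nat \<Rightarrow> nat) \<Rightarrow> (nat \<Rightarrow> nat) \<Rightarrow> real" where
  "pair_trace m n a b k \<alpha> \<mu>
      = op_trace (margin_tables m n \<alpha> \<mu>) (\<lambda>f. column_pair_op m a b ((swap_op m n ^^ k) f))"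

lemma op_trace_column_op_column_op:
  assumes "a < n"
  shows "op_trace (margin_tables m n \<alpha> \<mu>) (\<lambda>f. column_op m a b (column_op m b a ((swap_op m n ^^ k) f)))
    = pair_trace m n a b k \<alpha> \<mu> + real (\<mu> a) * swap_trace m n k \<alpha> \<mu>"
proof -
  have "real (\<Sum>i<m. T i a) = real (\<mu> a)" if "T \<in> margin_tables m n \<alpha> \<mu>" for T
    using that assms by (auto simp: margin_tables_def)
  then show ?thesis
    by (simp add: op_trace_def pair_trace_def swap_trace_def column_op_column_op sum.distrib sum_distrib_left)
qed

text \<open>Both sides are the trace of \<open>E\<^sub>b\<^sub>a E\<^sub>a\<^sub>b X\<close>, computed on the column sums \<open>\<mu>\<close> and, after a cyclic rotation, on \<open>\<nu>\<close>.\<close>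

lemma pair_trace_step:
  assumes "a < n" "b < n" "a \<noteq> b" "0 < \<mu> b" and \<nu>: "\<nu> = \<mu>(a := Suc (\<mu> a), b := \<mu> b - 1)"
  shows "pair_trace m n a b k \<alpha> \<mu> + real (\<mu> b) * swap_trace m n k \<alpha> \<mu>
    = pair_trace m n a b k \<alpha> \<nu> + (real (\<mu> a) + 1) * swap_trace m n k \<alpha> \<nu>"
proof -
  let ?X = "swap_op m n ^^ k"
  have ba: "has_kernel (column_op m b a) (margin_tables m n \<alpha> \<mu>) (margin_tables m n \<alpha> \<nu>)"
    by (rule has_kernel_column_op) (use assms in auto)
  have ab: "has_kernel (column_op m a b) (margin_tables m n \<alpha> \<nu>) (margin_tables m n \<alpha> \<mu>)"
    by (rule has_kernel_column_op) (use assms in auto)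
  have X: "has_kernel ?X (margin_tables m n \<alpha> \<mu>) (margin_tables m n \<alpha> \<mu>)"
    by (rule has_kernel_pow[OF has_kernel_swap_op finite_margin_tables])
  have "op_trace (margin_tables m n \<alpha> \<mu>) (\<lambda>f. column_op m b a (column_op m a b (?X f)))
    = op_trace (margin_tables m n \<alpha> \<nu>) (\<lambda>f. column_op m a b (?X (column_op m b a f)))"
    by (rule op_trace_commute[OF ba has_kernel_comp[OF ab X]])
  also have "\<dots> = op_trace (margin_tables m n \<alpha> \<nu>) (\<lambda>f. column_op m a b (column_op m b a (?X f)))"
    using assms by (simp add: swap_op_pow_column_op_commute)
  finally have "pair_trace m n b a k \<alpha> \<mu> + real (\<mu> b) * swap_trace m n k \<alpha> \<mu>
    = pair_trace m n a b k \<alpha> \<nu> + real (\<nu> a) * swap_trace m n k \<alpha> \<nu>"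
    using assms by (simp add: op_trace_column_op_column_op)
  moreover have "pair_trace m n b a k \<alpha> \<mu> = pair_trace m n a b k \<alpha> \<mu>"
    by (simp add: pair_trace_def column_pair_op_commute[of m b a])
  moreover have "real (\<nu> a) = real (\<mu> a) + 1" using assms by simp
  ultimately show ?thesis by simp
qed

text \<open>Iterates \<open>pair_trace_step\<close> until column \<open>b\<close> is empty, where
  the pair trace is zero. The swap trace reached after \<open>s + 1\<close> moves enters with
  \<open>\<mu> a + s + 1\<close> from the step leading to it and with
  \<open>- (\<mu> b - s - 1)\<close> from the next one, which gives the coefficient
  \<open>\<mu> a - \<mu> b + 2 (s + 1)\<close>.\<close>

lemma pair_trace_eq:
  assumes "a < n" "b < n" "a \<noteq> b"
  shows "pair_trace m n a b k \<alpha> \<mu> = - real (\<mu> b) * swap_trace m n k \<alpha> \<mu> +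
    (\<Sum>s<\<mu> b. (real (\<mu> a) - real (\<mu> b) + 2 * real (Suc s)) *
       swap_trace m n k \<alpha> (\<mu>(a := \<mu> a + Suc s, b := \<mu> b - Suc s)))"
proof (induction "\<mu> b" arbitrary: \<mu>)
  case 0
  have "column_pair_op m a b f T = 0" if "T \<in> margin_tables m n \<alpha> \<mu>" for f T
  proof -
    have "(\<Sum>i<m. T i b) = 0" using that 0 assms by (auto simp: margin_tables_def)
    then have "T i b = 0" if "i < m" for i using that by simp
    then show ?thesis using assms by
        (auto simp: column_pair_op_def lower_def decr_def intro!: sum.neutral)
  qed
  then show ?case using 0 by (simp add: pair_trace_def op_trace_def)
next
  case (Suc d)
  define \<nu> where "\<nu> = \<mu>(a := Suc (\<mu> a), b := \<mu> b - 1)"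
  have \<nu>: "\<nu> b = d" "\<nu> a = Suc (\<mu> a)" using Suc(2) assms by (auto simp: \<nu>_def)
  have upd: "\<nu>(a := \<nu> a + Suc s, b := \<nu> b - Suc s) = \<mu>(a := \<mu> a + Suc (Suc s), b := \<mu> b
      - Suc (Suc s))" for s
    using assms by (auto simp: \<nu>_def fun_eq_iff)
  have upd1: "\<nu> = \<mu>(a := \<mu> a + Suc 0, b := \<mu> b - Suc 0)" by (simp add: \<nu>_def)
  have "pair_trace m n a b k \<alpha> \<mu> + real (\<mu> b) * swap_trace m n k \<alpha> \<mu>
    = pair_trace m n a b k \<alpha> \<nu> + (real (\<mu> a) + 1) * swap_trace m n k \<alpha> \<nu>"
    by (rule pair_trace_step[OF assms _ \<nu>_def]) (use Suc(2) in simp)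
  also have "pair_trace m n a b k \<alpha> \<nu> = - real d * swap_trace m n k \<alpha> \<nu> +
    (\<Sum>s<d. (real (Suc (\<mu> a)) - real d + 2 * real (Suc s)) *
       swap_trace m n k \<alpha> (\<mu>(a := \<mu> a + Suc (Suc s), b := \<mu> b - Suc (Suc s))))"
    using Suc(1)[of \<nu>] \<nu> unfolding upd by simp
  finally have *: "pair_trace m n a b k \<alpha> \<mu> = - real (\<mu> b) * swap_trace m n k \<alpha> \<mu> +
    ((real (\<mu> a) + 1 - real d) * swap_trace m n k \<alpha> \<nu> +
    (\<Sum>s<d. (real (Suc (\<mu> a)) - real d + 2 * real (Suc s)) *
       swap_trace m n k \<alpha> (\<mu>(a := \<mu> a + Suc (Suc s), b := \<mu> b - Suc (Suc s)))))"
    by (simp add: algebra_simps)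
  have b: "\<mu> b = Suc d" using Suc(2) by simp
  have sh: "(\<Sum>s<\<mu> b. (real (\<mu> a) - real (\<mu> b) + 2 * real (Suc s)) *
       swap_trace m n k \<alpha> (\<mu>(a := \<mu> a + Suc s, b := \<mu> b - Suc s))) =
    (real (\<mu> a) + 1 - real d) * swap_trace m n k \<alpha> \<nu> +
    (\<Sum>s<d. (real (Suc (\<mu> a)) - real d + 2 * real (Suc s)) *
       swap_trace m n k \<alpha> (\<mu>(a := \<mu> a + Suc (Suc s), b := \<mu> b - Suc (Suc s))))"
    unfolding upd1 b sum.lessThan_Suc_shift by (simp add: algebra_simps)
  show ?case unfolding sh by (rule *)
qed

text \<open>Twice the sum of the contents \<open>j - i\<close> of the cells \<open>(i, j)\<close>.\<close>

definition content_sum :: "nat \<Rightarrow> (nat \<Rightarrow> nat) \<Rightarrow> real" where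
  "content_sum n \<mu> = (\<Sum>i<n. real (\<mu> i) * (real (\<mu> i) - 1 - 2 * real i))"

lemma sum_square_symmetric:
  fixes h :: "nat \<Rightarrow> nat \<Rightarrow> real"
  assumes "\<And>a b. h a b = h b a"
  shows "(\<Sum>a<n. \<Sum>b<n. h a b) = (\<Sum>b<n. h b b + 2 * (\<Sum>a<b. h a b))"
proof (induction n)
  case (Suc n)
  have "(\<Sum>a<Suc n. \<Sum>b<Suc n. h a b) = (\<Sum>a<n. \<Sum>b<n. h a b) + (\<Sum>a<n. h a n) + (\<Sum>b<n. h n b) + h n n"
    by (simp add: sum.distrib)
  also have "(\<Sum>b<n. h n b) = (\<Sum>a<n. h a n)" using assms by simp
  finally show ?case using Suc by simp
qed simp

text \<open>Both orders of a pair of columns give the same trace, so only \<open>a < b\<close> is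
  expanded, each pair counted twice; balls then move to the column that is the larger one in a
  partition. The terms \<open>- \<mu> b\<close> for the \<open>b\<close> columns before column
  \<open>b\<close>, doubled, supply the \<open>- 2 b\<close> of \<open>content_sum\<close>, and the
  diagonal pairs supply \<open>\<mu> b * (\<mu> b - 1)\<close>.\<close>

lemma swap_trace_Suc:
  "swap_trace m n (Suc k) \<alpha> \<mu> = content_sum n \<mu> * swap_trace m n k \<alpha> \<mu> +
    (\<Sum>b<n. \<Sum>a<b. \<Sum>s<\<mu> b. 2 * (real (\<mu> a) - real (\<mu> b) + 2 * real (Suc s)) *
       swap_trace m n k \<alpha> (\<mu>(a := \<mu> a + Suc s, b := \<mu> b - Suc s)))"
proof -
  let ?t = "swap_trace m n k \<alpha>"
  have "swap_trace m n (Suc k) \<alpha> \<mu> = (\<Sum>a<n. \<Sum>b<n. pair_trace m n a b k \<alpha> \<mu>)"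
  proof -
    have "swap_trace m n (Suc k) \<alpha> \<mu> =
      (\<Sum>T\<in>margin_tables m n \<alpha> \<mu>. \<Sum>a<n.
          \<Sum>b<n. column_pair_op m a b ((swap_op m n ^^ k) (point_fun T)) T)"
      by (simp add: swap_trace_def op_trace_def swap_op_column_pair_op)
    also have "\<dots> = (\<Sum>a<n. \<Sum>T\<in>margin_tables m n \<alpha> \<mu>.
        \<Sum>b<n. column_pair_op m a b ((swap_op m n ^^ k) (point_fun T)) T)"
      by (rule sum.swap)
    also have "\<dots> = (\<Sum>a<n. \<Sum>b<n. pair_trace m n a b k \<alpha> \<mu>)"
      unfolding pair_trace_def op_trace_def by (rule sum.cong[OF refl], rule sum.swap)
    finally show ?thesis .
  qed
  also have "\<dots> = (\<Sum>b<n. pair_trace m n b b k \<alpha> \<mu> + 2 * (\<Sum>a<b. pair_trace m n a b k \<alpha> \<mu>))"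
  proof (rule sum_square_symmetric)
    show "pair_trace m n a b k \<alpha> \<mu> = pair_trace m n b a k \<alpha> \<mu>" for a b
      by (simp add: pair_trace_def column_pair_op_commute[of m a b])
  qed
  also have "\<dots> = (\<Sum>b<n. (real (\<mu> b) * (real (\<mu> b) - 1 - 2 * real b)) * ?t \<mu> +
     (\<Sum>a<b. \<Sum>s<\<mu> b. 2 * (real (\<mu> a) - real (\<mu> b) + 2 * real (Suc s)) *
       ?t (\<mu>(a := \<mu> a + Suc s, b := \<mu> b - Suc s))))"
  proof (rule sum.cong[OF refl])
    fix b assume "b \<in> {..<n}"
    then have "b < n" by simp
    have "column_pair_op m b b f T = real (\<mu> b) * (real (\<mu> b) - 1) * f T"
        if "T \<in> margin_tables m n \<alpha> \<mu>" for f T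
      using that \<open>b < n\<close> by (auto simp: column_pair_op_same margin_tables_def simp del: of_nat_sum)
    then have d: "pair_trace m n b b k \<alpha> \<mu> = real (\<mu> b) * (real (\<mu> b) - 1) * ?t \<mu>"
      by (simp add: pair_trace_def swap_trace_def op_trace_def sum_distrib_left)
    have "2 * (\<Sum>a<b. pair_trace m n a b k \<alpha> \<mu>) = (\<Sum>a<b. - 2 * real (\<mu> b) * ?t \<mu> +
       (\<Sum>s<\<mu> b. 2 * (real (\<mu> a) - real (\<mu> b) + 2 * real (Suc s)) *
          ?t (\<mu>(a := \<mu> a + Suc s, b := \<mu> b - Suc s))))"
      unfolding sum_distrib_left
      by (rule sum.cong[OF refl], subst pair_trace_eq)
        (use \<open>b < n\<close> in \<open>auto simp: sum_distrib_left algebra_simps\<close>)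
    then show "pair_trace m n b b k \<alpha> \<mu> + 2 * (\<Sum>a<b. pair_trace m n a b k \<alpha> \<mu>) =
      (real (\<mu> b) * (real (\<mu> b) - 1 - 2 * real b)) * ?t \<mu> +
      (\<Sum>a<b. \<Sum>s<\<mu> b. 2 * (real (\<mu> a) - real (\<mu> b) + 2 * real (Suc s)) *
       ?t (\<mu>(a := \<mu> a + Suc s, b := \<mu> b - Suc s)))"
      unfolding d sum.distrib by (simp add: algebra_simps)
  qed
  finally show ?thesis by (simp add: content_sum_def sum.distrib sum_distrib_right)
qed

section \<open>Symmetries of the traces\<close>

lemma op_trace_reindex:
  assumes "bij_betw \<phi> S S'" "inj \<phi>" "\<And>f T. X f (\<phi> T) = X (f \<circ> \<phi>) T"
  shows "op_trace S' (X ^^ k) = op_trace S (X ^^ k)"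
proof -
  have X: "(X ^^ k) f (\<phi> T) = (X ^^ k) (f \<circ> \<phi>) T" for f T
  proof (induction k arbitrary: T)
    case (Suc k)
    have "(X ^^ Suc k) f (\<phi> T) = X ((X ^^ k) f \<circ> \<phi>) T" by (simp add: assms(3))
    also have "(X ^^ k) f \<circ> \<phi> = (X ^^ k) (f \<circ> \<phi>)"
      by (rule ext, subst comp_apply, rule Suc)
    finally show ?case unfolding funpow.simps(2) o_apply .
  qed simp
  have "op_trace S' (X ^^ k) = (\<Sum>T\<in>S. (X ^^ k) (point_fun (\<phi> T)) (\<phi> T))"
    unfolding op_trace_def by (rule sum.reindex_bij_betw[OF assms(1), symmetric])
  moreover have "point_fun (\<phi> T) \<circ> \<phi> = point_fun T" for T
    by (rule ext) (simp add: point_fun_def inj_eq[OF assms(2)])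
  ultimately show ?thesis by (simp add: X op_trace_def)
qed

text \<open>Exchanging the columns of two balls is the same as exchanging their rows, so the
  operator does not distinguish the two margins.\<close>

lemma swap_op_transpose: "swap_op n m f (\<lambda>i j. T j i) = swap_op m n (f \<circ> (\<lambda>T i j. T j i)) T"
proof -
  have "swap_op n m f (\<lambda>i j. T j i) = (\<Sum>j<n. \<Sum>l<n. \<Sum>i<m. \<Sum>k<m.
     real (T i j) * real (decr i j T k l) * f (\<lambda>i' j'. swap_cells i j k l T j' i'))"
    unfolding swap_op_eq
  proof (intro sum.cong refl)
    fix j l i k
    define tr where "tr T = (\<lambda>i j. T j i)" for T :: "nat \<Rightarrow> nat \<Rightarrow> nat"
    have "incr b a (tr T) = tr (incr a b T)" "decr b a (tr T) = tr (decr a b T)" for a b T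
      by (auto simp: incr_def decr_def tr_def fun_eq_iff)
    then have "swap_cells j i l k (tr T) = tr (swap_cells i j k l T)"
      unfolding swap_cells_def by (simp add: incr_commute[of i l k j])
    then have "swap_cells j i l k (\<lambda>i j. T j i) = (\<lambda>i' j'. swap_cells i j k l T j' i')"
      by (simp add: tr_def)
    moreover have "decr j i (\<lambda>i j. T j i) l k = decr i j T k l" by (auto simp: decr_def)
    ultimately show "real (T i j) * real (decr j i (\<lambda>i j. T j i) l k)
        * f (swap_cells j i l k (\<lambda>i j. T j i))
      = real (T i j) * real (decr i j T k l) * f (\<lambda>i' j'. swap_cells i j k l T j' i')" by simp
  qed
  also have "\<dots> = (\<Sum>j<n. \<Sum>i<m. \<Sum>k<m. \<Sum>l<n.
     real (T i j) * real (decr i j T k l) * f (\<lambda>i' j'. swap_cells i j k l T j' i'))"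
    by (rule sum.cong[OF refl], subst sum.swap, rule sum.cong[OF refl], rule sum.swap)
  also have "\<dots> = (\<Sum>i<m. \<Sum>k<m. \<Sum>j<n. \<Sum>l<n.
     real (T i j) * real (decr i j T k l) * f (\<lambda>i' j'. swap_cells i j k l T j' i'))"
    by (subst sum.swap, rule sum.cong[OF refl], rule sum.swap)
  finally show ?thesis by (simp add: swap_op_eq comp_def)
qed

lemma swap_trace_transpose: "swap_trace n n k \<alpha> \<mu> = swap_trace n n k \<mu> \<alpha>"
  unfolding swap_trace_def
proof (rule op_trace_reindex)
  show "bij_betw (\<lambda>T i j. T j i) (margin_tables n n \<mu> \<alpha>) (margin_tables n n \<alpha> \<mu>)"
    by (rule bij_betw_byWitness[where f' = "\<lambda>T i j. T j i"]) (auto simp: margin_tables_def)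
  show "inj (\<lambda>(T :: nat \<Rightarrow> nat \<Rightarrow> nat) i j. T j i)" by (auto simp: inj_def fun_eq_iff)
  show "swap_op n n f (\<lambda>i j. T j i) = swap_op n n (f \<circ> (\<lambda>T i j. T j i)) T" for f T
    by (rule swap_op_transpose)
qed

lemma swap_op_permute_columns:
  assumes "p permutes {..<n}"
  shows "swap_op m n f (\<lambda>i j. T i (p j)) = swap_op m n (f \<circ> (\<lambda>T i j. T i (p j))) T"
proof -
  have inj: "p j = p l \<longleftrightarrow> j = l" for j l using permutes_inj[OF assms] by (simp add: inj_eq)
  have "swap_op m n f (\<lambda>i j. T i (p j)) = (\<Sum>i<m. \<Sum>k<m. \<Sum>j<n. \<Sum>l<n.
     real (T i (p j)) * real (decr i (p j) T k (p l))
         * f (\<lambda>i' j'. swap_cells i (p j) k (p l) T i' (p j')))"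
    unfolding swap_op_eq
  proof (intro sum.cong refl)
    fix j l i k
    define pc where "pc T = (\<lambda>i j. T i (p j))" for T :: "nat \<Rightarrow> nat \<Rightarrow> nat"
    have "incr a b (pc T) = pc (incr a (p b) T)" "decr a b (pc T) = pc (decr a (p b) T)" for a b T
      by (auto simp: incr_def decr_def pc_def fun_eq_iff inj)
    then have "swap_cells i j k l (pc T) = pc (swap_cells i (p j) k (p l) T)"
      unfolding swap_cells_def by simp
    then have "swap_cells i j k l (\<lambda>i j. T i (p j))
        = (\<lambda>i' j'. swap_cells i (p j) k (p l) T i' (p j'))"
      by (simp add: pc_def)
    moreover have "decr i j (\<lambda>i j. T i (p j)) k l = decr i (p j) T k (p l)" by
        (auto simp: decr_def inj)
    ultimately show "real (T i (p j)) * real (decr i j (\<lambda>i j. T i (p j)) k l)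
        * f (swap_cells i j k l (\<lambda>i j. T i (p j)))
      = real (T i (p j)) * real (decr i (p j) T k (p l))
          * f (\<lambda>i' j'. swap_cells i (p j) k (p l) T i' (p j'))"
      by simp
  qed
  also have "\<dots> = (\<Sum>i<m. \<Sum>k<m. \<Sum>j<n. \<Sum>l<n.
     real (T i (p j)) * real (decr i (p j) T k l) * f (\<lambda>i' j'. swap_cells i (p j) k l T i' (p j')))"
  proof (rule sum.cong[OF refl], rule sum.cong[OF refl], rule sum.cong[OF refl])
    fix i k j
    show "(\<Sum>l<n. real (T i (p j)) * real (decr i (p j) T k (p l))
        * f (\<lambda>i' j'. swap_cells i (p j) k (p l) T i' (p j')))
      = (\<Sum>l<n. real (T i (p j)) * real (decr i (p j) T k l)
          * f (\<lambda>i' j'. swap_cells i (p j) k l T i' (p j')))"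
      using sum.permute[OF assms, of "\<lambda>l. real (T i (p j)) * real (decr i (p j) T k l)
          * f (\<lambda>i' j'. swap_cells i (p j) k l T i' (p j'))"]
      by (simp add: comp_def)
  qed
  also have "\<dots> = (\<Sum>i<m. \<Sum>k<m. \<Sum>j<n. \<Sum>l<n.
     real (T i j) * real (decr i j T k l) * f (\<lambda>i' j'. swap_cells i j k l T i' (p j')))"
  proof (rule sum.cong[OF refl], rule sum.cong[OF refl])
    fix i k
    show "(\<Sum>j<n. \<Sum>l<n. real (T i (p j)) * real (decr i (p j) T k l)
        * f (\<lambda>i' j'. swap_cells i (p j) k l T i' (p j')))
      = (\<Sum>j<n. \<Sum>l<n. real (T i j) * real (decr i j T k l)
          * f (\<lambda>i' j'. swap_cells i j k l T i' (p j')))"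
      using sum.permute[OF assms, of "\<lambda>j. \<Sum>l<n. real (T i j) * real (decr i j T k l)
          * f (\<lambda>i' j'. swap_cells i j k l T i' (p j'))"]
      by (simp add: comp_def)
  qed
  finally show ?thesis by (simp add: swap_op_eq comp_def)
qed

lemma margin_tables_cong: "(\<And>i. i < m \<Longrightarrow> \<alpha> i = \<alpha>' i) \<Longrightarrow> (\<And>j. j < n \<Longrightarrow> \<mu> j
    = \<mu>' j) \<Longrightarrow> margin_tables m n \<alpha> \<mu> = margin_tables m n \<alpha>' \<mu>'"
  by (auto simp: margin_tables_def)

lemma swap_trace_permute_columns:
  assumes p: "p permutes {..<n}"
  shows "swap_trace m n k \<alpha> (\<mu> \<circ> p) = swap_trace m n k \<alpha> \<mu>"
  unfolding swap_trace_def
proof (rule op_trace_reindex)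
  have image: "(\<lambda>i j. T i (p j)) \<in> margin_tables m n \<alpha> (\<mu> \<circ> p)"
      if "T \<in> margin_tables m n \<alpha> \<mu>" "p permutes {..<n}" for T \<mu> p
  proof -
    have "(\<Sum>j<n. T i (p j)) = (\<Sum>j<n. T i j)" for i
      using sum.permute[OF that(2), of "T i"] by (simp add: comp_def)
    moreover have "p j < n \<longleftrightarrow> j < n" for j using permutes_in_image[OF that(2), of j] by simp
    ultimately show ?thesis using that(1) by (auto simp: margin_tables_def not_le[symmetric])
  qed
  have inv: "p (inv_into UNIV p j) = j" "inv_into UNIV p (p j) = j" for j
      using permutes_inverses[OF p] by auto
  show "bij_betw (\<lambda>T i j. T i (p j)) (margin_tables m n \<alpha> \<mu>) (margin_tables m n \<alpha> (\<mu> \<circ> p))"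
  proof (rule bij_betw_byWitness[where f' = "\<lambda>T i j. T i (inv_into UNIV p j)"])
    show "(\<lambda>T i j. T i (inv_into UNIV p j)) ` margin_tables m n \<alpha> (\<mu> \<circ> p) \<subseteq> margin_tables m n \<alpha> \<mu>"
      using image[OF _ permutes_inv[OF p], of _ "\<mu> \<circ> p"] by (auto simp: comp_def inv)
  qed (use image p in \<open>auto simp: inv\<close>)
  show "inj (\<lambda>(T :: nat \<Rightarrow> nat \<Rightarrow> nat) i j. T i (p j))"
    by (auto simp: inj_def fun_eq_iff) (metis inv(1))
  show "swap_op m n f (\<lambda>i j. T i (p j)) = swap_op m n (f \<circ> (\<lambda>T i j. T i (p j))) T" for f T
    by (rule swap_op_permute_columns[OF p])
qed

text \<open>Moving balls between columns may destroy the decreasing order of the column sums;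
  sorting them brings the recursion back to partitions.\<close>

lemma ex_sorted_content:
  assumes "sum \<nu> {..<n} = n"
  shows "\<exists>\<nu>'\<in>part_fun n. (\<forall>k \<alpha>. swap_trace n n k \<alpha> \<nu> = swap_trace n n k \<alpha> \<nu>') \<and>
    (\<Sum>i<n. (\<nu> i)\<^sup>2) = (\<Sum>i<n. (\<nu>' i)\<^sup>2)"
proof -
  define xs where "xs = map \<nu> [0..<n]"
  define ys where "ys = rev (sort xs)"
  have "mset ys = mset xs" by (simp add: ys_def)
  then obtain p where p: "p permutes {..<length xs}" "permute_list p xs = ys"
    by (rule mset_eq_permutation)
  have len: "length xs = n" by (simp add: xs_def)
  have ys: "ys ! i = \<nu> (p i)" if "i < n" for i
  proof -
    have "p i < n" using permutes_in_image[OF p(1), of i] that len by simp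
    then show ?thesis using permute_list_nth[OF p(1), of i] that len p(2) by (simp add: xs_def)
  qed
  define \<nu>' where "\<nu>' i = (if i < n then ys ! i else 0)" for i
  have \<nu>': "\<nu>' i = (\<nu> \<circ> p) i" if "i < n" for i using that ys by (simp add: \<nu>'_def)
  have p': "p permutes {..<n}" using p(1) len by simp
  have "\<nu>' \<in> part_fun n"
  proof (rule ParI)
    have "sorted_wrt (\<ge>) ys" by (simp add: ys_def sorted_wrt_rev)
    then show "\<nu>' (Suc i) \<le> \<nu>' i" for i
      using sorted_wrt_nth_less[of "(\<ge>)" ys i "Suc i"] len by (auto simp: \<nu>'_def ys_def)
    have "sum \<nu>' {..<n} = (\<Sum>i<n. (\<nu> \<circ> p) i)" by (rule sum.cong) (auto simp: \<nu>')
    also have "\<dots> = sum \<nu> {..<n}" using sum.permute[OF p', of \<nu>] by simp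
    finally show "sum \<nu>' {..<n} = n" using assms by simp
  qed (simp add: \<nu>'_def)
  moreover have "swap_trace n n k \<alpha> \<nu> = swap_trace n n k \<alpha> \<nu>'" for k \<alpha>
  proof -
    have "margin_tables n n \<alpha> \<nu>' = margin_tables n n \<alpha> (\<nu> \<circ> p)" by (rule margin_tables_cong)
        (auto simp: \<nu>')
    then show ?thesis using swap_trace_permute_columns[OF p', of n k \<alpha> \<nu>]
      by (simp add: swap_trace_def)
  qed
  moreover have "(\<Sum>i<n. (\<nu> i)\<^sup>2) = (\<Sum>i<n. (\<nu>' i)\<^sup>2)"
  proof -
    have "(\<Sum>i<n. (\<nu>' i)\<^sup>2) = (\<Sum>i<n. ((\<lambda>i. (\<nu> i)\<^sup>2) \<circ> p) i)" by (rule sum.cong) (auto simp: \<nu>')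
    also have "\<dots> = (\<Sum>i<n. (\<nu> i)\<^sup>2)" using sum.permute[OF p', of "\<lambda>i. (\<nu> i)\<^sup>2"] by simp
    finally show ?thesis by simp
  qed
  ultimately show ?thesis by blast
qed

text \<open>Additive form, to avoid subtraction on naturals. It serves with \<open>g\<close> the
  identity for the total and with \<open>g\<close> squaring for the measure
  \<open>q\<close>.\<close>

lemma sum_two_updates:
  fixes g \<mu> :: "nat \<Rightarrow> nat"
  assumes "a < n" "b < n" "a \<noteq> b"
  shows "(\<Sum>i<n. g ((\<mu>(a := x, b := y)) i)) + g (\<mu> a) + g (\<mu> b) = (\<Sum>i<n. g (\<mu> i)) + g x + g y"
proof -
  have split: "(\<Sum>i<n. h i) = h a + h b + (\<Sum>i\<in>{..<n} - {a, b}. h i)" for h :: "nat \<Rightarrow> nat"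
  proof -
    have "(\<Sum>i<n. h i) = h a + (\<Sum>i\<in>{..<n} - {a}. h i)" using assms by (simp add: sum.remove)
    also have "(\<Sum>i\<in>{..<n} - {a}. h i) = h b + (\<Sum>i\<in>{..<n} - {a} - {b}. h i)"
      using assms by (intro sum.remove) auto
    finally show ?thesis by (simp add: Diff_insert2[symmetric] insert_commute)
  qed
  have "(\<Sum>i\<in>{..<n} - {a, b}. g ((\<mu>(a := x, b := y)) i)) = (\<Sum>i\<in>{..<n} - {a, b}. g (\<mu> i))"
    by (rule sum.cong) auto
  then show ?thesis
    using assms split[of "\<lambda>i. g ((\<mu>(a := x, b := y)) i)"] split[of "\<lambda>i. g (\<mu> i)"] by simp
qed

text \<open>Both margins have length \<open>n\<close>, so the two arguments are interchangeable and
  transposition provides the symmetry that the abstract recursion lemma asks for.\<close>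

theorem swap_trace_kostka:
  assumes "\<alpha> \<in> part_fun n" "\<mu> \<in> part_fun n"
  shows "swap_trace n n k \<alpha> \<mu> = (\<Sum>\<rho>\<in>part_fun n. content_sum n \<rho> ^ k * real (kostka_count \<alpha> n \<rho>)
      * real (kostka_count \<mu> n \<rho>))"
proof -
  define q where "q \<mu> = (\<Sum>i<n. (\<mu> i)\<^sup>2)" for \<mu> :: "nat \<Rightarrow> nat"
  obtain srt where srt: "\<And>\<nu>. sum \<nu> {..<n} = n \<Longrightarrow> srt \<nu> \<in> part_fun n"
    "\<And>\<nu> k \<alpha>. sum \<nu> {..<n} = n \<Longrightarrow> swap_trace n n k \<alpha> \<nu> = swap_trace n n k \<alpha> (srt \<nu>)"
    "\<And>\<nu>. sum \<nu> {..<n} = n \<Longrightarrow> q \<nu> = q (srt \<nu>)"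
    using ex_sorted_content[of _ n] unfolding q_def by metis
  define mv where "mv \<mu> = (\<lambda>(b, a, s). \<mu>(a := \<mu> a + Suc s, b := \<mu> b - Suc s))" for \<mu> :: "nat \<Rightarrow> nat"
  define wt where "wt \<mu> = (\<lambda>(b, a, s). 2 * (real (\<mu> a) - real (\<mu> b) + 2 * real (Suc s)))"
      for \<mu> :: "nat \<Rightarrow> nat"
  define I where "I \<mu> = (SIGMA b:{..<n}. SIGMA a:{..<b}. {..<\<mu> b})" for \<mu> :: "nat \<Rightarrow> nat"
  \<comment> \<open>Moves whose results sort to the same partition are collected into one
    coefficient.\<close>
  define B where "B \<mu> \<nu> = (\<Sum>x\<in>I \<mu>. if srt (mv \<mu> x) = \<nu> then wt \<mu> x else 0)" for \<mu> \<nu>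
  have finI: "finite (I \<mu>)" for \<mu> by (simp add: I_def)
  have mv: "sum (mv \<mu> x) {..<n} = n \<and> q \<mu> < q (mv \<mu> x)" if "\<mu> \<in> part_fun n" "x \<in> I \<mu>" for \<mu> x
  proof -
    obtain b a s where x: "x = (b, a, s)" by (metis surj_pair)
    have ab: "a < b" "b < n" "s < \<mu> b" using that x by (auto simp: I_def)
    have n: "sum \<mu> {..<n} = n" using that by (simp add: part_fun_def)
    have "sum (mv \<mu> x) {..<n} = n"
      using sum_two_updates[of a n b "\<lambda>x. x" \<mu> "\<mu> a + Suc s" "\<mu> b - Suc s"] ab n by
          (simp add: mv_def x)
    moreover have "\<mu> b \<le> \<mu> a" using part_fun_antimono[OF that(1), of a b] ab by simp
    \<comment> \<open>Moving balls from a smaller part to a larger one raises the sum of squares: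
      with gap \<open>e\<close> and \<open>S = Suc s\<close> balls moved, the gain is
      \<open>2 S (S + e)\<close>.\<close>
    then have "(\<mu> a)\<^sup>2 + (\<mu> b)\<^sup>2 < (\<mu> a + Suc s)\<^sup>2 + (\<mu> b - Suc s)\<^sup>2"
    proof -
      obtain d where d: "\<mu> b = Suc s + d" using ab(3) by (metis Suc_leI le_Suc_ex)
      obtain e where "\<mu> a = \<mu> b + e" using \<open>\<mu> b \<le> \<mu> a\<close> by (metis le_Suc_ex)
      then show ?thesis using d by (simp add: power2_eq_square algebra_simps)
    qed
    then have "q \<mu> < q (mv \<mu> x)"
      using sum_two_updates[of a n b "\<lambda>x. x\<^sup>2" \<mu> "\<mu> a + Suc s" "\<mu> b - Suc s"] ab
      by (simp add: mv_def x q_def)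
    ultimately show ?thesis by simp
  qed
  have rec: "swap_trace n n (Suc k) \<alpha> \<mu> = content_sum n \<mu> * swap_trace n n k \<alpha> \<mu> +
      (\<Sum>\<nu> | \<nu> \<in> part_fun n \<and> q \<mu> < q \<nu>. B \<mu> \<nu> * swap_trace n n k \<alpha> \<nu>)"
    if "\<mu> \<in> part_fun n" for k \<alpha> \<mu>
  proof -
    have fin: "finite {\<nu> \<in> part_fun n. q \<mu> < q \<nu>}" using finite_part_fun by simp
    have "(\<Sum>\<nu> | \<nu> \<in> part_fun n \<and> q \<mu> < q \<nu>. B \<mu> \<nu> * swap_trace n n k \<alpha> \<nu>) =
      (\<Sum>x\<in>I \<mu>. \<Sum>\<nu> | \<nu> \<in> part_fun n \<and> q \<mu> < q \<nu>. if srt (mv \<mu> x) = \<nu> then wt \<mu> x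
          * swap_trace n n k \<alpha> \<nu> else 0)"
      unfolding B_def sum_distrib_right
      by (subst sum.swap) (intro sum.cong refl, simp)
    also have "\<dots> = (\<Sum>x\<in>I \<mu>. wt \<mu> x * swap_trace n n k \<alpha> (mv \<mu> x))"
    proof (rule sum.cong[OF refl])
      fix x assume x: "x \<in> I \<mu>"
      note m = mv[OF that x]
      have "srt (mv \<mu> x) \<in> {\<nu> \<in> part_fun n. q \<mu> < q \<nu>}" using srt(1,3)[of "mv \<mu> x"] m by simp
      then have "(\<Sum>\<nu> | \<nu> \<in> part_fun n \<and> q \<mu> < q \<nu>. if srt (mv \<mu> x) = \<nu> then wt \<mu> x
          * swap_trace n n k \<alpha> \<nu> else 0)
        = wt \<mu> x * swap_trace n n k \<alpha> (srt (mv \<mu> x))"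
        using fin by simp
      then show "(\<Sum>\<nu> | \<nu> \<in> part_fun n \<and> q \<mu> < q \<nu>. if srt (mv \<mu> x) = \<nu> then wt \<mu> x
          * swap_trace n n k \<alpha> \<nu> else 0)
        = wt \<mu> x * swap_trace n n k \<alpha> (mv \<mu> x)"
        using srt(2)[of "mv \<mu> x" k \<alpha>] m by simp
    qed
    also have "\<dots> = (\<Sum>b<n. \<Sum>a<b. \<Sum>s<\<mu> b. 2 * (real (\<mu> a) - real (\<mu> b) + 2 * real (Suc s)) *
       swap_trace n n k \<alpha> (\<mu>(a := \<mu> a + Suc s, b := \<mu> b - Suc s)))"
      unfolding I_def by (simp add: sum.Sigma mv_def wt_def case_prod_unfold)
    finally show ?thesis using swap_trace_Suc[of n n k \<alpha> \<mu>] by simp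
  qed
  have "swap_trace n n k \<alpha> \<mu> = (\<Sum>\<rho>\<in>part_fun n. content_sum n \<rho> ^ k * real (kostka_count \<alpha> n \<rho>)
      * real (kostka_count \<mu> n \<rho>))"
  proof (rule traces_from_triangular_recursion[where q = q and B = B and K
      = "\<lambda>\<rho> \<mu>. real (kostka_count \<mu> n \<rho>)"])
    show "real (kostka_count \<rho> n \<rho>) = 1" if "\<rho> \<in> part_fun n" for \<rho>
      using kostka_count_self[OF that, of n] that by (simp add: part_fun_def)
    show "q \<mu> < q \<rho>" if "\<rho> \<in> part_fun n" "\<mu> \<in> part_fun n" "real (kostka_count \<mu> n \<rho>) \<noteq> 0" "\<rho> \<noteq> \<mu>"
        for \<rho> \<mu>
      using kostka_count_nonzero_sum_squares[of \<mu> n \<rho>] that by (simp add: q_def)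
    show "swap_trace n n 0 \<alpha> \<mu> = (\<Sum>\<rho>\<in>part_fun n. real (kostka_count \<alpha> n \<rho>)
        * real (kostka_count \<mu> n \<rho>))"
      if "\<alpha> \<in> part_fun n" "\<mu> \<in> part_fun n" for \<alpha> \<mu>
    proof -
      have "sum \<alpha> {..<n} = n" "sum \<mu> {..<n} = n" using that by (auto simp: part_fun_def)
      then have "card (margin_tables n n \<alpha> \<mu>) = (\<Sum>\<rho>\<in>part_fun n. kostka_count \<alpha> n \<rho>
          * kostka_count \<mu> n \<rho>)"
        using card_margin_tables[of \<alpha> n \<mu> n] by simp
      then have "real (card (margin_tables n n \<alpha> \<mu>)) = (\<Sum>\<rho>\<in>part_fun n. real (kostka_count \<alpha> n \<rho>)
          * real (kostka_count \<mu> n \<rho>))"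
        by simp
      then show ?thesis by (simp add: swap_trace_def op_trace_def point_fun_def)
    qed
    show "swap_trace n n k \<alpha> \<mu> = swap_trace n n k \<mu> \<alpha>" for k \<alpha> \<mu> by (rule swap_trace_transpose)
  qed (use finite_part_fun rec assms in auto)
  then show ?thesis .
qed

section \<open>Reversible operators on a finite weighted set\<close>

lemma poly_power_sums_eq:
  fixes d :: "'i \<Rightarrow> real" and c :: "'b \<Rightarrow> real"
  assumes "\<And>k. (\<Sum>i\<in>I. d i ^ k) = (\<Sum>\<rho>\<in>A. m \<rho> * c \<rho> ^ k)"
  shows "(\<Sum>i\<in>I. poly p (d i)) = (\<Sum>\<rho>\<in>A. m \<rho> * poly p (c \<rho>))"
proof -
  have "(\<Sum>i\<in>I. poly p (d i)) = (\<Sum>j\<le>degree p. \<Sum>i\<in>I. coeff p j * d i ^ j)"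
    unfolding poly_altdef by (rule sum.swap)
  also have "\<dots> = (\<Sum>j\<le>degree p. \<Sum>\<rho>\<in>A. coeff p j * (m \<rho> * c \<rho> ^ j))"
    by (simp add: assms flip: sum_distrib_left)
  also have "\<dots> = (\<Sum>\<rho>\<in>A. \<Sum>j\<le>degree p. coeff p j * (m \<rho> * c \<rho> ^ j))"
    by (rule sum.swap)
  finally show ?thesis by (simp add: poly_altdef sum_distrib_left mult_ac)
qed

text \<open>Equal power sums give equal sums of every polynomial. The test polynomial has as roots
  all values of \<open>d\<close> and \<open>c\<close> other than \<open>x\<close>, so only the terms
  with value \<open>x\<close> survive on both sides.\<close>

lemma multiplicities_from_power_sums:
  fixes d :: "'i \<Rightarrow> real" and c :: "'b \<Rightarrow> real" and m :: "'b \<Rightarrow> nat"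
  assumes fin: "finite I" "finite A"
    and eq: "\<And>k. (\<Sum>i\<in>I. d i ^ k) = (\<Sum>\<rho>\<in>A. real (m \<rho>) * c \<rho> ^ k)"
  shows "card {i \<in> I. d i = x} = (\<Sum>\<rho> | \<rho> \<in> A \<and> c \<rho> = x. m \<rho>)"
proof -
  define Y where "Y = (d ` I \<union> c ` A) - {x}"
  define p where "p = (\<Prod>y\<in>Y. [:- y, 1:])"
  have finY: "finite Y" using fin by (simp add: Y_def)
  have poly_p: "poly p z = (\<Prod>y\<in>Y. z - y)" for z by (simp add: p_def poly_prod)
  have z: "poly p z = (if z = x then poly p x else 0)" if "z \<in> d ` I \<union> c ` A" for z
    using that finY by (auto simp: poly_p Y_def)
  have nz: "poly p x \<noteq> 0" using finY by (simp add: poly_p Y_def)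
  have "(\<Sum>i\<in>I. poly p (d i)) = (\<Sum>i\<in>I. if d i = x then poly p x else 0)"
    by (rule sum.cong[OF refl], rule z) auto
  also have "\<dots> = real (card {i \<in> I. d i = x}) * poly p x"
    using fin by (simp add: sum.If_cases Int_def)
  also have "(\<Sum>i\<in>I. poly p (d i)) = (\<Sum>\<rho>\<in>A. real (m \<rho>) * poly p (c \<rho>))"
    by (rule poly_power_sums_eq[OF eq])
  also have "\<dots> = (\<Sum>\<rho>\<in>A. if c \<rho> = x then real (m \<rho>) * poly p x else 0)"
    by (rule sum.cong[OF refl], subst z) auto
  also have "\<dots> = real (\<Sum>\<rho> | \<rho> \<in> A \<and> c \<rho> = x. m \<rho>) * poly p x"
    using fin by (simp add: sum.If_cases Int_def sum_distrib_right)
  finally show ?thesis using nz by (simp only: mult_cancel_right of_nat_eq_iff simp_thms)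
qed

lemma prod_by_multiplicities:
  fixes g :: "real \<Rightarrow> 'c::comm_monoid_mult" and m :: "'b \<Rightarrow> nat"
  assumes fin: "finite I" "finite A"
    and eq: "\<And>x. card {i \<in> I. d i = x} = (\<Sum>\<rho> | \<rho> \<in> A \<and> c \<rho> = x. m \<rho>)"
  shows "(\<Prod>i\<in>I. g (d i)) = (\<Prod>\<rho>\<in>A. g (c \<rho>) ^ m \<rho>)"
proof -
  define Y where "Y = d ` I \<union> c ` A"
  have finY: "finite Y" using fin by (simp add: Y_def)
  have "(\<Prod>i\<in>I. g (d i)) = (\<Prod>y\<in>Y. \<Prod>i | i \<in> I \<and> d i = y. g (d i))"
    by (rule prod.group[symmetric]) (use fin finY in \<open>auto simp: Y_def\<close>)
  also have "\<dots> = (\<Prod>y\<in>Y. \<Prod>\<rho> | \<rho> \<in> A \<and> c \<rho> = y. g (c \<rho>) ^ m \<rho>)"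
  proof (rule prod.cong[OF refl])
    fix y
    have "(\<Prod>i | i \<in> I \<and> d i = y. g (d i)) = g y ^ card {i \<in> I. d i = y}" by simp
    also have "\<dots> = (\<Prod>\<rho> | \<rho> \<in> A \<and> c \<rho> = y. g y ^ m \<rho>)"
      unfolding eq by (rule power_sum)
    finally show "(\<Prod>i | i \<in> I \<and> d i = y. g (d i)) = (\<Prod>\<rho> | \<rho> \<in> A \<and> c \<rho> = y. g (c \<rho>) ^ m \<rho>)"
      by simp
  qed
  also have "\<dots> = (\<Prod>\<rho>\<in>A. g (c \<rho>) ^ m \<rho>)"
    by (rule prod.group) (use fin finY in \<open>auto simp: Y_def\<close>)
  finally show ?thesis .
qed

section \<open>Orthogonal families on a finite weighted set\<close>

locale weighted_set =
  fixes S :: "'a set" and w :: "'a \<Rightarrow> real"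
  assumes fin: "finite S" and w_pos: "T \<in> S \<Longrightarrow> 0 < w T"
begin

definition inner_prod :: "('a \<Rightarrow> real) \<Rightarrow> ('a \<Rightarrow> real) \<Rightarrow> real" where
  "inner_prod f g = (\<Sum>T\<in>S. w T * f T * g T)"

lemma inner_prod_commute: "inner_prod f g = inner_prod g f"
  by (simp add: inner_prod_def mult_ac)

lemma inner_prod_diff_scale: "inner_prod f (\<lambda>T. g T - c * h T) = inner_prod f g - c
    * inner_prod f h"
  by (simp add: inner_prod_def algebra_simps sum_subtractf sum_distrib_left)

lemma inner_prod_cong: "(\<And>T. T \<in> S \<Longrightarrow> f T = f' T) \<Longrightarrow> (\<And>T. T \<in> S \<Longrightarrow> g T = g' T) \<Longrightarrow> inner_prod f g
    = inner_prod f' g'"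
  by (simp add: inner_prod_def)

lemma inner_prod_scale: "inner_prod (\<lambda>T. c * f T) g = c * inner_prod f g"
  by (simp add: inner_prod_def sum_distrib_left mult_ac)

lemma inner_prod_point_fun: "T \<in> S \<Longrightarrow> inner_prod f (point_fun T) = w T * f T"
proof -
  assume "T \<in> S"
  have "inner_prod f (point_fun T) = (\<Sum>T'\<in>S. if T' = T then w T * f T else 0)"
    unfolding inner_prod_def by (rule sum.cong) (auto simp: point_fun_def)
  then show ?thesis using \<open>T \<in> S\<close> fin by simp
qed

lemma inner_prod_nonneg: "0 \<le> inner_prod f f"
  unfolding inner_prod_def by (rule sum_nonneg) (simp add: mult.assoc less_imp_le w_pos)

lemma inner_prod_eq_0_iff: "inner_prod f f = 0 \<longleftrightarrow> (\<forall>T\<in>S. f T = 0)"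
proof -
  have "inner_prod f f = 0 \<longleftrightarrow> (\<forall>T\<in>S. w T * f T * f T = 0)"
    unfolding inner_prod_def by (rule sum_nonneg_eq_0_iff[OF fin])
        (simp add: mult.assoc less_imp_le w_pos)
  also have "\<dots> \<longleftrightarrow> (\<forall>T\<in>S. f T = 0)" using w_pos by (auto simp: less_le)
  finally show ?thesis .
qed

definition orthogonal_family :: "nat \<Rightarrow> (nat \<Rightarrow> 'a \<Rightarrow> real) \<Rightarrow> bool" where
  "orthogonal_family k f \<longleftrightarrow> (\<forall>i<k. \<exists>T\<in>S. f i T \<noteq> 0) \<and> (\<forall>i<k. \<forall>j<k. i \<noteq> j \<longrightarrow> inner_prod (f i) (f j)
      = 0)"

text \<open>\<open>w T0 * f i T0\<close> is the inner product of \<open>f i\<close> with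
  \<open>point_fun T0\<close>, so this is \<open>point_fun T0\<close> minus its projection onto the
  span of the family.\<close>

definition residual :: "nat \<Rightarrow> (nat \<Rightarrow> 'a \<Rightarrow> real) \<Rightarrow> 'a \<Rightarrow> 'a \<Rightarrow> real" where
  "residual k f T0 = (\<lambda>T. point_fun T0 T - (\<Sum>i<k. w T0 * f i T0 / inner_prod (f i) (f i) * f i T))"

lemma orthogonal_family_norm: "orthogonal_family k f \<Longrightarrow> i < k \<Longrightarrow> 0 < inner_prod (f i) (f i)"
  using inner_prod_nonneg[of "f i"] inner_prod_eq_0_iff[of "f i"]
      by (force simp: orthogonal_family_def less_le)

lemma inner_prod_residual_right:
  "inner_prod h (residual k f T0) = inner_prod h (point_fun T0) - (\<Sum>i<k. w T0
      * f i T0 / inner_prod (f i) (f i) * inner_prod h (f i))"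
proof -
  have "(\<Sum>i<k. w T0 * f i T0 / inner_prod (f i) (f i) * inner_prod h (f i)) =
    (\<Sum>T\<in>S. \<Sum>i<k. w T0 * f i T0 / inner_prod (f i) (f i) * (w T * h T * f i T))"
    unfolding inner_prod_def[of h] sum_distrib_left by (rule sum.swap)
  also have "\<dots> = (\<Sum>T\<in>S. w T * h T * (\<Sum>i<k. w T0 * f i T0 / inner_prod (f i) (f i) * f i T))"
    by (simp add: sum_distrib_left mult_ac)
  finally show ?thesis
    by (simp add: inner_prod_def[of h] residual_def right_diff_distrib sum_subtractf)
qed

lemma inner_prod_residual:
  assumes f: "orthogonal_family k f" and "T0 \<in> S" "j < k"
  shows "inner_prod (f j) (residual k f T0) = 0"
proof -
  have "(\<Sum>i<k. w T0 * f i T0 / inner_prod (f i) (f i) * inner_prod (f j) (f i)) =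
      (\<Sum>i<k. if i = j then w T0 * f j T0 else 0)"
    using f \<open>j < k\<close> orthogonal_family_norm[OF f \<open>j < k\<close>]
    by (intro sum.cong) (auto simp: orthogonal_family_def)
  then show ?thesis using assms by (simp add: inner_prod_point_fun inner_prod_residual_right)
qed

text \<open>The left side is the trace of the projection onto the orthogonal complement. This
  dimension count is used twice: for \<open>k < card S\<close> some residual is nonzero, and for
  \<open>k = card S\<close> all residuals vanish.\<close>

lemma sum_residual_norms:
  assumes f: "orthogonal_family k f"
  shows "(\<Sum>T\<in>S. inner_prod (residual k f T) (residual k f T) / w T) = real (card S) - real k"
proof -
  have "inner_prod (residual k f T) (residual k f T) / w T = residual k f T T" if T: "T \<in> S" for T
  proof -
    let ?r = "residual k f T"
    have "inner_prod ?r ?r = inner_prod ?r (point_fun T)"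
      unfolding inner_prod_residual_right[of ?r k f T] inner_prod_commute[of ?r "f _"]
      using inner_prod_residual[OF f T] by simp
    then show ?thesis using inner_prod_point_fun[OF T] w_pos[OF T] by simp
  qed
  then have "(\<Sum>T\<in>S. inner_prod (residual k f T) (residual k f T) / w T) =
      (\<Sum>T\<in>S. residual k f T T)" by simp
  also have "\<dots> = real (card S) - (\<Sum>T\<in>S. \<Sum>i<k. w T * f i T * f i T / inner_prod (f i) (f i))"
    by (simp add: residual_def point_fun_def sum_subtractf)
  also have "(\<Sum>T\<in>S. \<Sum>i<k. w T * f i T * f i T / inner_prod (f i) (f i)) =
      (\<Sum>i<k. inner_prod (f i) (f i) / inner_prod (f i) (f i))"
    unfolding inner_prod_def[of "f _" "f _"] sum_divide_distrib by (rule sum.swap)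
  also have "\<dots> = (\<Sum>i<k. 1)"
    using orthogonal_family_norm[OF f] by (intro sum.cong) (auto simp: less_imp_neq[symmetric])
  finally show ?thesis by simp
qed

lemma ex_residual_nonzero:
  assumes f: "orthogonal_family k f" and "k < card S"
  shows "\<exists>T0\<in>S. \<exists>T\<in>S. residual k f T0 T \<noteq> 0"
proof (rule ccontr)
  assume "\<not> ?thesis"
  then have "inner_prod (residual k f T) (residual k f T) = 0" if "T \<in> S" for T
    using that by (subst inner_prod_eq_0_iff) auto
  then show False using sum_residual_norms[OF f] assms(2) by simp
qed

lemma orthogonal_basis_complete:
  assumes f: "orthogonal_family (card S) f" and "T0 \<in> S" "T \<in> S"
  shows "(\<Sum>i<card S. w T0 * f i T0 / inner_prod (f i) (f i) * f i T) = point_fun T0 T"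
proof -
  let ?r = "residual (card S) f"
  have "(\<Sum>T\<in>S. inner_prod (?r T) (?r T) / w T) = 0" using sum_residual_norms[OF f] by simp
  then have "\<forall>T\<in>S. inner_prod (?r T) (?r T) / w T = 0"
    by (subst (asm) sum_nonneg_eq_0_iff[OF fin]) (auto simp: inner_prod_nonneg w_pos less_imp_le)
  then have "inner_prod (?r T0) (?r T0) = 0" using assms(2) w_pos[OF assms(2)] by auto
  then have "?r T0 T = 0" using assms(3) by (simp add: inner_prod_eq_0_iff)
  then show ?thesis by (simp add: residual_def)
qed

lemma char_poly_of_orthogonal_eigenbasis:
  assumes f: "orthogonal_family (card S) f" and xs: "distinct xs" "set xs = S"
    and eig: "\<And>k T. k < card S \<Longrightarrow> T \<in> S \<Longrightarrow> (\<Sum>T'\<in>S. p T T' * f k T') = e k * f k T"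
  shows "char_poly (mat (length xs) (length xs) (\<lambda>(a, b). p (xs ! a) (xs ! b)))
    = (\<Prod>k<card S. [:- e k, 1:])"
proof -
  define N where "N = card S"
  have len: "length xs = N" using distinct_card[OF xs(1)] xs(2) by (simp add: N_def)
  have nth: "xs ! a \<in> S" if "a < N" for a using that len xs(2) by auto
  have sum_nth: "(\<Sum>a = 0..<N. g (xs ! a)) = (\<Sum>T\<in>S. g T)" for g :: "'a \<Rightarrow> real"
  proof -
    have "bij_betw ((!) xs) {..<N} S" using bij_betw_nth[OF xs(1)] len xs(2) by simp
    then show ?thesis using sum.reindex_bij_betw[of "(!) xs" "{..<N}" S g] by
        (simp add: lessThan_atLeast0)
  qed
  have point_fun_nth: "point_fun (xs ! a) (xs ! b) = (if a = b then 1 else 0)" if "a < N" "b < N"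
      for a b
    using that xs(1) len by (auto simp: point_fun_def nth_eq_iff_index_eq)
  define M where "M = mat N N (\<lambda>(a, b). p (xs ! a) (xs ! b))"
  define F where "F = mat N N (\<lambda>(a, k). f k (xs ! a))"
  \<comment> \<open>The inverse of \<open>F\<close>: its rows are the dual basis for the weighted
    inner product. Orthogonality yields \<open>G * F = 1\<close>, completeness yields
    \<open>F * G = 1\<close>.\<close>
  define G where "G = mat N N (\<lambda>(k, b). w (xs ! b) * f k (xs ! b) / inner_prod (f k) (f k))"
  define D where "D = mat N N (\<lambda>(k, l). if k = l then e k else 0)"
  have carr: "M \<in> carrier_mat N N" "F \<in> carrier_mat N N" "G \<in> carrier_mat N N" "D \<in> carrier_mat N N"
    by (auto simp: M_def F_def G_def D_def)
  have FG: "F * G = 1\<^sub>m N"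
  proof (rule eq_matI)
    fix a b assume "a < dim_row (1\<^sub>m N :: real mat)" "b < dim_col (1\<^sub>m N :: real mat)"
    then have ab: "a < N" "b < N" by auto
    have "(F * G) $$ (a, b) = (\<Sum>k<N. f k (xs ! a) * (w (xs ! b)
        * f k (xs ! b) / inner_prod (f k) (f k)))"
      using ab by (simp add: F_def G_def scalar_prod_def lessThan_atLeast0)
    also have "\<dots> = point_fun (xs ! b) (xs ! a)"
      using orthogonal_basis_complete[OF f nth[OF ab(2)] nth[OF ab(1)]] by (simp add: N_def mult_ac)
    finally show "(F * G) $$ (a, b) = 1\<^sub>m N $$ (a, b)" using ab point_fun_nth[OF ab(2,1)] by simp
  qed (auto simp: F_def G_def)
  have GF: "G * F = 1\<^sub>m N"
  proof (rule eq_matI)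
    fix k l assume "k < dim_row (1\<^sub>m N :: real mat)" "l < dim_col (1\<^sub>m N :: real mat)"
    then have kl: "k < N" "l < N" by auto
    have "(G * F) $$ (k, l) = (\<Sum>a = 0..<N. w (xs ! a) * f k (xs ! a) / inner_prod (f k) (f k)
        * f l (xs ! a))"
      using kl by (simp add: F_def G_def scalar_prod_def)
    also have "\<dots> = (\<Sum>T\<in>S. w T * f k T / inner_prod (f k) (f k) * f l T)"
      by (rule sum_nth)
    also have "\<dots> = inner_prod (f k) (f l) / inner_prod (f k) (f k)"
      by (simp add: inner_prod_def sum_divide_distrib)
    finally show "(G * F) $$ (k, l) = 1\<^sub>m N $$ (k, l)"
      using kl f orthogonal_family_norm[OF f, of k] by (auto simp: N_def orthogonal_family_def)
  qed (auto simp: F_def G_def)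
  have MF: "M * F = F * D"
  proof (rule eq_matI)
    fix a k assume "a < dim_row (F * D)" "k < dim_col (F * D)"
    then have ak: "a < N" "k < N" by (auto simp: F_def D_def)
    have "(M * F) $$ (a, k) = (\<Sum>b = 0..<N. p (xs ! a) (xs ! b) * f k (xs ! b))"
      using ak by (simp add: F_def M_def scalar_prod_def)
    also have "\<dots> = e k * f k (xs ! a)"
      unfolding sum_nth[of "\<lambda>T. p (xs ! a) T * f k T"] using eig[of k "xs ! a"] ak nth by
          (simp add: N_def)
    also have "\<dots> = (\<Sum>l = 0..<N. f l (xs ! a) * (if l = k then e l else 0))"
      using ak by (simp add: if_distrib[of "(*) _"] mult.commute cong: if_cong)
    also have "\<dots> = (F * D) $$ (a, k)"
      using ak by (simp add: F_def D_def scalar_prod_def)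
    finally show "(M * F) $$ (a, k) = (F * D) $$ (a, k)" .
  qed (auto simp: F_def D_def M_def)
  have "M = M * (F * G)" using carr FG by simp
  also have "\<dots> = F * D * G" using carr MF by (simp flip: assoc_mult_mat[of M N N F N G N])
  finally have "similar_mat M D"
    using carr FG GF by (intro similar_matI[of _ _ F G N]) auto
  then have "char_poly M = char_poly D" by (rule char_poly_similar)
  also have "\<dots> = (\<Prod>a\<leftarrow>diag_mat D. [:- a, 1:])"
    by (rule char_poly_upper_triangular[OF carr(4)]) (auto simp: D_def upper_triangular_def)
  also have "diag_mat D = map e [0..<N]" by (auto simp: diag_mat_def D_def)
  also have "(\<Prod>a\<leftarrow>map e [0..<N]. [:- a, 1:]) = (\<Prod>k<N. [:- e k, 1:])"
    using prod.distinct_set_conv_list[of "[0..<N]" "\<lambda>k. [:- e k, 1:]"]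
    by (simp add: comp_def lessThan_atLeast0)
  finally show ?thesis by (simp add: M_def N_def len)
qed

end

section \<open>Self-adjoint operators: eigenfunctions and multiplicities from traces\<close>

locale reversible_operator = weighted_set S w for S :: "'a set" and w :: "'a \<Rightarrow> real" +
  fixes X :: "('a \<Rightarrow> real) \<Rightarrow> 'a \<Rightarrow> real"
  assumes kernel: "has_kernel X S S"
    and reversible: "T \<in> S \<Longrightarrow> T' \<in> S \<Longrightarrow> w T * X (point_fun T') T = w T' * X (point_fun T) T'"
begin

lemma self_adjoint: "inner_prod f (X g) = inner_prod (X f) g"
proof -
  have X: "X h T = (\<Sum>T'\<in>S. X (point_fun T') T * h T')" if "T \<in> S" for h T
    using kernel that by (auto simp: has_kernel_def)
  have "inner_prod f (X g) = (\<Sum>T\<in>S. \<Sum>T'\<in>S. f T * (w T * X (point_fun T') T) * g T')"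
    unfolding inner_prod_def by (intro sum.cong refl) (simp add: X[of _ g] sum_distrib_left mult_ac)
  also have "\<dots> = (\<Sum>T\<in>S. \<Sum>T'\<in>S. f T * (w T' * X (point_fun T) T') * g T')"
    by (intro sum.cong refl) (simp add: reversible)
  also have "\<dots> = (\<Sum>T'\<in>S. \<Sum>T\<in>S. f T * (w T' * X (point_fun T) T') * g T')"
    by (rule sum.swap)
  also have "\<dots> = inner_prod (X f) g"
    unfolding inner_prod_def by (intro sum.cong refl)
        (simp add: X[of _ f] sum_distrib_left sum_distrib_right mult_ac)
  finally show ?thesis .
qed

primrec shifted_prod :: "real list \<Rightarrow> ('a \<Rightarrow> real) \<Rightarrow> 'a \<Rightarrow> real" where
  "shifted_prod [] f = f"
| "shifted_prod (c # cs) f = (\<lambda>T. X (shifted_prod cs f) T - c * shifted_prod cs f T)"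

lemma shifted_prod_append: "shifted_prod (cs @ ds) f = shifted_prod cs (shifted_prod ds f)"
  by (induction cs) simp_all

lemma shifted_prod_adjoint: "inner_prod f (shifted_prod cs g)
    = inner_prod (shifted_prod (rev cs) f) g"
proof (induction cs arbitrary: f)
  case (Cons c cs)
  have "inner_prod f (shifted_prod (c # cs) g) = inner_prod (X f) (shifted_prod cs g) - c
      * inner_prod f (shifted_prod cs g)"
    by (simp add: inner_prod_diff_scale self_adjoint)
  also have "\<dots> = inner_prod (\<lambda>T. X f T - c * f T) (shifted_prod cs g)"
    unfolding inner_prod_commute[of _ "shifted_prod cs g"] by (simp add: inner_prod_diff_scale)
  finally have "inner_prod f (shifted_prod (c # cs) g) = inner_prod (\<lambda>T. X f T - c
      * f T) (shifted_prod cs g)" .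
  then show ?case by (simp add: Cons shifted_prod_append)
qed simp

lemma has_kernel_shifted_prod: "has_kernel (shifted_prod cs) S S"
proof (induction cs)
  case Nil
  then show ?case using has_kernel_pow[OF kernel fin, of 0] by (simp add: has_kernel_def)
next
  case (Cons c cs)
  show ?case unfolding has_kernel_def
  proof (intro allI ballI)
    fix f T assume T: "T \<in> S"
    have 1: "X (shifted_prod cs f) T = (\<Sum>T'\<in>S. X (shifted_prod cs (point_fun T')) T * f T')"
      using has_kernel_comp[OF kernel Cons] T by (simp add: has_kernel_def)
    have 2: "shifted_prod cs f T = (\<Sum>T'\<in>S. shifted_prod cs (point_fun T') T * f T')"
      using Cons T by (simp add: has_kernel_def)
    show "shifted_prod (c # cs) f T = (\<Sum>T'\<in>S. shifted_prod (c # cs) (point_fun T') T * f T')"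
      by (simp add: 1 2[symmetric] left_diff_distrib sum_subtractf sum_distrib_left mult.assoc)
        (simp add: 2 sum_distrib_left mult.assoc)
  qed
qed

lemma X_pow_diff_scale:
  assumes "T \<in> S"
  shows "(X ^^ k) (\<lambda>T. f T - c * g T) T = (X ^^ k) f T - c * (X ^^ k) g T"
proof -
  have K: "(X ^^ k) h T = (\<Sum>T'\<in>S. (X ^^ k) (point_fun T') T * h T')" for h
    using has_kernel_pow[OF kernel fin, of k] assms by (auto simp: has_kernel_def)
  show ?thesis
    unfolding K[of "\<lambda>T. f T - c * g T"] K[of f] K[of g]
    by (simp add: algebra_simps sum_subtractf sum_distrib_left)
qed

text \<open>The extra power of \<open>X\<close> is for the induction: splitting off a factor
  \<open>X - x\<close> gives the trace with exponent \<open>k + 1\<close> minus \<open>x\<close>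
  times the trace with exponent \<open>k\<close>.\<close>

lemma trace_shifted_prod:
  assumes tr: "\<And>k. op_trace S (X ^^ k) = (\<Sum>\<rho>\<in>A. m \<rho> * c \<rho> ^ k)"
  shows "op_trace S (\<lambda>f. (X ^^ k) (shifted_prod cs f)) = (\<Sum>\<rho>\<in>A. m \<rho> * c \<rho> ^ k * (\<Prod>x\<leftarrow>cs. c \<rho> - x))"
proof (induction cs arbitrary: k)
  case Nil
  then show ?case using tr[of k] by (simp add: op_trace_def)
next
  case (Cons x cs)
  have "op_trace S (\<lambda>f. (X ^^ k) (shifted_prod (x # cs) f)) =
    op_trace S (\<lambda>f. (X ^^ Suc k) (shifted_prod cs f)) - x
        * op_trace S (\<lambda>f. (X ^^ k) (shifted_prod cs f))"
    unfolding op_trace_def sum_distrib_left sum_subtractf[symmetric]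
    by (intro sum.cong refl) (simp add: X_pow_diff_scale funpow_swap1)
  also have "\<dots> = (\<Sum>\<rho>\<in>A. m \<rho> * c \<rho> ^ k * (\<Prod>x\<leftarrow>x # cs. c \<rho> - x))"
    unfolding Cons sum_distrib_left sum_subtractf[symmetric]
    by (intro sum.cong refl) (simp add: algebra_simps)
  finally show ?case .
qed

text \<open>The trace of \<open>B* B\<close> vanishes for \<open>B = \<Prod>(X - c)\<close>, so \<open>B = 0\<close>.\<close>

lemma shifted_prod_eq_0:
  assumes tr: "\<And>k. op_trace S (X ^^ k) = (\<Sum>\<rho>\<in>A. m \<rho> * c \<rho> ^ k)" and cs: "c ` A \<subseteq> set cs"
    and "T \<in> S"
  shows "shifted_prod cs f T = 0"
proof -
  have "0 = (\<Sum>\<rho>\<in>A. m \<rho> * c \<rho> ^ 0 * (\<Prod>x\<leftarrow>rev cs @ cs. c \<rho> - x))"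
    using cs by (intro sum.neutral[symmetric]) (auto simp: prod_list_zero_iff)
  also have "\<dots> = op_trace S (\<lambda>f. (X ^^ 0) (shifted_prod (rev cs @ cs) f))"
    by (rule trace_shifted_prod[OF tr, symmetric])
  \<comment> \<open>By adjointness the diagonal entry at \<open>T\<close> is a squared norm divided
    by \<open>w T\<close>; since the sum is zero, every column of the product vanishes on
    \<open>S\<close>.\<close>
  also have "\<dots> = (\<Sum>T\<in>S. inner_prod (shifted_prod cs (point_fun T)) (shifted_prod cs (point_fun T)) / w T)"
    unfolding op_trace_def
  proof (rule sum.cong[OF refl])
    fix T assume T: "T \<in> S"
    have "inner_prod (shifted_prod cs (point_fun T)) (shifted_prod cs (point_fun T))
        = inner_prod (shifted_prod (rev cs) (shifted_prod cs (point_fun T))) (point_fun T)"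
      by (rule shifted_prod_adjoint)
    then show "(X ^^ 0) (shifted_prod (rev cs @ cs) (point_fun T)) T
        = inner_prod (shifted_prod cs (point_fun T)) (shifted_prod cs (point_fun T)) / w T"
      using T w_pos[OF T] by (simp add: inner_prod_point_fun shifted_prod_append)
  qed
  finally have "(\<Sum>T\<in>S. inner_prod (shifted_prod cs (point_fun T)) (shifted_prod cs (point_fun T)) / w T) = 0" by simp
  then have "\<forall>T\<in>S. inner_prod (shifted_prod cs (point_fun T)) (shifted_prod cs (point_fun T)) / w T = 0"
    by (subst (asm) sum_nonneg_eq_0_iff[OF fin]) (auto simp: inner_prod_nonneg w_pos less_imp_le)
  then have "inner_prod (shifted_prod cs (point_fun T)) (shifted_prod cs (point_fun T)) = 0"
      if "T \<in> S" for T
    using that w_pos[OF that] by auto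
  then have zero: "shifted_prod cs (point_fun T') T = 0" if "T' \<in> S" for T'
    using that \<open>T \<in> S\<close> by (simp add: inner_prod_eq_0_iff)
  have "shifted_prod cs f T = (\<Sum>T'\<in>S. shifted_prod cs (point_fun T') T * f T')"
    using has_kernel_shifted_prod[of cs] \<open>T \<in> S\<close> unfolding has_kernel_def by blast
  also have "\<dots> = 0" by (rule sum.neutral) (simp add: zero)
  finally show ?thesis .
qed

text \<open>Apply the factors one at a time, innermost first: the last nonzero function before the
  product dies is an eigenfunction, and it has not left the invariant set \<open>W\<close>.\<close>

lemma ex_eigenvector:
  assumes W: "\<And>f c. f \<in> W \<Longrightarrow> (\<lambda>T. X f T - c * f T) \<in> W"
    and v: "v \<in> W" "\<exists>T\<in>S. v T \<noteq> 0" and kill: "\<And>T. T \<in> S \<Longrightarrow> shifted_prod cs v T = 0"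
  shows "\<exists>c\<in>set cs. \<exists>f\<in>W. (\<exists>T\<in>S. f T \<noteq> 0) \<and> (\<forall>T\<in>S. X f T = c * f T)"
  using kill
proof (induction cs)
  case Nil
  then show ?case using v by auto
next
  case (Cons c cs)
  have inW: "shifted_prod ds v \<in> W" for ds by (induction ds) (use W v in auto)
  show ?case
  proof (cases "\<forall>T\<in>S. shifted_prod cs v T = 0")
    case True
    then show ?thesis using Cons.IH by auto
  next
    case False
    then show ?thesis using Cons.prems inW[of cs]
      by (intro bexI[of _ c] bexI[of _ "shifted_prod cs v"]) auto
  qed
qed

text \<open>By self-adjointness the orthogonal complement of eigenfunctions is invariant, and as
  long as \<open>k < card S\<close> it contains a nonzero residual. Feeding this to
  \<open>ex_eigenvector\<close> gives the next eigenfunction.\<close>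

lemma orthogonal_eigenfunctions:
  assumes kill: "\<And>f T. T \<in> S \<Longrightarrow> shifted_prod cs f T = 0" and "k \<le> card S"
  shows "\<exists>f d. orthogonal_family k f \<and> (\<forall>i<k. d i \<in> set cs \<and> (\<forall>T\<in>S. X (f i) T = d i * f i T))"
  using assms(2)
proof (induction k)
  case 0
  then show ?case by (simp add: orthogonal_family_def)
next
  case (Suc k)
  then obtain f d where f: "orthogonal_family k f"
    and d: "\<And>i. i < k \<Longrightarrow> d i \<in> set cs" "\<And>i T. i < k \<Longrightarrow> T \<in> S \<Longrightarrow> X (f i) T = d i * f i T"
    by auto
  obtain T0 where T0: "T0 \<in> S" "\<exists>T\<in>S. residual k f T0 T \<noteq> 0"
    using ex_residual_nonzero[OF f] Suc.prems by auto
  define W where "W = {g. \<forall>i<k. inner_prod (f i) g = 0}"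
  have "\<exists>c\<in>set cs. \<exists>g\<in>W. (\<exists>T\<in>S. g T \<noteq> 0) \<and> (\<forall>T\<in>S. X g T = c * g T)"
  proof (rule ex_eigenvector)
    show "residual k f T0 \<in> W" using inner_prod_residual[OF f T0(1)] by (simp add: W_def)
    show "(\<lambda>T. X g T - c * g T) \<in> W" if "g \<in> W" for g c
      unfolding W_def
    proof (intro CollectI allI impI)
      fix i assume i: "i < k"
      have "inner_prod (X (f i)) g = inner_prod (\<lambda>T. d i * f i T) g" by (rule inner_prod_cong)
          (auto simp: d(2)[OF i])
      then show "inner_prod (f i) (\<lambda>T. X g T - c * g T) = 0"
        using that i by (simp add: inner_prod_diff_scale self_adjoint inner_prod_scale W_def)
    qed
  qed (use T0 kill in auto)
  then obtain c g where g: "c \<in> set cs" "g \<in> W" "\<exists>T\<in>S. g T \<noteq> 0" "\<forall>T\<in>S. X g T = c * g T"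
    by blast
  have "orthogonal_family (Suc k) (f(k := g))"
    using f g(2,3) by (auto simp: orthogonal_family_def W_def less_Suc_eq inner_prod_commute[of g])
  moreover have "\<forall>i<Suc k. (d(k := c)) i \<in> set cs \<and> (\<forall>T\<in>S. X ((f(k := g)) i) T = (d(k := c)) i
      * (f(k := g)) i T)"
    using d g by (auto simp: less_Suc_eq)
  ultimately show ?case by blast
qed

text \<open>Expanding each \<open>point_fun T\<close> in the orthogonal basis diagonalises the
  trace.\<close>

lemma trace_eigenbasis:
  assumes f: "orthogonal_family (card S) f"
    and d: "\<And>i T. i < card S \<Longrightarrow> T \<in> S \<Longrightarrow> X (f i) T = d i * f i T"
  shows "op_trace S (X ^^ k) = (\<Sum>i<card S. d i ^ k)"
proof -
  have K: "(X ^^ k) h T = (\<Sum>T'\<in>S. (X ^^ k) (point_fun T') T * h T')" if "T \<in> S" for h T k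
    using has_kernel_pow[OF kernel fin, of k] that by (auto simp: has_kernel_def)
  have pow: "(X ^^ k) (f i) T = d i ^ k * f i T" if "i < card S" "T \<in> S" for i k T
    using that
  proof (induction k arbitrary: T)
    case (Suc k)
    have X: "X h T = (\<Sum>T'\<in>S. X (point_fun T') T * h T')" for h
      using kernel Suc.prems by (auto simp: has_kernel_def)
    have "(X ^^ Suc k) (f i) T = (\<Sum>T'\<in>S. X (point_fun T') T * (d i ^ k * f i T'))"
      unfolding funpow.simps(2) o_apply X[of "(X ^^ k) (f i)"] using Suc by simp
    also have "\<dots> = d i ^ k * X (f i) T"
      unfolding X[of "f i"] by (simp add: sum_distrib_left mult_ac)
    finally show ?case using d Suc.prems by simp
  qed simp
  have "op_trace S (X ^^ k) = (\<Sum>T\<in>S. \<Sum>T'\<in>S. (X ^^ k) (point_fun T') T * point_fun T T')"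
    unfolding op_trace_def by (intro sum.cong refl) (rule K)
  also have "\<dots> = (\<Sum>T\<in>S. \<Sum>T'\<in>S. \<Sum>i<card S. w T * f i T / inner_prod (f i) (f i)
      * ((X ^^ k) (point_fun T') T * f i T'))"
    by (intro sum.cong refl)
      (simp add: orthogonal_basis_complete[OF f, symmetric] sum_distrib_left mult_ac)
  also have "\<dots> = (\<Sum>T\<in>S. \<Sum>i<card S. w T * f i T / inner_prod (f i) (f i) * (X ^^ k) (f i) T)"
  proof (rule sum.cong[OF refl])
    fix T assume "T \<in> S"
    show "(\<Sum>T'\<in>S. \<Sum>i<card S. w T * f i T / inner_prod (f i) (f i) * ((X ^^ k) (point_fun T') T
        * f i T'))
      = (\<Sum>i<card S. w T * f i T / inner_prod (f i) (f i) * (X ^^ k) (f i) T)"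
      unfolding K[OF \<open>T \<in> S\<close>, of k "f _"] sum_distrib_left by (rule sum.swap)
  qed
  also have "\<dots> = (\<Sum>i<card S. \<Sum>T\<in>S. w T * f i T / inner_prod (f i) (f i) * (d i ^ k * f i T))"
    by (subst sum.swap) (intro sum.cong refl, simp add: pow)
  also have "\<dots> = (\<Sum>i<card S. d i ^ k)"
  proof (rule sum.cong[OF refl])
    fix i assume "i \<in> {..<card S}"
    then have "0 < inner_prod (f i) (f i)" using orthogonal_family_norm[OF f] by simp
    moreover have "(\<Sum>T\<in>S. w T * f i T / inner_prod (f i) (f i) * (d i ^ k * f i T)) = d i ^ k
        * (inner_prod (f i) (f i) / inner_prod (f i) (f i))"
      unfolding inner_prod_def[of "f i" "f i"] sum_divide_distrib sum_distrib_left by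
          (simp add: mult_ac)
    ultimately show "(\<Sum>T\<in>S. w T * f i T / inner_prod (f i) (f i) * (d i ^ k * f i T))
        = d i ^ k" by simp
  qed
  finally show ?thesis .
qed

text \<open>The traces are used twice: they show that the product of the \<open>X - c \<rho>\<close>
  is zero on \<open>S\<close>, which yields the basis, and compared with the traces computed in that
  basis they yield the multiplicities.\<close>

theorem eigenbasis_from_traces:
  fixes m :: "'b \<Rightarrow> nat"
  assumes tr: "\<And>k. op_trace S (X ^^ k) = (\<Sum>\<rho>\<in>A. real (m \<rho>) * c \<rho> ^ k)" and A: "finite A"
  obtains f d where "orthogonal_family (card S) f"
    and "\<And>i T. i < card S \<Longrightarrow> T \<in> S \<Longrightarrow> X (f i) T = d i * f i T"
    and "\<And>x. card {i \<in> {..<card S}. d i = x} = (\<Sum>\<rho> | \<rho> \<in> A \<and> c \<rho> = x. m \<rho>)"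
proof -
  obtain cs where cs: "set cs = c ` A" using finite_list[of "c ` A"] A by auto
  have "shifted_prod cs f T = 0" if "T \<in> S" for f T
    using shifted_prod_eq_0[OF tr, of cs] cs that by simp
  from orthogonal_eigenfunctions[OF this order_refl]
  obtain f d where f: "orthogonal_family (card S) f"
    and d: "\<And>i T. i < card S \<Longrightarrow> T \<in> S \<Longrightarrow> X (f i) T = d i * f i T"
    by metis
  have "card {i \<in> {..<card S}. d i = x} = (\<Sum>\<rho> | \<rho> \<in> A \<and> c \<rho> = x. m \<rho>)" for x
    by (rule multiplicities_from_power_sums) (use A tr trace_eigenbasis[OF f d] in auto)
  then show ?thesis using that f d by blast
qed

end

section \<open>The random transpositions chain\<close>

definition list_fun :: "nat list \<Rightarrow> nat \<Rightarrow> nat" where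
  "list_fun xs i = (if i < length xs then xs ! i else 0)"

lemma list_fun_part_fun:
  assumes "is_partition n xs"
  shows "list_fun xs \<in> part_fun n" "length xs \<le> n"
proof -
  have xs: "sorted_wrt (\<ge>) xs" "0 \<notin> set xs" "sum_list xs = n"
    using assms by (auto simp: is_partition_def)
  show P: "list_fun xs \<in> part_fun n"
  proof (rule ParI)
    show "list_fun xs (Suc i) \<le> list_fun xs i" for i
      using sorted_wrt_nth_less[OF xs(1), of i "Suc i"] by (auto simp: list_fun_def)
    show "list_fun xs i = 0" if "i \<ge> length xs" for i using that by (simp add: list_fun_def)
    have "sum (list_fun xs) {..<length xs} = (\<Sum>i = 0..<length xs. xs ! i)"
      unfolding lessThan_atLeast0 by (rule sum.cong) (auto simp: list_fun_def)
    then show "sum (list_fun xs) {..<length xs} = n" using xs(3) by (simp add: sum_list_sum_nth)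
  qed
  show "length xs \<le> n"
  proof (rule ccontr)
    assume "\<not> length xs \<le> n"
    then have "xs ! n = 0" using part_fun_zero[OF P, of n] by (simp add: list_fun_def)
    then show False using xs(2) \<open>\<not> length xs \<le> n\<close> by (metis not_le nth_mem)
  qed
qed

text \<open>The padding rows and columns have margin zero, hence contain only zeros.\<close>

lemma tables_eq_margin_tables:
  assumes "length lam \<le> n" "length mu \<le> n"
  shows "tables lam mu = margin_tables n n (list_fun lam) (list_fun mu)"
proof (intro equalityI subsetI)
  fix T assume T: "T \<in> tables lam mu"
  have "(\<Sum>j<n. T i j) = (\<Sum>j<length mu. T i j)" for i
    by (rule sum_lessThan_zero_tail) (use T assms in \<open>auto simp: tables_def\<close>)
  moreover have "(\<Sum>i<n. T i j) = (\<Sum>i<length lam. T i j)" for j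
    by (rule sum_lessThan_zero_tail) (use T assms in \<open>auto simp: tables_def\<close>)
  ultimately show "T \<in> margin_tables n n (list_fun lam) (list_fun mu)"
    using T assms by (auto simp: margin_tables_def tables_def list_fun_def)
next
  fix T assume T: "T \<in> margin_tables n n (list_fun lam) (list_fun mu)"
  have z: "T i j = 0" if ij: "length lam \<le> i \<or> length mu \<le> j" for i j
  proof (cases "n \<le> i \<or> n \<le> j")
    case True
    then show ?thesis using T by (auto simp: margin_tables_def)
  next
    case False
    then have "(\<Sum>j<n. T i j) = 0 \<or> (\<Sum>i<n. T i j) = 0" using T ij by
        (auto simp: margin_tables_def list_fun_def)
    then show ?thesis using False by auto
  qed
  have "(\<Sum>j<n. T i j) = (\<Sum>j<length mu. T i j)" for i
    by (rule sum_lessThan_zero_tail) (use z assms in auto)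
  moreover have "(\<Sum>i<n. T i j) = (\<Sum>i<length lam. T i j)" for j
    by (rule sum_lessThan_zero_tail) (use z assms in auto)
  ultimately show "T \<in> tables lam mu"
    using T assms z unfolding margin_tables_def tables_def list_fun_def by auto
qed

lemma incr_decr: "0 < T i j \<Longrightarrow> incr i j (decr i j T) = T"
  by (auto simp: incr_def decr_def fun_eq_iff)

lemma decr_incr: "decr i j (incr i j T) = T"
  by (auto simp: incr_def decr_def fun_eq_iff)

lemma swap_cells_flip:
  assumes "i \<noteq> k" "j \<noteq> l"
  shows "swap_cells i j k l T = flip T i j k l"
  using assms by (auto simp: swap_cells_def flip_def incr_def decr_def fun_eq_iff)

lemma swap_cells_trivial:
  assumes "i = k \<or> j = l" "0 < T i j" "0 < decr i j T k l"
  shows "swap_cells i j k l T = T"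
proof (cases "i = k")
  case True
  then show ?thesis using assms by (simp add: swap_cells_def incr_decr)
next
  case False
  then have "j = l" using assms by simp
  moreover have "swap_cells i j k j T = incr i j (incr k j (decr k j (decr i j T)))"
    unfolding swap_cells_def by (rule incr_commute)
  ultimately show ?thesis using assms by (simp add: incr_decr)
qed

text \<open>Separates a multiple of \<open>f T\<close> from the proper moves. The subtracted
  indicator prevents a ball from being paired with itself; pairs in a common row or column
  contribute to the multiple of \<open>f T\<close> only.\<close>

lemma swap_term:
  "real (T i j) * real (decr i j T k l) * f (swap_cells i j k l T) =
    real (T i j) * (real (T k l) - (if k = i \<and> l = j then 1 else 0)) * f T +
    (if i \<noteq> k \<and> j \<noteq> l then real (T i j) * real (T k l) * (f (flip T i j k l) - f T) else 0)"
proof (cases "T i j = 0")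
  case False
  have d: "real (decr i j T k l) = real (T k l) - (if k = i \<and> l = j then 1 else 0)"
    using False by (auto simp: decr_def)
  show ?thesis
  proof (cases "i \<noteq> k \<and> j \<noteq> l")
    case True
    then show ?thesis unfolding d by (simp add: swap_cells_flip algebra_simps)
  next
    case nontriv: False
    show ?thesis
    proof (cases "decr i j T k l = 0")
      case True
      then show ?thesis using nontriv d by auto
    next
      case False
      then have "swap_cells i j k l T = T"
        using nontriv \<open>T i j \<noteq> 0\<close> by (intro swap_cells_trivial) auto
      then show ?thesis using nontriv unfolding d by auto
    qed
  qed
qed simp

text \<open>Passes from ordered pairs of balls to the normalisation \<open>i1 < i2\<close> of
  \<open>rt_move\<close>; this is the origin of the factor 2 there.\<close>

lemma sum_pairs_symmetric:
  fixes h :: "nat \<Rightarrow> nat \<Rightarrow> nat \<Rightarrow> nat \<Rightarrow> real"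
  assumes sym: "\<And>i k j l. h i k j l = h k i l j"
  shows "(\<Sum>i<m. \<Sum>k<m. \<Sum>j<n. \<Sum>l<n. if i \<noteq> k \<and> j \<noteq> l then h i k j l else 0) =
    2 * (\<Sum>i<m. \<Sum>k<m. \<Sum>j<n. \<Sum>l<n. if i < k \<and> j \<noteq> l then h i k j l else 0)"
proof -
  have "(\<Sum>i<m. \<Sum>k<m. \<Sum>j<n. \<Sum>l<n. if k < i \<and> j \<noteq> l then h i k j l else 0) =
    (\<Sum>k<m. \<Sum>i<m. \<Sum>j<n. \<Sum>l<n. if k < i \<and> j \<noteq> l then h i k j l else 0)"
    by (rule sum.swap)
  also have "\<dots> = (\<Sum>k<m. \<Sum>i<m. \<Sum>l<n. \<Sum>j<n. if k < i \<and> j \<noteq> l then h i k j l else 0)"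
    by (rule sum.cong[OF refl], rule sum.cong[OF refl], rule sum.swap)
  also have "\<dots> = (\<Sum>i<m. \<Sum>k<m. \<Sum>j<n. \<Sum>l<n. if i < k \<and> j \<noteq> l then h i k j l else 0)"
    by (intro sum.cong refl) (auto intro: sym)
  finally have "(\<Sum>i<m. \<Sum>k<m. \<Sum>j<n. \<Sum>l<n. if k < i \<and> j \<noteq> l then h i k j l else 0) =
    (\<Sum>i<m. \<Sum>k<m. \<Sum>j<n. \<Sum>l<n. if i < k \<and> j \<noteq> l then h i k j l else 0)" .
  moreover have "(\<Sum>i<m. \<Sum>k<m. \<Sum>j<n. \<Sum>l<n. if i \<noteq> k \<and> j \<noteq> l then h i k j l else 0) =
    (\<Sum>i<m. \<Sum>k<m. \<Sum>j<n. \<Sum>l<n. if i < k \<and> j \<noteq> l then h i k j l else 0) +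
    (\<Sum>i<m. \<Sum>k<m. \<Sum>j<n. \<Sum>l<n. if k < i \<and> j \<noteq> l then h i k j l else 0)"
    unfolding sum.distrib[symmetric] by (intro sum.cong refl) auto
  ultimately show ?thesis by simp
qed

lemma flip_swap: "i \<noteq> k \<Longrightarrow> j \<noteq> l \<Longrightarrow> flip T i j k l = flip T k l i j"
  by (auto simp: flip_def fun_eq_iff)

text \<open>\<open>n (n - 1)\<close> is the number of ordered pairs of distinct balls, so
  \<open>swap_op\<close> is this constant plus a generator that kills constants.\<close>

lemma swap_op_flip:
  assumes T: "T \<in> margin_tables n n \<alpha> \<mu>" and \<alpha>: "sum \<alpha> {..<n} = n"
  shows "swap_op n n f T = real n * (real n - 1) * f T +
    (\<Sum>i<n. \<Sum>k<n. \<Sum>j<n. \<Sum>l<n. if i < k \<and> j \<noteq> l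
       then 2 * real (T i j) * real (T k l) * (f (flip T i j k l) - f T) else 0)"
proof -
  have tot: "(\<Sum>i<n. \<Sum>j<n. real (T i j)) = real n"
  proof -
    have "(\<Sum>i<n. \<Sum>j<n. T i j) = n" using T \<alpha> by (simp add: margin_tables_def)
    then show ?thesis by (simp flip: of_nat_sum)
  qed
  have w: "(\<Sum>i<n. \<Sum>k<n. \<Sum>j<n. \<Sum>l<n. real (T i j) * (real (T k l) - (if k = i \<and> l
      = j then 1 else 0)))
    = real n * (real n - 1)"
  proof -
    have "(\<Sum>i<n. \<Sum>k<n. \<Sum>j<n. \<Sum>l<n. real (T i j) * (real (T k l) - (if k = i \<and> l = j then 1 else 0)))
      = (\<Sum>i<n. \<Sum>j<n. \<Sum>k<n. \<Sum>l<n. real (T i j) * (real (T k l) - (if k = i \<and> l = j then 1 else 0)))"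
      by (rule sum.cong[OF refl], rule sum.swap)
    also have "\<dots> = (\<Sum>i<n. \<Sum>j<n. real (T i j) * (real n - 1))"
    proof (intro sum.cong refl)
      fix i j assume ij: "i \<in> {..<n}" "j \<in> {..<n}"
      have "(\<Sum>k<n. \<Sum>l<n. if k = i \<and> l = j then 1 else 0) =
          (\<Sum>k<n. if k = i then \<Sum>l<n. if l = j then 1 else 0 else (0::real))"
        by (intro sum.cong refl) auto
      also have "\<dots> = 1" using ij by simp
      finally have one: "(\<Sum>k<n. \<Sum>l<n. if k = i \<and> l = j then 1 else 0) = (1::real)" .
      have "(\<Sum>k<n. \<Sum>l<n. real (T i j) * (real (T k l) - (if k = i \<and> l = j then 1 else 0)))
        = real (T i j) * ((\<Sum>k<n. \<Sum>l<n. real (T k l)) - (\<Sum>k<n. \<Sum>l<n. if k = i \<and> l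
            = j then 1 else 0))"
        by (simp only: sum_distrib_left[symmetric] sum_subtractf)
      then show "(\<Sum>k<n. \<Sum>l<n. real (T i j) * (real (T k l) - (if k = i \<and> l = j then 1 else 0)))
        = real (T i j) * (real n - 1)"
        unfolding tot one .
    qed
    also have "\<dots> = real n * (real n - 1)" unfolding sum_distrib_right[symmetric] tot ..
    finally show ?thesis .
  qed
  define h where "h i k j l = real (T i j) * real (T k l) * (f (flip T i j k l) - f T)" for i k j l
  define g where "g i k j l = (if i \<noteq> k \<and> j \<noteq> l then h i k j l else 0)" for i k j l
  have g_sym: "g i k j l = g k i l j" for i k j l
    by (auto simp: g_def h_def flip_swap[of i k j l T])
  have "swap_op n n f T = (\<Sum>i<n. \<Sum>k<n. \<Sum>j<n. \<Sum>l<n.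
      real (T i j) * (real (T k l) - (if k = i \<and> l = j then 1 else 0)) * f T + g i k j l)"
    unfolding swap_op_eq swap_term g_def h_def ..
  also have "\<dots> = real n * (real n - 1) * f T + (\<Sum>i<n. \<Sum>k<n. \<Sum>j<n. \<Sum>l<n. g i k j l)"
    unfolding sum.distrib w[symmetric] sum_distrib_right ..
  also have "(\<Sum>i<n. \<Sum>k<n. \<Sum>j<n. \<Sum>l<n. g i k j l) =
      (\<Sum>i<n. \<Sum>k<n. \<Sum>j<n. \<Sum>l<n. if i \<noteq> k \<and> j \<noteq> l then g i k j l else 0)"
    by (intro sum.cong refl) (auto simp: g_def)
  also have "\<dots> = 2 * (\<Sum>i<n. \<Sum>k<n. \<Sum>j<n. \<Sum>l<n. if i < k \<and> j \<noteq> l then g i k j l else 0)"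
    by (rule sum_pairs_symmetric) (rule g_sym)
  also have "\<dots> = (\<Sum>i<n. \<Sum>k<n. \<Sum>j<n. \<Sum>l<n. if i < k \<and> j \<noteq> l
       then 2 * real (T i j) * real (T k l) * (f (flip T i j k l) - f T) else 0)"
    unfolding sum_distrib_left by (intro sum.cong refl) (auto simp: g_def h_def)
  finally show ?thesis .
qed

text \<open>Trades the sum over target tables for a sum over moves: a move of nonzero weight stays
  inside \<open>tables lam mu\<close>, so it is counted for exactly one target.\<close>

lemma rt_move_sum:
  assumes "length lam \<le> n" "length mu \<le> n" "sum_list lam = n" and T: "T \<in> tables lam mu"
  shows "(\<Sum>T'\<in>tables lam mu. rt_move lam mu T T' * g T') =
    (\<Sum>i<n. \<Sum>k<n. \<Sum>j<n. \<Sum>l<n. if i < k \<and> j \<noteq> l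
       then 2 * real (T i j) * real (T k l) * g (flip T i j k l) else 0) / (real n)\<^sup>2"
proof -
  let ?I = "{..<length lam} \<times> {..<length lam} \<times> {..<length mu} \<times> {..<length mu}"
  let ?J = "{..<n} \<times> {..<n} \<times> {..<n} \<times> {..<n}"
  have fin: "finite (tables lam mu)"
      using tables_eq_margin_tables[OF assms(1,2)] finite_margin_tables by simp
  define c where "c = (\<lambda>(i, k, j, l). if i < k \<and> j \<noteq> l then 2 * real (T i j)
      * real (T k l) / (real n)\<^sup>2 else 0)"
  define F where "F = (\<lambda>(i, k, j, l). flip T i j k l)"
  have "rt_move lam mu T T' = (\<Sum>x\<in>?I. if F x = T' then c x else 0)" for T'
    unfolding rt_move_def assms(3) sum.cartesian_product
    by (intro sum.cong refl) (auto simp: c_def F_def)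
  then have "(\<Sum>T'\<in>tables lam mu. rt_move lam mu T T' * g T') =
      (\<Sum>T'\<in>tables lam mu. \<Sum>x\<in>?I. if F x = T' then c x * g T' else 0)"
    by (simp add: sum_distrib_right if_distrib[of "\<lambda>x. x * _"] cong: if_cong)
  also have "\<dots> = (\<Sum>x\<in>?I. \<Sum>T'\<in>tables lam mu. if F x = T' then c x * g T' else 0)"
    by (rule sum.swap)
  also have "\<dots> = (\<Sum>x\<in>?I. c x * g (F x))"
  proof (rule sum.cong[OF refl])
    fix x assume x: "x \<in> ?I"
    have "F x \<in> tables lam mu" if "c x \<noteq> 0"
    proof -
      obtain i k j l where ijkl: "x = (i, k, j, l)" by (metis surj_pair)
      have *: "i < k" "j \<noteq> l" "0 < T i j" "0 < T k l" "i < n" "k < n" "j < n" "l < n"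
        using that x assms by (auto simp: c_def ijkl split: if_splits)
      then have "swap_cells i j k l T \<in> margin_tables n n (list_fun lam) (list_fun mu)"
        using T tables_eq_margin_tables[OF assms(1,2)] by (intro swap_cells_in_margin_tables)
            (auto simp: decr_def)
      then show ?thesis
        using * tables_eq_margin_tables[OF assms(1,2)] swap_cells_flip[of i k j l T] by
            (simp add: F_def ijkl)
    qed
    then show "(\<Sum>T'\<in>tables lam mu. if F x = T' then c x * g T' else 0) = c x * g (F x)"
      using fin by (cases "c x = 0") (auto simp: sum.neutral)
  qed
  \<comment> \<open>Cells outside the two margins are empty, so enlarging the index range adds only
    zero terms.\<close>
  also have "\<dots> = (\<Sum>x\<in>?J. c x * g (F x))"
  proof (rule sum.mono_neutral_left)
    show "\<forall>x\<in>?J - ?I. c x * g (F x) = 0"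
    proof
      fix x assume x: "x \<in> ?J - ?I"
      obtain i k j l where ijkl: "x = (i, k, j, l)" by (metis surj_pair)
      have "T i j = 0 \<or> T k l = 0" using x T by (auto simp: ijkl tables_def)
      then show "c x * g (F x) = 0" by (auto simp: c_def ijkl)
    qed
  qed (use assms in auto)
  also have "\<dots> = (\<Sum>i<n. \<Sum>k<n. \<Sum>j<n. \<Sum>l<n. c (i, k, j, l) * g (F (i, k, j, l)))"
    by (simp add: sum.cartesian_product case_prod_unfold)
  also have "\<dots> = (\<Sum>i<n. \<Sum>k<n. \<Sum>j<n. \<Sum>l<n. if i < k \<and> j \<noteq> l
       then 2 * real (T i j) * real (T k l) * g (flip T i j k l) else 0) / (real n)\<^sup>2"
    unfolding sum_divide_distrib by (intro sum.cong refl) (simp add: c_def F_def)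
  finally show ?thesis .
qed

lemma rt_chain_swap_op:
  assumes "n > 0" "is_partition n lam" "is_partition n mu" and T: "T \<in> tables lam mu"
  shows "(\<Sum>T'\<in>tables lam mu. rt_chain lam mu T T' * f T') =
    (real n * f T + swap_op n n f T) / (real n)\<^sup>2"
proof -
  have len: "length lam \<le> n" "length mu \<le> n"
    using list_fun_part_fun(2)[OF assms(2)] list_fun_part_fun(2)[OF assms(3)] .
  have n: "sum_list lam = n" using assms by (simp add: is_partition_def)
  have fin: "finite (tables lam mu)"
      using tables_eq_margin_tables[OF len] finite_margin_tables by simp
  have Tt: "T \<in> margin_tables n n (list_fun lam) (list_fun mu)"
      using T tables_eq_margin_tables[OF len] by simp
  have "sum (list_fun lam) {..<n} = n"
      using part_fun_sum[OF list_fun_part_fun(1)[OF assms(2)]] by simp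
  note swap = swap_op_flip[OF Tt this, of f]
  let ?mv = "rt_move lam mu T"
  have "(\<Sum>T'\<in>tables lam mu. rt_chain lam mu T T' * f T') =
    (1 - (\<Sum>T'\<in>tables lam mu - {T}. ?mv T')) * f T + (\<Sum>T'\<in>tables lam mu - {T}. ?mv T' * f T')"
    using sum.remove[OF fin T, of "\<lambda>T'. rt_chain lam mu T T' * f T'"] by (simp add: rt_chain_def)
  also have "\<dots> = f T + (\<Sum>T'\<in>tables lam mu - {T}. ?mv T' * (f T' - f T))"
    by (simp add: algebra_simps sum_subtractf sum_distrib_left)
  \<comment> \<open>The term for \<open>T' = T\<close> is zero, so the separate treatment of the
    diagonal in \<open>rt_chain\<close> disappears.\<close>
  also have "(\<Sum>T'\<in>tables lam mu - {T}. ?mv T' * (f T' - f T)) = (\<Sum>T'\<in>tables lam mu. ?mv T' * (f T'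
      - f T))"
    using sum.remove[OF fin T, of "\<lambda>T'. ?mv T' * (f T' - f T)"] by simp
  also have "\<dots> = (swap_op n n f T - real n * (real n - 1) * f T) / (real n)\<^sup>2"
    unfolding rt_move_sum[OF len n T] swap by simp
  also have "f T + \<dots> = (real n * f T + swap_op n n f T) / (real n)\<^sup>2"
    using assms(1) by (simp add: field_simps power2_eq_square)
  finally show ?thesis .
qed

section \<open>Reversibility with respect to the Fisher-Yates distribution\<close>

text \<open>For fixed margins the Fisher-Yates weight is a constant divided by this product.\<close>

definition fact_prod :: "nat \<Rightarrow> table \<Rightarrow> real" where
  "fact_prod n T = (\<Prod>i<n. \<Prod>j<n. fact (T i j))"

lemma fact_prod_decr:
  assumes "i < n" "j < n" "0 < T i j"
  shows "fact_prod n T = real (T i j) * fact_prod n (decr i j T)"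
proof -
  have split: "fact_prod n U = fact (U i j) * (\<Prod>j\<in>{..<n} - {j}. fact (U i j)) * (\<Prod>i\<in>{..<n}
      - {i}. \<Prod>j<n. fact (U i j))"
    for U
    unfolding fact_prod_def using assms
    by (subst prod.remove[of "{..<n}" i], simp, simp, subst prod.remove[of "{..<n}" j]) auto
  have "fact (T i j) = real (T i j) * fact (decr i j T i j)"
    using assms(3) by (simp add: decr_def fact_reduce)
  moreover have "(\<Prod>q\<in>{..<n} - {j}. fact (decr i j T i q)) = (\<Prod>q\<in>{..<n} - {j}. fact (T i q) :: real)"
    by (rule prod.cong) (auto simp: decr_def)
  moreover have "(\<Prod>p\<in>{..<n} - {i}. \<Prod>q<n. fact (decr i j T p q)) = (\<Prod>p\<in>{..<n}
      - {i}. \<Prod>q<n. fact (T p q) :: real)"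
    by (intro prod.cong refl) (auto simp: decr_def)
  ultimately show ?thesis unfolding split[of T] split[of "decr i j T"] by simp
qed

lemma fact_prod_pos: "0 < fact_prod n T"
  unfolding fact_prod_def by (intro prod_pos) auto

text \<open>Let \<open>U\<close> be the table with both balls removed. The move and its inverse,
  which has \<open>j\<close> and \<open>l\<close> interchanged, pass through the same
  \<open>U\<close>, and each weight divided by the \<open>fact_prod\<close> of its starting table
  equals \<open>1 / fact_prod n U\<close>.\<close>

lemma swap_cells_inverse:
  assumes "0 < T i j" "0 < decr i j T k l" "i < n" "k < n" "j < n" "l < n"
    and T': "T' = swap_cells i j k l T"
  shows "T = swap_cells i l k j T' \<and>
    real (T i j) * real (decr i j T k l) / fact_prod n T
      = real (T' i l) * real (decr i l T' k j) / fact_prod n T'"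
proof -
  define U where "U = decr k l (decr i j T)"
  have T: "T = incr i j (incr k l U)" using assms(1,2) by (simp add: U_def incr_decr)
  have T'1: "T' = incr i l (incr k j U)"
    unfolding T' swap_cells_def U_def[symmetric] by (rule incr_commute)
  have d1: "decr i l T' = incr k j U" unfolding T'1 by (rule decr_incr)
  have d2: "decr k j (decr i l T') = U" unfolding d1 by (rule decr_incr)
  have pos: "0 < T' i l" "0 < decr i l T' k j" unfolding d1 by (simp_all add: T'1 incr_def)
  have "swap_cells i l k j T' = incr k l (incr i j U)" by (simp add: swap_cells_def d2)
  then have 1: "T = swap_cells i l k j T'" using T incr_commute by simp
  have "fact_prod n T = real (T i j) * (real (decr i j T k l) * fact_prod n U)"
    using assms by (simp add: fact_prod_decr[of i n j T] fact_prod_decr[of k n l "decr i j T"] U_def)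
  then have 2: "real (T i j) * real (decr i j T k l) / fact_prod n T = 1 / fact_prod n U"
    using assms(1,2) by simp
  have "fact_prod n T' = real (T' i l) * (real (decr i l T' k j) * fact_prod n U)"
    using fact_prod_decr[of i n l T'] fact_prod_decr[of k n j "decr i l T'"] assms(3-6) pos d2 by simp
  then have 3: "real (T' i l) * real (decr i l T' k j) / fact_prod n T' = 1 / fact_prod n U"
    using pos by simp
  show ?thesis using 1 2 3 by simp
qed

lemma swap_op_reversible:
  "swap_op n n (point_fun T') T / fact_prod n T = swap_op n n (point_fun T) T' / fact_prod n T'"
proof -
  define q where "q i j k l T T' =
    (if T' = swap_cells i j k l T then real (T i j) * real (decr i j T k l) / fact_prod n T else 0)"
    for i j k l T T'
  have eq: "q i j k l T T' = q i l k j T' T" if "i < n" "k < n" "j < n" "l < n" for i j k l T T'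
  proof (cases "q i j k l T T' = 0")
    case False
    then show ?thesis using swap_cells_inverse[of T i j k l n T'] that
      by (auto simp: q_def split: if_splits)
  next
    case True
    show ?thesis
    proof (rule ccontr)
      assume neq: "q i j k l T T' \<noteq> q i l k j T' T"
      then have "q i l k j T' T \<noteq> 0" using True by simp
      then show False using swap_cells_inverse[of T' i l k j n T] that True neq
        by (auto simp: q_def split: if_splits)
    qed
  qed
  have sw: "swap_op n n (point_fun T') T / fact_prod n T = (\<Sum>i<n. \<Sum>k<n. \<Sum>j<n.
      \<Sum>l<n. q i j k l T T')" for T T'
    unfolding swap_op_eq sum_divide_distrib by (intro sum.cong refl)
        (auto simp: q_def point_fun_def)
  have "swap_op n n (point_fun T') T / fact_prod n T = (\<Sum>i<n. \<Sum>k<n. \<Sum>j<n. \<Sum>l<n. q i l k j T' T)"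
    unfolding sw by (intro sum.cong refl) (auto intro: eq)
  also have "\<dots> = (\<Sum>i<n. \<Sum>k<n. \<Sum>l<n. \<Sum>j<n. q i l k j T' T)"
    by (rule sum.cong[OF refl], rule sum.cong[OF refl], rule sum.swap)
  finally show ?thesis unfolding sw .
qed

lemma fisher_yates_fact_prod:
  assumes "length lam \<le> n" "length mu \<le> n" "T \<in> tables lam mu"
  shows "fisher_yates lam mu T =
    (\<Prod>i<length lam. fact (lam ! i))
        * (\<Prod>j<length mu. fact (mu ! j)) / fact (sum_list lam) / fact_prod n T"
proof -
  have "fact_prod n T = (\<Prod>i<length lam. \<Prod>j<n. fact (T i j))"
    unfolding fact_prod_def
    by (rule prod.mono_neutral_right) (use assms in \<open>auto simp: tables_def\<close>)
  also have "\<dots> = (\<Prod>i<length lam. \<Prod>j<length mu. fact (T i j))"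
    by (intro prod.cong refl prod.mono_neutral_right) (use assms in \<open>auto simp: tables_def\<close>)
  finally show ?thesis by (simp add: fisher_yates_def)
qed

lemma reversible_operator_swap_op:
  assumes "is_partition n lam" "is_partition n mu"
  shows "reversible_operator (tables lam mu) (fisher_yates lam mu) (swap_op n n)"
proof -
  have len: "length lam \<le> n" "length mu \<le> n" using assms list_fun_part_fun(2) by auto
  define C :: real where "C = (\<Prod>i<length lam. fact (lam ! i))
      * (\<Prod>j<length mu. fact (mu ! j)) / fact (sum_list lam)"
  have "0 < C" unfolding C_def by (intro divide_pos_pos mult_pos_pos prod_pos) auto
  have w: "fisher_yates lam mu T = C / fact_prod n T" if "T \<in> tables lam mu" for T
    using fisher_yates_fact_prod[OF len that] by (simp add: C_def)
  show ?thesis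
  proof
    show "finite (tables lam mu)" using tables_eq_margin_tables[OF len] finite_margin_tables by simp
    show "0 < fisher_yates lam mu T" if "T \<in> tables lam mu" for T
      using w[OF that] \<open>0 < C\<close> fact_prod_pos by simp
    show "has_kernel (swap_op n n) (tables lam mu) (tables lam mu)"
      unfolding tables_eq_margin_tables[OF len] by (rule has_kernel_swap_op)
    show "fisher_yates lam mu T * swap_op n n (point_fun T') T = fisher_yates lam mu T'
        * swap_op n n (point_fun T) T'"
      if "T \<in> tables lam mu" "T' \<in> tables lam mu" for T T'
      using swap_op_reversible[of n T' T] by
          (simp add: w that) (metis times_divide_eq_right mult.commute)
  qed
qed

section \<open>Semistandard tableaux as chains of horizontal strips\<close>

definition cells_fun :: "(nat \<Rightarrow> nat) \<Rightarrow> (nat \<times> nat) set" where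
  "cells_fun \<rho> = {(r, c). c < \<rho> r}"

lemma cells_fun_eq_Sigma: "(\<And>i. i \<ge> m \<Longrightarrow> \<rho> i = 0) \<Longrightarrow> cells_fun \<rho> = (SIGMA r:{..<m}. {..<\<rho> r})"
  by (auto simp: cells_fun_def) (metis leI less_nat_zero_code)

lemma finite_cells_fun: "\<rho> \<in> part_fun n \<Longrightarrow> finite (cells_fun \<rho>)"
  by (subst cells_fun_eq_Sigma[of n]) (auto simp: part_fun_zero)

lemma card_cells_fun: "(\<And>i. i \<ge> m \<Longrightarrow> \<rho> i = 0) \<Longrightarrow> card (cells_fun \<rho>) = sum \<rho> {..<m}"
  by (subst cells_fun_eq_Sigma[of m]) auto

definition ssyt_fun :: "nat \<Rightarrow> (nat \<Rightarrow> nat) \<Rightarrow> (nat \<Rightarrow> nat) \<Rightarrow> table set" where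
  "ssyt_fun l \<mu> \<rho> = {t. (\<forall>r c. \<rho> r \<le> c \<longrightarrow> t r c = 0) \<and>
     (\<forall>r c. c < \<rho> r \<longrightarrow> 1 \<le> t r c \<and> t r c \<le> l) \<and>
     (\<forall>r c. Suc c < \<rho> r \<longrightarrow> t r c \<le> t r (Suc c)) \<and>
     (\<forall>r c. c < \<rho> r \<and> c < \<rho> (Suc r) \<longrightarrow> t r c < t (Suc r) c) \<and>
     (\<forall>s\<in>{1..l}. card {x \<in> cells_fun \<rho>. t (fst x) (snd x) = s} = \<mu> (s - 1))}"

lemma ssyt_fun_row_mono:
  assumes "t \<in> ssyt_fun l \<mu> \<rho>" "c \<le> c'" "c' < \<rho> r"
  shows "t r c \<le> t r c'"
  using assms(2,3)
proof (induction c' rule: dec_induct)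
  case (step c')
  then have "t r c' \<le> t r (Suc c')" using assms(1) by (auto simp: ssyt_fun_def)
  then show ?case using step by simp
qed simp

text \<open>Restores the cells of the largest symbol \<open>s\<close>; \<open>small_shape\<close>
  and \<open>small_part\<close> are the inverse direction, which removes them.\<close>

definition add_strip :: "nat \<Rightarrow> (nat \<Rightarrow> nat) \<Rightarrow> (nat \<Rightarrow> nat) \<Rightarrow> table \<Rightarrow> table" where
  "add_strip s \<rho> \<sigma> t = (\<lambda>r c. if c < \<sigma> r then t r c else if c < \<rho> r then s else 0)"

definition small_shape :: "nat \<Rightarrow> (nat \<Rightarrow> nat) \<Rightarrow> table \<Rightarrow> nat \<Rightarrow> nat" where
  "small_shape l \<rho> t = (\<lambda>r. card {c. c < \<rho> r \<and> t r c \<le> l})"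

definition small_part :: "nat \<Rightarrow> table \<Rightarrow> table" where
  "small_part l t = (\<lambda>r c. if t r c \<le> l then t r c else 0)"

text \<open>Columns stay strict because the cell above any cell of \<rho> already lies in \<sigma>
  and carries an entry at most \<open>l\<close>. The number of new entries is the difference of the
  two sizes.\<close>

lemma add_strip_in_ssyt_fun:
  assumes \<sigma>: "\<sigma> \<in> part_fun (sum \<mu> {..<l})" "interlaces \<sigma> \<rho>" and \<rho>: "\<rho> \<in> part_fun (sum \<mu> {..<Suc l})"
    and t: "t \<in> ssyt_fun l \<mu> \<sigma>"
  shows "add_strip (Suc l) \<rho> \<sigma> t \<in> ssyt_fun (Suc l) \<mu> \<rho>"
proof -
  let ?t = "add_strip (Suc l) \<rho> \<sigma> t"
  define m where "m = sum \<mu> {..<Suc l}"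
  have le: "\<sigma> r \<le> \<rho> r" "\<rho> (Suc r) \<le> \<sigma> r" for r using \<sigma>(2) by (auto simp: interlaces_def)
  have bnd: "1 \<le> t r c" "t r c \<le> l" if "c < \<sigma> r" for r c using t that by (auto simp: ssyt_fun_def)
  have "card {x \<in> cells_fun \<rho>. ?t (fst x) (snd x) = s} = \<mu> (s - 1)" if s: "s \<in> {1..Suc l}" for s
  proof (cases "s = Suc l")
    case False
    then have "{x \<in> cells_fun \<rho>. ?t (fst x) (snd x) = s} = {x \<in> cells_fun \<sigma>. t (fst x) (snd x) = s}"
      using s le(1) by (auto simp: cells_fun_def add_strip_def intro: less_le_trans)
    then show ?thesis using t s False by (auto simp: ssyt_fun_def)
  next
    case True
    have sub: "cells_fun \<sigma> \<subseteq> cells_fun \<rho>" using le(1) by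
        (auto simp: cells_fun_def intro: less_le_trans)
    have z: "\<rho> i = 0" "\<sigma> i = 0" if "m \<le> i" for i
      using part_fun_zero[OF \<rho>, of i] le(1)[of i] that by (auto simp: m_def)
    have "{x \<in> cells_fun \<rho>. ?t (fst x) (snd x) = s} = cells_fun \<rho> - cells_fun \<sigma>"
      using True bnd(2) by (force simp: cells_fun_def add_strip_def split: if_splits)
    then have "card {x \<in> cells_fun \<rho>. ?t (fst x) (snd x) = s} = card (cells_fun \<rho>)
        - card (cells_fun \<sigma>)"
      using card_Diff_subset[OF finite_cells_fun[OF \<sigma>(1)] sub] by simp
    also have "card (cells_fun \<rho>) = m" using card_cells_fun[OF z(1)] part_fun_sum[OF \<rho>, of m] by
        (simp add: m_def)
    also have "card (cells_fun \<sigma>) = sum \<mu> {..<l}"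
      using card_cells_fun[OF z(2)] part_fun_sum[OF \<sigma>(1), of m] by (simp add: m_def)
    finally show ?thesis using True by (simp add: m_def)
  qed
  moreover have "?t r c \<le> ?t r (Suc c)" if "Suc c < \<rho> r" for r c
  proof (cases "Suc c < \<sigma> r")
    case True
    then show ?thesis using t by (auto simp: ssyt_fun_def add_strip_def)
  next
    case False
    then show ?thesis using that bnd(2)[of c r] by (auto simp: add_strip_def)
  qed
  moreover have "?t r c < ?t (Suc r) c" if "c < \<rho> (Suc r)" for r c
  proof -
    have c: "c < \<sigma> r" using that le(2)[of r] by simp
    then have "c < \<sigma> (Suc r) \<longrightarrow> t r c < t (Suc r) c" using t by (auto simp: ssyt_fun_def)
    then show ?thesis using c that bnd(2)[OF c] by (auto simp: add_strip_def)
  qed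
  moreover have "1 \<le> ?t r c \<and> ?t r c \<le> Suc l" if "c < \<rho> r" for r c
    using that bnd[of c r] by (auto simp: add_strip_def)
  moreover have "?t r c = 0" if "\<rho> r \<le> c" for r c
    using that le(1)[of r] by (simp add: add_strip_def)
  ultimately show ?thesis unfolding ssyt_fun_def by blast
qed

text \<open>Rows weakly increase, so the cells with entries at most \<open>l\<close> form an initial
  segment of the row, and counting them gives its length.\<close>

lemma less_small_shape_iff:
  assumes "t \<in> ssyt_fun (Suc l) \<mu> \<rho>"
  shows "c < small_shape l \<rho> t r \<longleftrightarrow> c < \<rho> r \<and> t r c \<le> l"
proof -
  define A where "A = {c. c < \<rho> r \<and> t r c \<le> l}"
  have fin: "finite A" by (rule finite_subset[of _ "{..<\<rho> r}"]) (auto simp: A_def)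
  have down: "c \<in> A" if "c' \<in> A" "c \<le> c'" for c c'
    using that ssyt_fun_row_mono[OF assms, of c c' r] by (auto simp: A_def)
  have "A = {..<card A}"
  proof (rule ccontr)
    assume "A \<noteq> {..<card A}"
    then have "\<not> A \<subseteq> {..<card A}" using card_subset_eq[of "{..<card A}" A] by auto
    then obtain a where "a \<in> A" "card A \<le> a" by (meson lessThan_iff not_less subsetI)
    then have "{..card A} \<subseteq> A" using down by auto
    then have "card {..card A} \<le> card A" by (rule card_mono[OF fin])
    then show False by simp
  qed
  then have "c \<in> A \<longleftrightarrow> c < card A" by (metis lessThan_iff)
  then show ?thesis by (simp add: A_def small_shape_def)
qed

lemma small_part_in_ssyt_fun:
  assumes \<rho>: "\<rho> \<in> part_fun (sum \<mu> {..<Suc l})" and t: "t \<in> ssyt_fun (Suc l) \<mu> \<rho>"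
  defines "\<sigma> \<equiv> small_shape l \<rho> t"
  shows "\<sigma> \<in> part_fun (sum \<mu> {..<l})" "interlaces \<sigma> \<rho>" "small_part l t \<in> ssyt_fun l \<mu> \<sigma>"
proof -
  note iff = less_small_shape_iff[OF t, folded \<sigma>_def]
  have bnd: "1 \<le> t r c" "t r c \<le> Suc l" if "c < \<rho> r" for r c using t that by
      (auto simp: ssyt_fun_def)
  have "\<rho> (Suc r) \<le> \<sigma> r" for r
  proof (rule ccontr)
    \<comment> \<open>Then the cell \<open>(r, \<sigma> r)\<close> holds \<open>Suc l\<close>, and
      the cell of \<rho> below it would need a still larger entry.\<close>
    assume "\<not> \<rho> (Suc r) \<le> \<sigma> r"
    then have "\<sigma> r < \<rho> (Suc r)" by simp
    moreover have "\<rho> (Suc r) \<le> \<rho> r" using part_fun_antimono[OF \<rho>] by simp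
    ultimately have "t r (\<sigma> r) < t (Suc r) (\<sigma> r)" "\<sigma> r < \<rho> r" using t by (auto simp: ssyt_fun_def)
    then show False using bnd(2)[OF \<open>\<sigma> r < \<rho> (Suc r)\<close>] iff[of "\<sigma> r" r] by simp
  qed
  moreover have "\<sigma> r \<le> \<rho> r" for r using iff[of _ r] by (meson leI less_irrefl)
  ultimately show int: "interlaces \<sigma> \<rho>" by (simp add: interlaces_def)
  define m where "m = sum \<mu> {..<Suc l}"
  have z: "\<sigma> i = 0" if "m \<le> i" for i
    using part_fun_zero[OF \<rho>, of i] int that by (auto simp: m_def interlaces_def) (metis le_zero_eq)
  have count: "{x \<in> cells_fun \<sigma>. small_part l t (fst x) (snd x) = s}
      = {x \<in> cells_fun \<rho>. t (fst x) (snd x) = s}"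
    if "s \<in> {1..l}" for s
    using that by (auto simp: cells_fun_def iff small_part_def)
  have counts: "card {x \<in> cells_fun \<rho>. t (fst x) (snd x) = s} = \<mu> (s - 1)" if "s \<in> {1..l}" for s
    using t that by (auto simp: ssyt_fun_def)
  have "cells_fun \<sigma> = (\<Union>s\<in>{1..l}. {x \<in> cells_fun \<rho>. t (fst x) (snd x) = s})"
    using bnd by (auto simp: cells_fun_def iff)
  then have "card (cells_fun \<sigma>) = (\<Sum>s\<in>{1..l}. card {x \<in> cells_fun \<rho>. t (fst x) (snd x) = s})"
    using finite_cells_fun[OF \<rho>] by (simp only:) (rule card_UN_disjoint, auto)
  also have "\<dots> = (\<Sum>s\<in>{1..l}. \<mu> (s - 1))" using counts by simp
  also have "\<dots> = sum \<mu> {..<l}"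
    by (rule sum.reindex_bij_witness[of _ Suc "\<lambda>s. s - 1"]) auto
  finally have "sum \<sigma> {..<m} = sum \<mu> {..<l}" using card_cells_fun[OF z] by simp
  then show "\<sigma> \<in> part_fun (sum \<mu> {..<l})"
    by (rule ParI[rotated 2]) (use int z in \<open>auto simp: interlaces_def intro: order_trans\<close>)
  show "small_part l t \<in> ssyt_fun l \<mu> \<sigma>"
    unfolding ssyt_fun_def
  proof (intro CollectI conjI allI impI ballI)
    show "small_part l t r c = 0" if "\<sigma> r \<le> c" for r c
    proof (cases "c < \<rho> r")
      case True
      then show ?thesis using iff[of c r] that by (simp add: small_part_def)
    next
      case False
      then show ?thesis using t by (auto simp: small_part_def ssyt_fun_def)
    qed
    show "1 \<le> small_part l t r c" "small_part l t r c \<le> l" if "c < \<sigma> r" for r c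
      using that bnd by (auto simp: iff small_part_def)
    show "small_part l t r c \<le> small_part l t r (Suc c)" if "Suc c < \<sigma> r" for r c
      using that ssyt_fun_row_mono[OF t, of c "Suc c" r] by (auto simp: iff small_part_def)
    show "small_part l t r c < small_part l t (Suc r) c" if "c < \<sigma> r \<and> c < \<sigma> (Suc r)" for r c
      using that t by (auto simp: iff small_part_def ssyt_fun_def)
    show "card {x \<in> cells_fun \<sigma>. small_part l t (fst x) (snd x) = s} = \<mu> (s - 1)" if "s \<in> {1..l}"
        for s
      using that count counts by simp
  qed
qed

text \<open>The cells with the largest symbol form the last horizontal strip of the chain.
  Finiteness is carried through the induction because the cardinality of the union over smaller
  shapes depends on it.\<close>

lemma card_ssyt_fun:
  assumes "\<rho> \<in> part_fun (sum \<mu> {..<l})"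
  shows "finite (ssyt_fun l \<mu> \<rho>) \<and> card (ssyt_fun l \<mu> \<rho>) = kostka_count \<mu> l \<rho>"
  using assms
proof (induction l arbitrary: \<rho>)
  case 0
  then have "\<rho> = (\<lambda>_. 0)" by (simp add: part_fun_0)
  moreover have "ssyt_fun 0 \<mu> (\<lambda>_. 0) = {\<lambda>_ _. 0}" by (auto simp: ssyt_fun_def)
  ultimately show ?case by simp
next
  case (Suc l)
  define A where "A = {\<sigma> \<in> part_fun (sum \<mu> {..<l}). interlaces \<sigma> \<rho>}"
  have bij: "bij_betw (\<lambda>(\<sigma>, t). add_strip (Suc l) \<rho> \<sigma> t) (SIGMA \<sigma>:A. ssyt_fun l \<mu> \<sigma>) (ssyt_fun (Suc l) \<mu> \<rho>)"
  proof (rule bij_betw_byWitness[where f' = "\<lambda>t. (small_shape l \<rho> t, small_part l t)"])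
    show "\<forall>p\<in>SIGMA \<sigma>:A. ssyt_fun l \<mu> \<sigma>. (small_shape l \<rho> (case p of (\<sigma>, t) \<Rightarrow> add_strip (Suc l) \<rho> \<sigma> t),
        small_part l (case p of (\<sigma>, t) \<Rightarrow> add_strip (Suc l) \<rho> \<sigma> t)) = p"
    proof
      fix p assume "p \<in> (SIGMA \<sigma>:A. ssyt_fun l \<mu> \<sigma>)"
      then obtain \<sigma> t where p: "p = (\<sigma>, t)" and "\<sigma> \<in> A" and t: "t \<in> ssyt_fun l \<mu> \<sigma>" by auto
      then have le: "\<sigma> r \<le> \<rho> r" for r by (auto simp: A_def interlaces_def)
      have bnd: "t r c \<le> l" if "c < \<sigma> r" for r c using t that by (auto simp: ssyt_fun_def)
      have "{c. c < \<rho> r \<and> add_strip (Suc l) \<rho> \<sigma> t r c \<le> l} = {..<\<sigma> r}" for r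
        using bnd le[of r] by (auto simp: add_strip_def split: if_splits)
      then have "small_shape l \<rho> (add_strip (Suc l) \<rho> \<sigma> t) = \<sigma>" by (simp add: small_shape_def)
      moreover have "small_part l (add_strip (Suc l) \<rho> \<sigma> t) = t"
        using t bnd by (auto simp: fun_eq_iff small_part_def add_strip_def ssyt_fun_def)
      ultimately show "(small_shape l \<rho> (case p of (\<sigma>, t) \<Rightarrow> add_strip (Suc l) \<rho> \<sigma> t),
        small_part l (case p of (\<sigma>, t) \<Rightarrow> add_strip (Suc l) \<rho> \<sigma> t)) = p" by (simp add: p)
    qed
    show "\<forall>t\<in>ssyt_fun (Suc l) \<mu> \<rho>. (case (small_shape l \<rho> t, small_part l t) of (\<sigma>, t) \<Rightarrow> add_strip (Suc l) \<rho> \<sigma> t) = t"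
    proof
      fix t assume t: "t \<in> ssyt_fun (Suc l) \<mu> \<rho>"
      have "t r c \<le> Suc l" "\<not> c < \<rho> r \<Longrightarrow> t r c = 0" for r c
        using t by (cases "c < \<rho> r"; auto simp: ssyt_fun_def)+
      then have "add_strip (Suc l) \<rho> (small_shape l \<rho> t) (small_part l t) r c = t r c" for r c
        by (cases "c < \<rho> r"; cases "t r c \<le> l")
          (auto simp: add_strip_def small_part_def less_small_shape_iff[OF t] intro: antisym)
      then show "(case (small_shape l \<rho> t, small_part l t) of (\<sigma>, t) \<Rightarrow> add_strip (Suc l) \<rho> \<sigma> t) = t"
        by (simp add: fun_eq_iff)
    qed
    show "(\<lambda>(\<sigma>, t). add_strip (Suc l) \<rho> \<sigma> t) ` (SIGMA \<sigma>:A. ssyt_fun l \<mu> \<sigma>) \<subseteq> ssyt_fun (Suc l) \<mu> \<rho>"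
      using add_strip_in_ssyt_fun Suc.prems by (auto simp: A_def)
    show "(\<lambda>t. (small_shape l \<rho> t, small_part l t)) ` ssyt_fun (Suc l) \<mu> \<rho>
        \<subseteq> (SIGMA \<sigma>:A. ssyt_fun l \<mu> \<sigma>)"
      using small_part_in_ssyt_fun[OF Suc.prems] by (auto simp: A_def)
  qed
  have fin: "finite A" "\<And>\<sigma>. \<sigma> \<in> A \<Longrightarrow> finite (ssyt_fun l \<mu> \<sigma>)"
    using finite_part_fun Suc.IH by (auto simp: A_def)
  have "card (ssyt_fun (Suc l) \<mu> \<rho>) = card (SIGMA \<sigma>:A. ssyt_fun l \<mu> \<sigma>)"
    using bij_betw_same_card[OF bij] by simp
  also have "\<dots> = (\<Sum>\<sigma>\<in>A. card (ssyt_fun l \<mu> \<sigma>))" using fin by (simp add: card_SigmaI)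
  also have "\<dots> = (\<Sum>\<sigma>\<in>A. kostka_count \<mu> l \<sigma>)" using Suc.IH by (simp add: A_def)
  also have "\<dots> = kostka_count \<mu> (Suc l) \<rho>" by (simp add: A_def)
  finally show ?case using bij_betw_finite[OF bij] fin by auto
qed

lemma interlaces_same_size:
  assumes "interlaces \<sigma> \<rho>" "\<sigma> \<in> part_fun s" "\<rho> \<in> part_fun s"
  shows "\<sigma> = \<rho>"
proof (rule ccontr)
  assume "\<sigma> \<noteq> \<rho>"
  then obtain i where i: "\<sigma> i \<noteq> \<rho> i" by auto
  then have "i < s" using part_fun_zero[OF assms(2)] part_fun_zero[OF assms(3)] by (metis not_le)
  then have "sum \<sigma> {..<s} < sum \<rho> {..<s}"
    using assms(1) i by (intro sum_strict_mono_ex1)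
        (auto simp: interlaces_def le_neq_implies_less intro!: bexI[of _ i])
  then show False using part_fun_sum[OF assms(2)] part_fun_sum[OF assms(3)] by simp
qed

text \<open>Zero parts add empty strips, since interlacing shapes of equal size coincide. This links
  contents of length \<open>length lam\<close> with the uniform length \<open>n\<close> of the trace
  formula.\<close>

lemma kostka_count_pad:
  assumes "\<And>i. l \<le> i \<Longrightarrow> \<mu> i = 0" "\<rho> \<in> part_fun (sum \<mu> {..<l})"
  shows "kostka_count \<mu> (l + d) \<rho> = kostka_count \<mu> l \<rho>"
proof (induction d)
  case (Suc d)
  have "sum \<mu> {..<l + d} = sum \<mu> {..<l}"
    by (rule sum_lessThan_zero_tail) (use assms in auto)
  moreover have "interlaces \<rho> \<rho>" using part_fun_antimono[OF assms(2)] by (simp add: interlaces_def)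
  ultimately have "{\<sigma>. \<sigma> \<in> part_fun (sum \<mu> {..<l + d}) \<and> interlaces \<sigma> \<rho>} = {\<rho>}"
    using interlaces_same_size assms(2) by auto
  then show ?case using Suc by simp
qed simp

lemma kostka_kostka_count:
  assumes "is_partition n \<rho>" "is_partition n lam"
  shows "kostka \<rho> lam = kostka_count (list_fun lam) n (list_fun \<rho>)"
proof -
  have cells: "cells \<rho> = cells_fun (list_fun \<rho>)" by
      (auto simp: cells_def cells_fun_def list_fun_def split: if_splits)
  have "(\<forall>s\<in>{1..length lam}. card {x \<in> cells_fun (list_fun \<rho>). t (fst x) (snd x) = s} = lam ! (s
      - 1)) \<longleftrightarrow>
    (\<forall>s\<in>{1..length lam}. card {x \<in> cells_fun (list_fun \<rho>). t (fst x) (snd x) = s}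
        = list_fun lam (s - 1))" for t :: table
    by (rule ball_cong) (auto simp: list_fun_def)
  then have "ssyt \<rho> lam = ssyt_fun (length lam) (list_fun lam) (list_fun \<rho>)"
    unfolding ssyt_def ssyt_fun_def cells by (auto simp: cells_fun_def not_less)
  moreover have s: "sum (list_fun lam) {..<length lam} = n"
  proof -
    have "sum (list_fun lam) {..<length lam} = sum (list_fun lam) {..<n}"
      by (rule sum_lessThan_zero_tail[symmetric]) (use list_fun_part_fun(2)[OF assms(2)] in \<open>auto simp: list_fun_def\<close>)
    then show ?thesis using part_fun_sum[OF list_fun_part_fun(1)[OF assms(2)]] by simp
  qed
  moreover have "kostka_count (list_fun lam) (length lam + (n - length lam)) (list_fun \<rho>)
      = kostka_count (list_fun lam) (length lam) (list_fun \<rho>)"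
    by (rule kostka_count_pad) (use list_fun_part_fun(1)[OF assms(1)] s in \<open>auto simp: list_fun_def\<close>)
  ultimately show ?thesis
    using card_ssyt_fun[of "list_fun \<rho>" "list_fun lam" "length lam"] list_fun_part_fun[OF assms(1)] list_fun_part_fun(2)[OF assms(2)]
    by (simp add: kostka_def)
qed

lemma bij_betw_list_fun: "bij_betw list_fun (partitions n) (part_fun n)"
  unfolding bij_betw_def
proof
  show "inj_on list_fun (partitions n)"
  proof (rule inj_onI)
    fix xs ys assume "xs \<in> partitions n" "ys \<in> partitions n" and eq: "list_fun xs = list_fun ys"
    then have nz: "0 \<notin> set xs" "0 \<notin> set ys" by (auto simp: partitions_def is_partition_def)
    have iff: "list_fun zs i = 0 \<longleftrightarrow> length zs \<le> i" if "0 \<notin> set zs" for zs i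
      using that by (auto simp: list_fun_def not_le) (metis gr0I nth_mem)
    have len: "length xs = length ys"
      using iff[OF nz(1), of "length ys"] iff[OF nz(2), of "length xs"] iff[OF nz(1), of "length xs"]
        iff[OF nz(2), of "length ys"] eq by simp
    moreover have "xs ! i = ys ! i" if "i < length xs" for i
      using fun_cong[OF eq, of i] that len by (simp add: list_fun_def)
    ultimately show "xs = ys" by (rule nth_equalityI)
  qed
  show "list_fun ` partitions n = part_fun n"
  proof (intro equalityI subsetI)
    show "f \<in> part_fun n" if "f \<in> list_fun ` partitions n" for f
      using that list_fun_part_fun(1) by (auto simp: partitions_def)
    fix f assume f: "f \<in> part_fun n"
    define l where "l = (LEAST i. f i = 0)"
    have l0: "f l = 0" unfolding l_def by (rule LeastI[of _ n]) (use part_fun_zero[OF f] in simp)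
    have pos: "f i \<noteq> 0" if "i < l" for i using not_less_Least[of i "\<lambda>i. f i = 0"] that by
        (simp add: l_def)
    have z: "f i = 0" if "l \<le> i" for i using part_fun_antimono[OF f that] l0 by simp
    have "l \<le> n" unfolding l_def by (rule Least_le) (use part_fun_zero[OF f] in simp)
    have "list_fun (map f [0..<l]) = f" using z by (auto simp: list_fun_def fun_eq_iff)
    moreover have "is_partition n (map f [0..<l])"
    proof -
      have "sum f {..<l} = n"
        using sum_lessThan_zero_tail[of l f n, OF z \<open>l \<le> n\<close>] part_fun_sum[OF f] by simp
      then have "sum_list (map f [0..<l]) = n"
        by (simp add: interv_sum_list_conv_sum_set_nat lessThan_atLeast0)
      moreover have "sorted_wrt (\<ge>) (map f [0..<l])"
        using part_fun_antimono[OF f] by (simp add: sorted_wrt_iff_nth_less)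
      moreover have "0 \<notin> set (map f [0..<l])" using pos
          by (metis (no_types, lifting) atLeastLessThan_iff imageE set_map set_upt)
      ultimately show ?thesis by (simp add: is_partition_def)
    qed
    ultimately show "f \<in> list_fun ` partitions n" unfolding partitions_def
        by (metis imageI mem_Collect_eq)
  qed
qed

text \<open>With \<open>i = j - 1\<close>, each summand of \<open>beta\<close> equals
  \<open>\<rho> i * (\<rho> i - 1 - 2 * i)\<close>.\<close>

lemma beta_content:
  assumes "n > 0" "is_partition n \<rho>"
  shows "beta n \<rho> = (real n + content_sum n (list_fun \<rho>)) / (real n)\<^sup>2"
proof -
  have "content_sum n (list_fun \<rho>) = (\<Sum>i<length \<rho>. real (list_fun \<rho> i) * (real (list_fun \<rho> i) - 1
      - 2 * real i))"
    unfolding content_sum_def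
    by (rule sum_lessThan_zero_tail) (use list_fun_part_fun(2)[OF assms(2)] in \<open>auto simp: list_fun_def\<close>)
  also have "\<dots> = (\<Sum>j = 1..length \<rho>. (real (\<rho> ! (j - 1)) - real j) * (real (\<rho> ! (j - 1)) - real j
      + 1)
                           - real j * (real j - 1))"
    by (rule sum.reindex_bij_witness[of _ "\<lambda>j. j - 1" Suc]) (auto simp: list_fun_def algebra_simps)
  finally show ?thesis using assms(1) by (simp add: beta_def field_simps power2_eq_square)
qed

section \<open>Polynomial interpolation on finite sets of tables\<close>

text \<open>Lagrange interpolation: each \<open>T1\<close> in \<open>S\<close> differs from
  \<open>T0\<close> in some cell, and the entry of that cell provides an affine factor that is 1 at
  \<open>T0\<close> and 0 at \<open>T1\<close>.\<close>

lemma poly_fun_prod_indicator: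
  assumes "finite S" "T0 \<notin> S"
  shows "\<exists>q. poly_fun q \<and> q T0 = 1 \<and> (\<forall>T\<in>S. q T = 0)"
  using assms
proof (induction S)
  case empty
  show ?case by (rule exI[of _ "\<lambda>T. 1"]) (simp add: poly_fun.const)
next
  case (insert T1 S)
  then obtain q where q: "poly_fun q" "q T0 = 1" "\<forall>T\<in>S. q T = 0" by auto
  from insert obtain i j where ij: "T0 i j \<noteq> T1 i j" by (auto simp: fun_eq_iff)
  define a where "a = 1 / (real (T0 i j) - real (T1 i j))"
  let ?q = "\<lambda>T. (a * real (T i j) + - a * real (T1 i j)) * q T"
  have "poly_fun ?q" by (intro poly_fun.mult poly_fun.add poly_fun.const poly_fun.var q)
  moreover have "?q T0 = 1"
  proof -
    have "a * real (T0 i j) + - a * real (T1 i j) = a * (real (T0 i j) - real (T1 i j))"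
      by (simp add: algebra_simps)
    also have "\<dots> = 1" using ij by (simp add: a_def)
    finally show ?thesis using q by simp
  qed
  ultimately show ?case using q by (intro exI[of _ ?q]) auto
qed

lemma poly_fun_interpolation:
  assumes "finite S"
  shows "\<exists>p. poly_fun p \<and> (\<forall>T\<in>S. p T = g T)"
  using assms
proof (induction S)
  case empty
  show ?case using poly_fun.const by auto
next
  case (insert T0 S)
  then obtain p where p: "poly_fun p" "\<forall>T\<in>S. p T = g T" by auto
  obtain q where q: "poly_fun q" "q T0 = 1" "\<forall>T\<in>S. q T = 0"
    using poly_fun_prod_indicator insert.hyps by blast
  have "poly_fun (\<lambda>T. p T + (g T0 - p T0) * q T)"
    by (intro poly_fun.add poly_fun.mult poly_fun.const p q)
  then show ?case using p q by (intro exI[of _ "\<lambda>T. p T + (g T0 - p T0) * q T"]) auto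
qed

section \<open>The spectrum of the chain\<close>

context weighted_set
begin

text \<open>A complex eigenfunction has a nonzero coordinate \<open>a k\<close> in the real
  eigenbasis, and comparing this coordinate on both sides of the eigenvalue equation identifies
  \<open>c\<close>. This excludes non-real eigenvalues.\<close>

lemma complex_eigenvalue_of_orthogonal_eigenbasis:
  assumes f: "orthogonal_family (card S) f"
    and eig: "\<And>k T. k < card S \<Longrightarrow> T \<in> S \<Longrightarrow> (\<Sum>T'\<in>S. p T T' * f k T') = e k * f k T"
    and g: "\<exists>T\<in>S. g T \<noteq> 0"
    and c: "\<And>T. T \<in> S \<Longrightarrow> (\<Sum>T'\<in>S. complex_of_real (p T T') * g T') = c * g T"
  shows "\<exists>k<card S. c = complex_of_real (e k)"
proof -
  define a where "a k = (\<Sum>T\<in>S. complex_of_real (w T * f k T) * g T)" for k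
  define b where "b k = a k / complex_of_real (inner_prod (f k) (f k))" for k
  have norm: "inner_prod (f k) (f k) \<noteq> 0" if "k < card S" for k
    using orthogonal_family_norm[OF f that] by simp
  have expand: "g T = (\<Sum>k<card S. b k * complex_of_real (f k T))" if T: "T \<in> S" for T
  proof -
    have "(\<Sum>k<card S. b k * complex_of_real (f k T)) =
      (\<Sum>k<card S. \<Sum>T'\<in>S. complex_of_real (w T' * f k T' / inner_prod (f k) (f k) * f k T) * g T')"
      by (simp add: b_def a_def sum_divide_distrib sum_distrib_right sum_distrib_left field_simps)
    also have "\<dots> = (\<Sum>T'\<in>S. complex_of_real (\<Sum>k<card S. w T' * f k T' / inner_prod (f k) (f k)
        * f k T) * g T')"
      by (subst sum.swap) (simp add: sum_distrib_right)
    also have "\<dots> = (\<Sum>T'\<in>S. if T = T' then g T' else 0)"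
      by (rule sum.cong[OF refl], subst orthogonal_basis_complete[OF f])
        (use T in \<open>auto simp: point_fun_def\<close>)
    finally show ?thesis using T fin by simp
  qed
  have "\<exists>k<card S. a k \<noteq> 0"
  proof (rule ccontr)
    assume "\<not> ?thesis"
    then have "g T = 0" if "T \<in> S" for T using expand[OF that] by (simp add: b_def)
    then show False using g by auto
  qed
  then obtain k where k: "k < card S" "a k \<noteq> 0" by auto
  have "c * a k = (\<Sum>T\<in>S. complex_of_real (w T * f k T) * (\<Sum>T'\<in>S. complex_of_real (p T T') * g T'))"
    unfolding a_def sum_distrib_left[of c] by (rule sum.cong[OF refl], subst c) simp_all
  also have "\<dots> = (\<Sum>T\<in>S. complex_of_real (w T * f k T) * (\<Sum>j<card S. b j * complex_of_real (e j
      * f j T)))"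
  proof (intro sum.cong refl arg_cong[of _ _ "(*) _"])
    fix T assume T: "T \<in> S"
    have "(\<Sum>T'\<in>S. complex_of_real (p T T') * g T') =
      (\<Sum>T'\<in>S. \<Sum>j<card S. b j * complex_of_real (p T T' * f j T'))"
      by (intro sum.cong refl) (simp add: expand sum_distrib_left mult_ac)
    also have "\<dots> = (\<Sum>j<card S. b j * complex_of_real (\<Sum>T'\<in>S. p T T' * f j T'))"
      by (subst sum.swap) (simp add: sum_distrib_left)
    also have "\<dots> = (\<Sum>j<card S. b j * complex_of_real (e j * f j T))"
      using eig T by (intro sum.cong refl) simp
    finally show "(\<Sum>T'\<in>S. complex_of_real (p T T') * g T') = (\<Sum>j<card S. b j
        * complex_of_real (e j * f j T))" .
  qed
  also have "\<dots> = (\<Sum>j<card S. b j * complex_of_real (e j * inner_prod (f k) (f j)))"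
    unfolding inner_prod_def sum_distrib_left of_real_sum by (subst sum.swap) (simp add: mult_ac)
  also have "\<dots> = (\<Sum>j<card S. if j = k then complex_of_real (e k) * a k else 0)"
    using f k norm[OF k(1)] by (intro sum.cong refl) (auto simp: orthogonal_family_def b_def)
  finally have "c * a k = complex_of_real (e k) * a k" using k by simp
  then show ?thesis using k by auto
qed

end

theorem theorem1p1:
  fixes lam mu :: "nat list" and n :: nat
  assumes "n > 0" and "is_partition n lam" and "is_partition n mu"
  shows
    "(\<forall>(c::complex) (f::table \<Rightarrow> complex).
        (\<exists>T\<in>tables lam mu. f T \<noteq> 0) \<and>
        (\<forall>T\<in>tables lam mu. (\<Sum>T'\<in>tables lam mu. of_real (rt_chain lam mu T T') * f T') = c * f T)
        \<longrightarrow> (\<exists>\<rho>. is_partition n \<rho> \<and> c = of_real (beta n \<rho>)))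
   \<and> (\<forall>xs. distinct xs \<and> set xs = tables lam mu \<longrightarrow>
        char_poly (mat (length xs) (length xs) (\<lambda>(a, b). rt_chain lam mu (xs ! a) (xs ! b)))
        = (\<Prod>\<rho>\<in>partitions n. [:- beta n \<rho>, 1:] ^ (kostka \<rho> lam * kostka \<rho> mu)))
   \<and> (\<exists>fs :: nat \<Rightarrow> table \<Rightarrow> real.
        (\<forall>k < card (tables lam mu).
           poly_fun (fs k)
         \<and> (\<exists>T\<in>tables lam mu. fs k T \<noteq> 0)
         \<and> (\<exists>c. \<forall>T\<in>tables lam mu. (\<Sum>T'\<in>tables lam mu. rt_chain lam mu T T' * fs k T') = c * fs k T))
      \<and> (\<forall>k < card (tables lam mu). \<forall>l < card (tables lam mu). k \<noteq> l \<longrightarrow>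
           (\<Sum>T\<in>tables lam mu. fisher_yates lam mu T * fs k T * fs l T) = 0))"
proof -
  define S where "S = tables lam mu"
  define N where "N = card S"
  interpret reversible_operator S "fisher_yates lam mu" "swap_op n n"
    unfolding S_def by (rule reversible_operator_swap_op[OF assms(2,3)])
  define c where "c \<rho> = content_sum n (list_fun \<rho>)" for \<rho>
  define m where "m \<rho> = kostka \<rho> lam * kostka \<rho> mu" for \<rho>
  have fin_part: "finite (partitions n)"
    using bij_betw_finite[OF bij_betw_list_fun] finite_part_fun by blast
  have part: "is_partition n \<rho>" if "\<rho> \<in> partitions n" for \<rho> using that by (simp add: partitions_def)
  have tr: "op_trace S (swap_op n n ^^ k) = (\<Sum>\<rho>\<in>partitions n. real (m \<rho>) * c \<rho> ^ k)" for k
  proof -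
    have "S = margin_tables n n (list_fun lam) (list_fun mu)"
      unfolding S_def by (rule tables_eq_margin_tables) (use list_fun_part_fun(2) assms in auto)
    then have "op_trace S (swap_op n n ^^ k) =
      (\<Sum>\<rho>\<in>part_fun n. content_sum n \<rho> ^ k * real (kostka_count (list_fun lam) n \<rho>)
          * real (kostka_count (list_fun mu) n \<rho>))"
      using swap_trace_kostka[OF list_fun_part_fun(1)[OF assms(2)] list_fun_part_fun(1)[OF assms(3)], of k]
      by (simp add: swap_trace_def)
    also have "\<dots> = (\<Sum>\<rho>\<in>partitions n. c \<rho> ^ k * real (kostka_count (list_fun lam) n (list_fun \<rho>))
        * real (kostka_count (list_fun mu) n (list_fun \<rho>)))"
      unfolding c_def by (rule sum.reindex_bij_betw[OF bij_betw_list_fun, symmetric])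
    also have "\<dots> = (\<Sum>\<rho>\<in>partitions n. real (m \<rho>) * c \<rho> ^ k)"
      using assms part by (intro sum.cong refl) (simp add: m_def kostka_kostka_count[of n])
    finally show ?thesis .
  qed
  obtain f d where f: "orthogonal_family N f"
    and d: "\<And>k T. k < N \<Longrightarrow> T \<in> S \<Longrightarrow> swap_op n n (f k) T = d k * f k T"
    and mult: "\<And>x. card {k \<in> {..<N}. d k = x} = (\<Sum>\<rho> | \<rho> \<in> partitions n \<and> c \<rho> = x. m \<rho>)"
    by (rule eigenbasis_from_traces[OF tr fin_part, folded N_def]) (rule that; assumption)
  define e where "e x = (real n + x) / (real n)\<^sup>2" for x
  have eig: "(\<Sum>T'\<in>S. rt_chain lam mu T T' * f k T') = e (d k) * f k T" if "k < N" "T \<in> S" for k T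
    using rt_chain_swap_op[OF assms, of T "f k"] that d by (simp add: S_def e_def algebra_simps)
  have beta: "beta n \<rho> = e (c \<rho>)" if "\<rho> \<in> partitions n" for \<rho>
    using beta_content[OF assms(1) part[OF that]] by (simp add: e_def c_def)
  \<comment> \<open>The value \<open>d k\<close> is attained, so its multiplicity is positive and
    some partition must account for it.\<close>
  have dc: "\<exists>\<rho>\<in>partitions n. d k = c \<rho>" if "k < N" for k
  proof -
    have "0 < card {j \<in> {..<N}. d j = d k}" using that by (subst card_gt_0_iff) auto
    then have "(\<Sum>\<rho> | \<rho> \<in> partitions n \<and> c \<rho> = d k. m \<rho>) \<noteq> 0" using mult by simp
    then obtain \<rho> where "\<rho> \<in> partitions n" "c \<rho> = d k"
      by (rule sum.not_neutral_contains_not_neutral) auto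
    then show ?thesis by metis
  qed
  have spectrum: "\<exists>\<rho>. is_partition n \<rho> \<and> z = of_real (beta n \<rho>)"
    if g: "\<exists>T\<in>S. g T \<noteq> 0"
      and z: "\<forall>T\<in>S. (\<Sum>T'\<in>S. of_real (rt_chain lam mu T T') * g T') = z * g T" for z :: complex and g
  proof -
    obtain k where k: "k < N" "z = of_real (e (d k))"
      using complex_eigenvalue_of_orthogonal_eigenbasis[OF f[unfolded N_def] eig[unfolded N_def] g, of z] z
      by (auto simp: N_def)
    obtain \<rho> where "\<rho> \<in> partitions n" "d k = c \<rho>" using dc[OF k(1)] by auto
    then show ?thesis using k beta part by metis
  qed
  have charpoly: "char_poly (mat (length xs) (length xs) (\<lambda>(a, b). rt_chain lam mu (xs ! a) (xs ! b)))
      = (\<Prod>\<rho>\<in>partitions n. [:- beta n \<rho>, 1:] ^ (kostka \<rho> lam * kostka \<rho> mu))"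
    if "distinct xs" "set xs = S" for xs
  proof -
    have "char_poly (mat (length xs) (length xs) (\<lambda>(a, b). rt_chain lam mu (xs ! a) (xs ! b)))
      = (\<Prod>k<N. [:- e (d k), 1:])"
      unfolding N_def
      by (rule char_poly_of_orthogonal_eigenbasis[OF f[unfolded N_def] that eig[unfolded N_def]])
    also have "\<dots> = (\<Prod>\<rho>\<in>partitions n. [:- e (c \<rho>), 1:] ^ m \<rho>)"
      by (rule prod_by_multiplicities[where d = d and c = c and m = m and g
          = "\<lambda>x. [:- e x, 1:]"]) (use fin_part mult in auto)
    finally show ?thesis using beta by (simp add: m_def)
  qed
  have eigenfunctions: "\<exists>fs :: nat \<Rightarrow> table \<Rightarrow> real.
        (\<forall>k < N. poly_fun (fs k) \<and> (\<exists>T\<in>S. fs k T \<noteq> 0)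
         \<and> (\<exists>c. \<forall>T\<in>S. (\<Sum>T'\<in>S. rt_chain lam mu T T' * fs k T') = c * fs k T))
      \<and> (\<forall>k < N. \<forall>l < N. k \<noteq> l \<longrightarrow> (\<Sum>T\<in>S. fisher_yates lam mu T * fs k T * fs l T) = 0)"
  proof -
    \<comment> \<open>The chain and the inner product see functions only through their values on
      \<open>S\<close>, so each eigenfunction may be replaced by an interpolating
      polynomial.\<close>
    have "\<exists>fs. \<forall>k. poly_fun (fs k) \<and> (\<forall>T\<in>S. fs k T = f k T)"
      by (rule choice) (use poly_fun_interpolation[OF fin] in blast)
    then obtain fs where fs: "\<And>k. poly_fun (fs k)" "\<And>k T. T \<in> S \<Longrightarrow> fs k T = f k T"
      by blast
    have "(\<Sum>T\<in>S. fisher_yates lam mu T * fs k T * fs l T) = 0" if "k < N" "l < N" "k \<noteq> l" for k l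
      using f that by (simp add: fs orthogonal_family_def inner_prod_def)
    moreover have "\<exists>T\<in>S. fs k T \<noteq> 0" if "k < N" for k
      using f that by (auto simp: fs orthogonal_family_def)
    moreover have "\<exists>c. \<forall>T\<in>S. (\<Sum>T'\<in>S. rt_chain lam mu T T' * fs k T') = c * fs k T" if "k < N" for k
      using eig[OF that] by (auto simp: fs)
    ultimately show ?thesis using fs(1) by blast
  qed
  show ?thesis
    unfolding S_def[symmetric] N_def[symmetric]
  proof (rule conjI, goal_cases)
    case 1
    show ?case using spectrum by (intro allI impI) (elim conjE)
  next
    case 2
    show ?case
    proof (rule conjI, goal_cases)
      case 1
      show ?case by (intro allI impI, elim conjE) (rule charpoly)
    next
      case 2
      show ?case by (rule eigenfunctions)
    qed
  qed
qed

end
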